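(* Let $\Omega\subset\mathbb{R}^n$ be a bounded open set, $g\in W^{1,\infty}(\Omega)$, and let $u\in C(\bar\Omega)$ be a viscosity solution of $\Delta_\infty u-|Du|^2=0$ in $\Omega$ with $u=g$ on $\partial\Omega$. Then: (i) $u$ is not the absolute minimizer (for $H(p,z)=\frac12|p|^2-z$ in $\Omega$ with boundary value $g$) if and only if the graph of $u$ has a well; (ii) $u$ is not the continuum value function (with boundary value $g$) if and only if the graph of $u$ has a flat piece. In particular, $u$ is an intermediate solution, i.e. neither the absolute minimizer nor the continuum value function, if and only if its graph has both a well and a flat piece.
   Context: $\Delta_\infty u=\sum_{i,j=1}^n u_{x_i}u_{x_j}u_{x_ix_j}$; viscosity solutions in the Crandall–Ishii–Lions sense. An absolute minimizer for $H$ in $\Omega$ is $w\in W^{1,\infty}_{loc}(\Omega)$ such that for every open $V$ with $\bar V\subset\Omega$ and $f\in W^{1,\infty}(V)$ with $w=f$ on $\partial V$, $\operatorname{ess\,sup}_V(\frac12|Dw|^2-w)\le\operatorname{ess\,sup}_V(\frac12|Df|^2-f)$; there is a unique such $w\in C(\bar\Omega)$ with $w=g$ on $\partial\Omega$, called "the absolute minimizer". The continuum value function is the unique viscosity solution $v\in C(\bar\Omega)$ of $\frac{\Delta_\infty v}{|Dv|^2}=1$ in $\Omega$, $v=g$ on $\partial\Omega$, where this equation is understood as follows: if $\phi\in C^2$ and $v-\phi$ has a local maximum (resp. minimum) at $x$, then $\frac{\Delta_\infty\phi(x)}{|D\phi(x)|^2}\ge1$ (resp. $\le1$) when $D\phi(x)\ne0$,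 and $\max_{|p|=1}p\cdot D^2\phi(x)p\ge1$ (resp. $\min_{|p|=1}p\cdot D^2\phi(x)p\le1$) when $D\phi(x)=0$. The graph of $f\in C(\bar\Omega)$ has a well if there is an open set $V\subset\Omega$ with $\min_{\bar V}f<\min_{\partial V}f$; it has a flat piece if $f$ is constant on some nonempty open subset of $\Omega$. *)

theory Defs
  imports "HOL-Analysis.Analysis" "HOL-Probability.Essential_Supremum"
begin

definition C1c_test :: "'a::euclidean_space set \<Rightarrow> ('a \<Rightarrow> real) \<Rightarrow> ('a \<Rightarrow> 'a) \<Rightarrow> bool" where
  "C1c_test V phi Dphi \<longleftrightarrow>
     (\<forall>x. (phi has_derivative (\<lambda>h. Dphi x \<bullet> h)) (at x)) \<and> continuous_on UNIV Dphi \<and>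
     compact (closure {x. phi x \<noteq> 0}) \<and> closure {x. phi x \<noteq> 0} \<subseteq> V"

definition weak_grad :: "'a::euclidean_space set \<Rightarrow> ('a \<Rightarrow> real) \<Rightarrow> ('a \<Rightarrow> 'a) \<Rightarrow> bool" where
  "weak_grad V f G \<longleftrightarrow>
     set_borel_measurable lborel V f \<and> set_borel_measurable lborel V G \<and>
     (\<forall>K. compact K \<and> K \<subseteq> V \<longrightarrow> set_integrable lborel K f \<and> set_integrable lborel K G) \<and>
     (\<forall>phi Dphi. C1c_test V phi Dphi \<longrightarrow>
        (\<forall>v. (LINT x:V|lborel. f x * (Dphi x \<bullet> v)) = - (LINT x:V|lborel. (G x \<bullet> v) * phi x)))"

definition W1inf :: "'a::euclidean_space set \<Rightarrow> ('a \<Rightarrow> real) \<Rightarrow> bool" where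
  "W1inf V f \<longleftrightarrow>
     set_borel_measurable lborel V f \<and> (\<exists>M. AE x in lborel. x \<in> V \<longrightarrow> \<bar>f x\<bar> \<le> M) \<and>
     (\<exists>G. weak_grad V f G \<and> (\<exists>M. AE x in lborel. x \<in> V \<longrightarrow> norm (G x) \<le> M))"

definition W1inf_loc :: "'a::euclidean_space set \<Rightarrow> ('a \<Rightarrow> real) \<Rightarrow> bool" where
  "W1inf_loc \<Omega> f \<longleftrightarrow> (\<forall>V. open V \<and> compact (closure V) \<and> closure V \<subseteq> \<Omega> \<longrightarrow> W1inf V f)"

definition ess_H :: "'a::euclidean_space set \<Rightarrow> ('a \<Rightarrow> real) \<Rightarrow> ('a \<Rightarrow> 'a) \<Rightarrow> ereal" where
  "ess_H V f G = esssup (restrict_space lborel V) (\<lambda>x. ereal ((1/2) * (norm (G x))\<^sup>2 - f x))"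

definition abs_minimizer :: "'a::euclidean_space set \<Rightarrow> ('a \<Rightarrow> real) \<Rightarrow> bool" where
  "abs_minimizer \<Omega> w \<longleftrightarrow> W1inf_loc \<Omega> w \<and>
     (\<forall>V f. open V \<and> compact (closure V) \<and> closure V \<subseteq> \<Omega> \<and> W1inf V f \<and> continuous_on (closure V) f \<and>
        (\<forall>x\<in>frontier V. w x = f x) \<longrightarrow>
        (\<forall>Gw Gf. weak_grad V w Gw \<and> weak_grad V f Gf \<longrightarrow> ess_H V w Gw \<le> ess_H V f Gf))"

definition is_the_abs_minimizer :: "'a::euclidean_space set \<Rightarrow> ('a \<Rightarrow> real) \<Rightarrow> ('a \<Rightarrow> real) \<Rightarrow> bool" where
  "is_the_abs_minimizer \<Omega> g w \<longleftrightarrow> continuous_on (closure \<Omega>) w \<and> (\<forall>x\<in>frontier \<Omega>. w x = g x) \<and> abs_minimizer \<Omega> w"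

definition C2_on :: "'a::euclidean_space set \<Rightarrow> ('a \<Rightarrow> real) \<Rightarrow> ('a \<Rightarrow> 'a) \<Rightarrow> ('a \<Rightarrow> 'a \<Rightarrow> 'a) \<Rightarrow> bool" where
  "C2_on S phi Dphi D2phi \<longleftrightarrow>
     (\<forall>x\<in>S. (phi has_derivative (\<lambda>h. Dphi x \<bullet> h)) (at x)) \<and>
     (\<forall>x\<in>S. (Dphi has_derivative D2phi x) (at x)) \<and>
     (\<forall>h. continuous_on S (\<lambda>x. D2phi x h))"

definition loc_max_at :: "'a::euclidean_space set \<Rightarrow> ('a \<Rightarrow> real) \<Rightarrow> 'a \<Rightarrow> bool" where
  "loc_max_at S f x \<longleftrightarrow> (\<exists>e>0. \<forall>y\<in>S. dist y x < e \<longrightarrow> f y \<le> f x)"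

definition loc_min_at :: "'a::euclidean_space set \<Rightarrow> ('a \<Rightarrow> real) \<Rightarrow> 'a \<Rightarrow> bool" where
  "loc_min_at S f x \<longleftrightarrow> (\<exists>e>0. \<forall>y\<in>S. dist y x < e \<longrightarrow> f y \<ge> f x)"

definition inf_lap :: "('a::euclidean_space \<Rightarrow> 'a) \<Rightarrow> ('a \<Rightarrow> 'a \<Rightarrow> 'a) \<Rightarrow> 'a \<Rightarrow> real" where
  "inf_lap Dphi D2phi x = Dphi x \<bullet> D2phi x (Dphi x)"

definition visc_sol_inflap_grad :: "'a::euclidean_space set \<Rightarrow> ('a \<Rightarrow> real) \<Rightarrow> bool" where
  "visc_sol_inflap_grad \<Omega> u \<longleftrightarrow> continuous_on \<Omega> u \<and>
     (\<forall>phi Dphi D2phi x. C2_on \<Omega> phi Dphi D2phi \<and> x \<in> \<Omega> \<and> loc_max_at \<Omega> (\<lambda>y. u y - phi y) x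
        \<longrightarrow> inf_lap Dphi D2phi x - (norm (Dphi x))\<^sup>2 \<ge> 0) \<and>
     (\<forall>phi Dphi D2phi x. C2_on \<Omega> phi Dphi D2phi \<and> x \<in> \<Omega> \<and> loc_min_at \<Omega> (\<lambda>y. u y - phi y) x
        \<longrightarrow> inf_lap Dphi D2phi x - (norm (Dphi x))\<^sup>2 \<le> 0)"

definition visc_sol_normalized :: "'a::euclidean_space set \<Rightarrow> ('a \<Rightarrow> real) \<Rightarrow> bool" where
  "visc_sol_normalized \<Omega> v \<longleftrightarrow> continuous_on \<Omega> v \<and>
     (\<forall>phi Dphi D2phi x. C2_on \<Omega> phi Dphi D2phi \<and> x \<in> \<Omega> \<and> loc_max_at \<Omega> (\<lambda>y. v y - phi y) x
        \<longrightarrow> (if Dphi x \<noteq> 0 then inf_lap Dphi D2phi x / (norm (Dphi x))\<^sup>2 \<ge> 1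
             else (\<exists>p. norm p = 1 \<and> (\<forall>q. norm q = 1 \<longrightarrow> q \<bullet> D2phi x q \<le> p \<bullet> D2phi x p) \<and> p \<bullet> D2phi x p \<ge> 1))) \<and>
     (\<forall>phi Dphi D2phi x. C2_on \<Omega> phi Dphi D2phi \<and> x \<in> \<Omega> \<and> loc_min_at \<Omega> (\<lambda>y. v y - phi y) x
        \<longrightarrow> (if Dphi x \<noteq> 0 then inf_lap Dphi D2phi x / (norm (Dphi x))\<^sup>2 \<le> 1
             else (\<exists>p. norm p = 1 \<and> (\<forall>q. norm q = 1 \<longrightarrow> p \<bullet> D2phi x p \<le> q \<bullet> D2phi x q) \<and> p \<bullet> D2phi x p \<le> 1)))"

definition is_the_cont_value_fn :: "'a::euclidean_space set \<Rightarrow> ('a \<Rightarrow> real) \<Rightarrow> ('a \<Rightarrow> real) \<Rightarrow> bool" where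
  "is_the_cont_value_fn \<Omega> g v \<longleftrightarrow> continuous_on (closure \<Omega>) v \<and> (\<forall>x\<in>frontier \<Omega>. v x = g x) \<and> visc_sol_normalized \<Omega> v"

definition has_well :: "'a::euclidean_space set \<Rightarrow> ('a \<Rightarrow> real) \<Rightarrow> bool" where
  "has_well \<Omega> f \<longleftrightarrow> (\<exists>V. open V \<and> V \<noteq> {} \<and> V \<subseteq> \<Omega> \<and>
      (INF x\<in>closure V. f x) < (INF x\<in>frontier V. f x))"

definition has_flat_piece :: "'a::euclidean_space set \<Rightarrow> ('a \<Rightarrow> real) \<Rightarrow> bool" where
  "has_flat_piece \<Omega> f \<longleftrightarrow> (\<exists>U c. open U \<and> U \<noteq> {} \<and> U \<subseteq> \<Omega> \<and> (\<forall>x\<in>U. f x = c))"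

end

theory Submission
  imports Defs
begin

text \<open>
  The equation is compared with the radial solutions \<open>c + b r + r\<^sup>2 / 2\<close>, on which
  \<open>|Dw|\<^sup>2 / 2 - w\<close> is constant; equivalently, \<open>sqrt (2 * (w + A))\<close> is a cone of slope one.

  (i) In a well, a sublevel set \<open>{u < c}\<close> with the constant competitor \<open>c\<close> violates absolute minimality.
  If there is no well and the competitor \<open>f\<close> has energy at most \<open>k\<close> on \<open>V\<close>, then \<open>- k \<le> f\<close>, hence
  \<open>- k \<le> u\<close>, and \<open>sqrt (2 * (f + k))\<close> is 1-Lipschitz along segments. If \<open>sqrt (2 * (u + A))\<close> with
  \<open>A > k\<close> were steeper than slope one at some point, comparison with cones would yield a discrete
  gradient flow through this point that reaches the boundary of \<open>V\<close> in both directions and gains at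
  least its length, which is more than the competitor can do.

  (ii) A smooth test function with vanishing gradient that violates the normalized equation can be replaced by
  a paraboloid \<open>a * |x - y|\<^sup>2\<close>; sliding its vertex \<open>y\<close> shows that it touches \<open>u\<close> only at the
  vertex, so \<open>u\<close> has quadratic increments and is locally constant.
\<close>

section \<open>Viscosity subsolutions and cones\<close>

text \<open>Where a touching function has zero gradient the equation says nothing, so barriers must
  have a nonvanishing gradient. This is the origin of the guards
  \<open>b + \<sigma> * R > 0\<close>: the radial function
  \<open>c + b * r + \<sigma> / 2 * r\<^sup>2\<close> has to increase up to radius \<open>R\<close>.
  For \<open>- u\<close> it increases only up to \<open>r = b\<close>. The strict gap
  \<open>k < A\<close> keeps the downward flow away from that radius, because
  \<open>sqrt (2 * (u + A))\<close> never falls below \<open>sqrt (2 * (A - k))\<close>. The same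
  gap makes the final comparison strict: on the boundary the transforms \<open>w\<close> of
  \<open>u\<close> and \<open>F\<close> of the competitor satisfy
  \<open>w\<^sup>2 = F\<^sup>2 + 2 * (A - k)\<close>, and the map from \<open>F\<close> to
  \<open>w\<close> strictly shortens distances. A second obstacle is that \<open>u\<close> is merely
  continuous, whereas energies are essential suprema over weak gradients. Two translations bridge
  this: a local Lipschitz constant bounds the weak gradient almost everywhere, and a bounded weak
  gradient makes a continuous function Lipschitz on balls. The square root is treated on balls on
  which it is nearly constant, in place of a chain rule.\<close>

text \<open>The two one-sided conditions on \<open>u\<close> are the cases \<open>\<sigma> = 1\<close> for \<open>u\<close> and \<open>\<sigma> = -1\<close> for \<open>- u\<close>.\<close>

definition gsub :: "real \<Rightarrow> 'a::euclidean_space set \<Rightarrow> ('a \<Rightarrow> real) \<Rightarrow> bool" where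
  "gsub \<sigma> \<Omega> v \<longleftrightarrow> continuous_on \<Omega> v \<and>
     (\<forall>phi Dphi D2phi x. C2_on \<Omega> phi Dphi D2phi \<and> x \<in> \<Omega> \<and> loc_max_at \<Omega> (\<lambda>y. v y - phi y) x
        \<longrightarrow> \<sigma> * (norm (Dphi x))\<^sup>2 \<le> inf_lap Dphi D2phi x)"

lemma gsub_if_visc_sol:
  assumes "visc_sol_inflap_grad \<Omega> u"
  shows "gsub 1 \<Omega> u"
  using assms unfolding visc_sol_inflap_grad_def gsub_def by fastforce

lemma C2_on_uminus:
  assumes "C2_on S phi Dphi D2phi"
  shows "C2_on S (\<lambda>x. - phi x) (\<lambda>x. - Dphi x) (\<lambda>x h. - D2phi x h)"
  using assms unfolding C2_on_def inner_minus_left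
  by (auto intro!: continuous_on_minus has_derivative_minus)

text \<open>The infinity Laplacian is cubic in the test function, hence odd, whereas the squared
  gradient is even; this is why \<open>- u\<close> satisfies the condition with
  \<open>\<sigma> = -1\<close>.\<close>

lemma inf_lap_uminus:
  assumes "C2_on S phi Dphi D2phi" "x \<in> S"
  shows "inf_lap (\<lambda>x. - Dphi x) (\<lambda>x h. - D2phi x h) x = - inf_lap Dphi D2phi x"
proof -
  have "linear (D2phi x)"
    using assms by (auto simp: C2_on_def intro: has_derivative_linear)
  then show ?thesis
    by (simp add: inf_lap_def linear_neg)
qed

lemma gsub_uminus_if_visc_sol:
  assumes "visc_sol_inflap_grad \<Omega> u"
  shows "gsub (-1) \<Omega> (\<lambda>x. - u x)"
  unfolding gsub_def
proof (intro conjI allI impI)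
  show "continuous_on \<Omega> (\<lambda>x. - u x)"
    using assms by (auto simp: visc_sol_inflap_grad_def intro: continuous_on_minus)
  fix phi Dphi D2phi x
  assume *: "C2_on \<Omega> phi Dphi D2phi \<and> x \<in> \<Omega> \<and> loc_max_at \<Omega> (\<lambda>y. - u y - phi y) x"
  have "loc_min_at \<Omega> (\<lambda>y. u y - - phi y) x"
  proof -
    obtain e where "e > 0" "\<And>y. y \<in> \<Omega> \<Longrightarrow> dist y x < e \<Longrightarrow> - u y - phi y \<le> - u x - phi x"
      using * unfolding loc_max_at_def by blast
    then show ?thesis
      unfolding loc_min_at_def by (intro exI[of _ e]) force
  qed
  moreover have "C2_on \<Omega> (\<lambda>x. - phi x) (\<lambda>x. - Dphi x) (\<lambda>x h. - D2phi x h)"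
    using * C2_on_uminus by blast
  ultimately have "inf_lap (\<lambda>x. - Dphi x) (\<lambda>x h. - D2phi x h) x - (norm (- Dphi x))\<^sup>2 \<le> 0"
    using assms * unfolding visc_sol_inflap_grad_def by fast
  then show "-1 * (norm (Dphi x))\<^sup>2 \<le> inf_lap Dphi D2phi x"
    using inf_lap_uminus[of \<Omega> phi Dphi D2phi x] * by simp
qed

text \<open>Profiles are composed with the squared distance, which is smooth at the centre as well,
  so \<open>y\<close> needs no separate treatment.\<close>

lemma C2_on_radial:
  fixes y :: "'a::euclidean_space"
  assumes d1: "\<And>s. (\<psi> has_real_derivative \<psi>' s) (at s)"
    and d2: "\<And>s. (\<psi>' has_real_derivative \<psi>'' s) (at s)"
    and c: "continuous_on UNIV \<psi>''"
  shows "C2_on S (\<lambda>z. \<psi> ((z - y) \<bullet> (z - y))) (\<lambda>z. (2 * \<psi>' ((z - y) \<bullet> (z - y))) *\<^sub>R (z - y))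
     (\<lambda>z h. (2 * \<psi>' ((z - y) \<bullet> (z - y))) *\<^sub>R h + (4 * \<psi>'' ((z - y) \<bullet> (z - y)) * ((z - y) \<bullet> h)) *\<^sub>R (z - y))"
  unfolding C2_on_def
proof (intro conjI ballI allI)
  have s: "((\<lambda>z. (z - y) \<bullet> (z - y)) has_derivative (\<lambda>h. 2 * ((x - y) \<bullet> h))) (at x)" for x
    by (auto intro!: derivative_eq_intros simp: inner_commute)
  show "((\<lambda>z. \<psi> ((z - y) \<bullet> (z - y))) has_derivative (\<lambda>h. ((2 * \<psi>' ((x - y) \<bullet> (x - y))) *\<^sub>R (x - y)) \<bullet> h)) (at x)" for x
    by (rule has_derivative_eq_rhs[OF DERIV_compose_FDERIV[OF d1 s]]) (auto simp: fun_eq_iff)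
  have p: "((\<lambda>z. \<psi>' ((z - y) \<bullet> (z - y))) has_derivative (\<lambda>h. 2 * ((x - y) \<bullet> h) * \<psi>'' ((x - y) \<bullet> (x - y)))) (at x)" for x
    by (rule DERIV_compose_FDERIV[OF d2 s])
  show "((\<lambda>z. (2 * \<psi>' ((z - y) \<bullet> (z - y))) *\<^sub>R (z - y)) has_derivative
      (\<lambda>h. (2 * \<psi>' ((x - y) \<bullet> (x - y))) *\<^sub>R h + (4 * \<psi>'' ((x - y) \<bullet> (x - y)) * ((x - y) \<bullet> h)) *\<^sub>R (x - y))) (at x)" for x
    by (rule has_derivative_eq_rhs) (rule derivative_eq_intros p refl | simp add: fun_eq_iff algebra_simps)+
  have c1: "continuous_on UNIV \<psi>'"
    using d2 by (meson DERIV_isCont continuous_at_imp_continuous_on)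
  show "continuous_on S (\<lambda>x. (2 * \<psi>' ((x - y) \<bullet> (x - y))) *\<^sub>R h + (4 * \<psi>'' ((x - y) \<bullet> (x - y)) * ((x - y) \<bullet> h)) *\<^sub>R (x - y))" for h
    by (intro continuous_intros continuous_on_compose2[OF c] continuous_on_compose2[OF c1]) auto
qed

text \<open>The right-hand side is the second derivative of \<open>\<psi> (r\<^sup>2)\<close> in
  \<open>r\<close>, the only part of the Hessian seen in the gradient direction. The factor
  \<open>(norm (Dphi x))\<^sup>2\<close> cancels; \<open>x \<noteq> y\<close> and the nonzero
  \<open>\<psi>'\<close> make it positive.\<close>

lemma gsub_radial:
  assumes v: "gsub \<sigma> \<Omega> v" and x: "x \<in> \<Omega>" "x \<noteq> y"
    and d1: "\<And>s. (\<psi> has_real_derivative \<psi>' s) (at s)"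
    and d2: "\<And>s. (\<psi>' has_real_derivative \<psi>'' s) (at s)"
    and c: "continuous_on UNIV \<psi>''"
    and m: "loc_max_at \<Omega> (\<lambda>z. v z - \<psi> ((z - y) \<bullet> (z - y))) x"
    and nz: "\<psi>' ((x - y) \<bullet> (x - y)) \<noteq> 0"
  shows "\<sigma> \<le> 2 * \<psi>' ((x - y) \<bullet> (x - y)) + 4 * \<psi>'' ((x - y) \<bullet> (x - y)) * ((x - y) \<bullet> (x - y))"
proof -
  define s where "s = (x - y) \<bullet> (x - y)"
  have s0: "s > 0" using x by (simp add: s_def)
  define p q where "p = \<psi>' s" and "q = \<psi>'' s"
  have "\<sigma> * (norm ((2 * p) *\<^sub>R (x - y)))\<^sup>2 \<le>
     ((2 * p) *\<^sub>R (x - y)) \<bullet> ((2 * p) *\<^sub>R ((2 * p) *\<^sub>R (x - y)) + (4 * q * ((x - y) \<bullet> ((2 * p) *\<^sub>R (x - y)))) *\<^sub>R (x - y))"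
    using v[unfolded gsub_def, THEN conjunct2, rule_format,
        OF conjI[OF C2_on_radial[OF d1 d2 c] conjI[OF x(1) m]]]
    by (simp add: inf_lap_def s_def p_def q_def)
  moreover have "(norm ((2 * p) *\<^sub>R (x - y)))\<^sup>2 = 4 * p\<^sup>2 * s"
    unfolding power2_norm_eq_inner inner_scaleR_left inner_scaleR_right s_def by (simp add: power2_eq_square)
  moreover have "((2 * p) *\<^sub>R (x - y)) \<bullet> ((2 * p) *\<^sub>R ((2 * p) *\<^sub>R (x - y)) + (4 * q * ((x - y) \<bullet> ((2 * p) *\<^sub>R (x - y)))) *\<^sub>R (x - y))
     = 4 * p\<^sup>2 * s * (2 * p + 4 * q * s)"
    unfolding inner_add_right inner_scaleR_left inner_scaleR_right s_def[symmetric]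
    by (simp add: power2_eq_square algebra_simps)
  ultimately have "(4 * p\<^sup>2 * s) * \<sigma> \<le> (4 * p\<^sup>2 * s) * (2 * p + 4 * q * s)"
    by (simp add: mult.commute)
  moreover have "4 * p\<^sup>2 * s > 0" using s0 nz by (simp add: p_def s_def)
  ultimately have "\<sigma> \<le> 2 * p + 4 * q * s"
    using mult_le_cancel_left_pos by blast
  then show ?thesis by (simp add: p_def q_def s_def)
qed

text \<open>The Taylor polynomial of the square root at 1 touches it from above, which makes cones admissible:
  test functions have to be smooth on all of \<open>\<Omega>\<close>, also at the vertex.\<close>

lemma sqrt_le_cubic:
  fixes q :: real
  assumes "q \<ge> 0"
  shows "q \<le> 1 + (q\<^sup>2 - 1) / 2 - (q\<^sup>2 - 1)\<^sup>2 / 8 + (q\<^sup>2 - 1)^3 / 16"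
proof -
  have "1 + (q\<^sup>2 - 1) / 2 - (q\<^sup>2 - 1)\<^sup>2 / 8 + (q\<^sup>2 - 1)^3 / 16 - q = (q - 1)^4 * (q\<^sup>2 + 4 * q + 5) / 16"
    by (simp add: field_simps power2_eq_square power3_eq_cube power4_eq_xxxx)
  moreover have "(q - 1)^4 * (q\<^sup>2 + 4 * q + 5) / 16 \<ge> 0"
    using assms by simp
  ultimately show ?thesis by linarith
qed

text \<open>Reducing the curvature from \<open>\<sigma>\<close> to \<open>\<sigma> - e\<close> makes
  the cone a strict supersolution, so \<open>v\<close> minus the cone has no interior maximum away
  from the vertex. The lift by \<open>e * R\<^sup>2 / 2\<close> compensates the reduction on the
  sphere and raises the cone strictly above \<open>v\<close> at the vertex.\<close>

lemma cone_comparison: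
  assumes v: "gsub \<sigma> \<Omega> v" and ball: "cball y R \<subseteq> \<Omega>" and R: "R > 0"
    and b: "b \<ge> 0" "b + \<sigma> * R > 0"
    and bd: "\<And>x. x \<in> sphere y R \<Longrightarrow> v x \<le> v y + b * R + \<sigma> / 2 * R\<^sup>2"
    and x1: "x1 \<in> cball y R"
  shows "v x1 \<le> v y + b * dist x1 y + \<sigma> / 2 * (dist x1 y)\<^sup>2"
proof (rule ccontr)
  assume "\<not> ?thesis"
  then have gap: "v x1 - (v y + b * dist x1 y + \<sigma> / 2 * (dist x1 y)\<^sup>2) > 0" (is "?g > 0") by simp
  \<comment> \<open>The first bound keeps the radial derivative of the perturbed cone positive up to
    \<open>R\<close>; by the second, the lift costs at most half of the violation at
    \<open>x1\<close>.\<close>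
  define e where "e = min ((b + \<sigma> * R) / (2 * R)) (?g / R\<^sup>2)"
  have e0: "e > 0" using gap b R by (simp add: e_def)
  have "e * R \<le> (b + \<sigma> * R) / 2"
    using R by (simp add: e_def min_def field_simps)
  then have e1: "b + (\<sigma> - e) * R > 0"
    using b by (simp add: algebra_simps)
  have e2: "e * R\<^sup>2 \<le> ?g"
    using R by (simp add: e_def min_def field_simps)
  define \<phi> where "\<phi> x = v y + b * dist x y + (\<sigma> - e) / 2 * (dist x y)\<^sup>2 + e * R\<^sup>2 / 2" for x
  have vc: "continuous_on (cball y R) v"
    using v ball unfolding gsub_def by (metis continuous_on_subset)
  have "continuous_on (cball y R) (\<lambda>x. v x - \<phi> x)"
    unfolding \<phi>_def by (intro continuous_intros vc)
  then obtain x where x: "x \<in> cball y R" and mx: "\<And>z. z \<in> cball y R \<Longrightarrow> v z - \<phi> z \<le> v x - \<phi> x"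
    using continuous_attains_sup[of "cball y R" "\<lambda>x. v x - \<phi> x"] R by (auto simp: cball_eq_empty)
  have "v x1 - \<phi> x1 = ?g + e / 2 * (dist x1 y)\<^sup>2 - e * R\<^sup>2 / 2"
    by (simp add: \<phi>_def algebra_simps diff_divide_distrib)
  moreover have "e / 2 * (dist x1 y)\<^sup>2 \<ge> 0" using e0 by simp
  ultimately have "v x1 - \<phi> x1 > 0" using e2 gap by linarith
  then have pos: "v x - \<phi> x > 0" using mx[OF x1] by linarith
  have xy: "x \<noteq> y"
  proof
    assume "x = y"
    then have "v x - \<phi> x = - (e * R\<^sup>2 / 2)" by (simp add: \<phi>_def)
    moreover have "e * R\<^sup>2 > 0" using e0 R by simp
    ultimately show False using pos by linarith
  qed
  have "dist x y \<noteq> R"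
  proof
    assume *: "dist x y = R"
    then have "v x \<le> v y + b * R + \<sigma> / 2 * R\<^sup>2" using bd[of x] by (simp add: dist_commute)
    moreover have "\<phi> x = v y + b * R + \<sigma> / 2 * R\<^sup>2" using * by (simp add: \<phi>_def field_simps)
    ultimately show False using pos by linarith
  qed
  then have xR: "dist x y < R" using x by (simp add: dist_commute less_le)
  define \<rho> where "\<rho> = dist x y"
  have \<rho>: "0 < \<rho>" "\<rho> < R" using xy xR by (auto simp: \<rho>_def)
  \<comment> \<open>The distance is replaced by its cubic majorant in \<open>s = r\<^sup>2\<close>,
    expanded at \<open>\<rho>\<^sup>2\<close>: it agrees with the distance to second order at
    \<open>x\<close> and is nowhere smaller, so \<open>x\<close> remains a maximum.\<close>
  define \<psi> where "\<psi> s = v y + b * \<rho> * (1 + (s/\<rho>\<^sup>2 - 1) / 2 - (s/\<rho>\<^sup>2 - 1)\<^sup>2 / 8 + (s/\<rho>\<^sup>2 - 1)^3 / 16)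
      + (\<sigma> - e) / 2 * s + e * R\<^sup>2 / 2" for s
  define \<psi>' where "\<psi>' s = b / \<rho> * (1/2 - (s/\<rho>\<^sup>2 - 1) / 4 + 3 * (s/\<rho>\<^sup>2 - 1)\<^sup>2 / 16) + (\<sigma> - e) / 2" for s
  define \<psi>'' where "\<psi>'' s = b / \<rho>^3 * (- 1/4 + 3 * (s/\<rho>\<^sup>2 - 1) / 8)" for s
  have d1: "(\<psi> has_real_derivative \<psi>' s) (at s)" for s
    unfolding \<psi>_def \<psi>'_def using \<rho>
    by (auto intro!: derivative_eq_intros simp: field_simps power2_eq_square power3_eq_cube)
  have d2: "(\<psi>' has_real_derivative \<psi>'' s) (at s)" for s
    unfolding \<psi>''_def \<psi>'_def using \<rho>
    by (auto intro!: derivative_eq_intros simp: field_simps power2_eq_square power3_eq_cube)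
  have c: "continuous_on UNIV \<psi>''"
    unfolding \<psi>''_def using \<rho> by (intro continuous_intros) auto
  have sq: "(z - y) \<bullet> (z - y) = (dist z y)\<^sup>2" for z by (simp add: dist_norm power2_norm_eq_inner)
  have le: "\<phi> z \<le> \<psi> ((z - y) \<bullet> (z - y))" for z
  proof -
    have "dist z y / \<rho> \<le> 1 + ((dist z y)\<^sup>2/\<rho>\<^sup>2 - 1) / 2 - ((dist z y)\<^sup>2/\<rho>\<^sup>2 - 1)\<^sup>2 / 8 + ((dist z y)\<^sup>2/\<rho>\<^sup>2 - 1)^3 / 16"
      using sqrt_le_cubic[of "dist z y / \<rho>"] \<rho> by (simp add: power_divide)
    from mult_left_mono[OF this, of "b * \<rho>"] show ?thesis
      unfolding \<phi>_def \<psi>_def sq using \<rho> b by simp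
  qed
  have eq: "\<phi> x = \<psi> ((x - y) \<bullet> (x - y))"
    unfolding \<phi>_def \<psi>_def sq using \<rho> by (simp add: \<rho>_def)
  have xin: "x \<in> \<Omega>" using x ball by auto
  have "loc_max_at \<Omega> (\<lambda>z. v z - \<psi> ((z - y) \<bullet> (z - y))) x"
    unfolding loc_max_at_def
  proof (intro exI[of _ "R - \<rho>"] conjI ballI impI)
    show "R - \<rho> > 0" using \<rho> by simp
    fix z assume "dist z x < R - \<rho>"
    then have "z \<in> cball y R"
      using dist_triangle[of z y x] by (simp add: \<rho>_def dist_commute)
    then show "v z - \<psi> ((z - y) \<bullet> (z - y)) \<le> v x - \<psi> ((x - y) \<bullet> (x - y))"
      using mx[of z] le[of z] eq by linarith
  qed
  moreover have p: "\<psi>' ((x - y) \<bullet> (x - y)) = b / \<rho> / 2 + (\<sigma> - e) / 2"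
    unfolding sq \<psi>'_def using \<rho> by (simp add: \<rho>_def)
  \<comment> \<open>The radial derivative is affine in the radius, nonnegative at \<open>0\<close>
    and positive at \<open>R\<close>.\<close>
  moreover have "b + (\<sigma> - e) * \<rho> > 0"
  proof -
    have "b + (\<sigma> - e) * \<rho> = (1 - \<rho> / R) * b + (\<rho> / R) * (b + (\<sigma> - e) * R)"
      using R by (simp add: field_simps)
    moreover have "(1 - \<rho> / R) * b \<ge> 0" using \<rho> R b by simp
    moreover have "(\<rho> / R) * (b + (\<sigma> - e) * R) > 0" using \<rho> R e1 by simp
    ultimately show ?thesis by linarith
  qed
  then have "b / \<rho> / 2 + (\<sigma> - e) / 2 \<noteq> 0" using \<rho> by (simp add: field_simps)
  ultimately have "\<sigma> \<le> 2 * \<psi>' ((x - y) \<bullet> (x - y)) + 4 * \<psi>'' ((x - y) \<bullet> (x - y)) * ((x - y) \<bullet> (x - y))"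
    using gsub_radial[OF v xin xy d1 d2 c] by simp
  also have "\<dots> = \<sigma> - e"
    unfolding p unfolding sq \<psi>''_def using \<rho> by (simp add: \<rho>_def[symmetric] field_simps power2_eq_square power3_eq_cube)
  finally show False using e0 by simp
qed

section \<open>Touching with vanishing gradient, and flat pieces\<close>

lemma quadratic_increment_imp_constant:
  fixes v :: "'a::euclidean_space \<Rightarrow> real"
  assumes "\<And>x y. x \<in> ball x0 d \<Longrightarrow> y \<in> ball x0 d \<Longrightarrow> v x - v y \<le> a * (dist x y)\<^sup>2" and d: "d > 0"
    and x: "x \<in> ball x0 d"
  shows "v x = v x0"
proof -
  have ab: "\<bar>v p - v q\<bar> \<le> \<bar>a\<bar> * (dist p q)\<^sup>2" if "p \<in> ball x0 d" "q \<in> ball x0 d" for p q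
  proof -
    have "v p - v q \<le> a * (dist p q)\<^sup>2" "v q - v p \<le> a * (dist p q)\<^sup>2"
      using assms(1)[of p q] assms(1)[of q p] that by (simp_all add: dist_commute)
    moreover have "a * (dist p q)\<^sup>2 \<le> \<bar>a\<bar> * (dist p q)\<^sup>2" by (intro mult_right_mono) auto
    ultimately show ?thesis by linarith
  qed
  have "(v has_derivative (\<lambda>h. 0)) (at y within ball x0 d)" if y: "y \<in> ball x0 d" for y
    unfolding has_derivative_within_alt
  proof (intro conjI allI impI)
    fix e :: real assume e: "e > 0"
    show "\<exists>d'>0. \<forall>z\<in>ball x0 d. norm (z - y) < d' \<longrightarrow> norm (v z - v y - 0) \<le> e * norm (z - y)"
    proof (intro exI[of _ "e / (\<bar>a\<bar> + 1)"] conjI ballI impI)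
      show "0 < e / (\<bar>a\<bar> + 1)" using e by simp
      fix z assume z: "z \<in> ball x0 d" "norm (z - y) < e / (\<bar>a\<bar> + 1)"
      then have "(\<bar>a\<bar> + 1) * norm (z - y) \<le> e" by (simp add: field_simps)
      moreover have "\<bar>a\<bar> * norm (z - y) \<le> (\<bar>a\<bar> + 1) * norm (z - y)" by (intro mult_right_mono) auto
      ultimately have "\<bar>a\<bar> * norm (z - y) \<le> e" by linarith
      from mult_right_mono[OF this, of "norm (z - y)"] show "norm (v z - v y - 0) \<le> e * norm (z - y)"
        using ab[OF z(1) y] by (simp add: dist_norm power2_eq_square algebra_simps)
    qed
  qed auto
  then obtain c where "\<And>y. y \<in> ball x0 d \<Longrightarrow> v y = c"
    using has_derivative_zero_constant[OF convex_ball, of x0 d v] by blast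
  then show ?thesis using x d by simp
qed

text \<open>Sliding the vertex of a paraboloid that is a strict supersolution away from its vertex:
  the touching point has to be the vertex itself, for every position of the vertex.\<close>

lemma gsub_below_paraboloid_imp_constant:
  assumes v: "gsub \<sigma> \<Omega> v" and r: "r > 0" "cball x0 r \<subseteq> \<Omega>"
    and a: "a' < a" "a \<noteq> 0" "2 * a < \<sigma>"
    and le: "\<And>x. x \<in> cball x0 r \<Longrightarrow> v x \<le> v x0 + a' * (dist x x0)\<^sup>2"
  obtains d where "d > 0" "d \<le> r" "\<And>x. x \<in> ball x0 d \<Longrightarrow> v x = v x0"
proof -
  \<comment> \<open>Moving the vertex by less than \<open>d\<close> changes the paraboloid on the
    sphere and at \<open>x0\<close> by at most \<open>4 * \<bar>a\<bar> * d * r\<close> in total.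
    This is less than the margin \<open>(a - a') * r\<^sup>2\<close> on the sphere, so the maximum
    is not attained there.\<close>
  define d where "d = min r ((a - a') * r / (6 * (\<bar>a\<bar> + 1)))"
  have d: "d > 0" "d \<le> r" using r a by (auto simp: d_def)
  have dd: "6 * (\<bar>a\<bar> + 1) * d \<le> (a - a') * r"
  proof -
    have "d \<le> (a - a') * r / (6 * (\<bar>a\<bar> + 1))" by (simp add: d_def)
    moreover have "6 * (\<bar>a\<bar> + 1) > 0" by simp
    ultimately show ?thesis by (simp only: pos_le_divide_eq) (simp only: mult.commute)
  qed
  have inc: "v x - v y \<le> a * (dist x y)\<^sup>2" if y: "y \<in> ball x0 d" and x: "x \<in> ball x0 d" for x y
  proof -
    have cv: "continuous_on (cball x0 r) v"
      using v r unfolding gsub_def by (metis continuous_on_subset)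
    have "continuous_on (cball x0 r) (\<lambda>z. v z - a * (dist z y)\<^sup>2)"
      by (intro continuous_intros cv)
    then obtain z where z: "z \<in> cball x0 r"
      and mz: "\<And>w. w \<in> cball x0 r \<Longrightarrow> v w - a * (dist w y)\<^sup>2 \<le> v z - a * (dist z y)\<^sup>2"
      using continuous_attains_sup[of "cball x0 r" "\<lambda>z. v z - a * (dist z y)\<^sup>2"] r by auto
    have yr: "dist x0 y < d" using y by simp
    have "dist x0 z \<noteq> r"
    proof
      assume zr: "dist x0 z = r"
      have 1: "v z \<le> v x0 + a' * r\<^sup>2" using le[of z] z zr by (simp add: dist_commute)
      have 2: "v x0 - a * (dist x0 y)\<^sup>2 \<le> v z - a * (dist z y)\<^sup>2" using mz[of x0] r by simp
      have 3: "\<bar>dist z y - r\<bar> \<le> dist x0 y"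
        using zr dist_triangle2[of z y x0] dist_triangle2[of z x0 y] dist_triangle[of z y x0]
          dist_triangle[of z x0 y] by (auto simp: dist_commute abs_le_iff)
      have 4: "dist z y + r \<le> 3 * r"
        using 3 yr d by linarith
      have "\<bar>(dist z y)\<^sup>2 - r\<^sup>2\<bar> = \<bar>dist z y - r\<bar> * (dist z y + r)"
      proof -
        have "(dist z y)\<^sup>2 - r\<^sup>2 = (dist z y - r) * (dist z y + r)" by (simp add: power2_eq_square algebra_simps)
        then show ?thesis using r by (simp add: abs_mult)
      qed
      also have "\<dots> \<le> d * (3 * r)"
        using 3 4 yr r by (intro mult_mono) auto
      finally have 5: "\<bar>a\<bar> * \<bar>(dist z y)\<^sup>2 - r\<^sup>2\<bar> \<le> \<bar>a\<bar> * (d * (3 * r))"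
        by (intro mult_left_mono) auto
      have "(dist x0 y)\<^sup>2 \<le> d * r"
        unfolding power2_eq_square using yr d by (intro mult_mono) auto
      then have 6: "\<bar>a\<bar> * (dist x0 y)\<^sup>2 \<le> \<bar>a\<bar> * (d * r)"
        by (intro mult_left_mono) auto
      have 7: "- (a * ((dist z y)\<^sup>2 - r\<^sup>2)) \<le> \<bar>a\<bar> * \<bar>(dist z y)\<^sup>2 - r\<^sup>2\<bar>"
        by (metis abs_ge_minus_self abs_mult)
      have 8: "a * (dist x0 y)\<^sup>2 \<le> \<bar>a\<bar> * (dist x0 y)\<^sup>2" by (intro mult_right_mono) auto
      have "(a - a') * r\<^sup>2 \<le> 4 * (\<bar>a\<bar> * (d * r))"
        using 1 2 5 6 7 8 by (simp add: algebra_simps)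
      also have "\<dots> = (4 * \<bar>a\<bar> * d) * r" by simp
      also have "\<dots> < (6 * (\<bar>a\<bar> + 1) * d) * r"
        using r d by (intro mult_strict_right_mono) auto
      also have "\<dots> \<le> ((a - a') * r) * r" using dd r by (intro mult_right_mono) auto
      finally show False by (simp add: power2_eq_square)
    qed
    then have zr: "dist x0 z < r" using z by (simp add: less_le)
    have "z = y"
    proof (rule ccontr)
      assume zy: "z \<noteq> y"
      have sq: "(w - y) \<bullet> (w - y) = (dist w y)\<^sup>2" for w by (simp add: dist_norm power2_norm_eq_inner)
      have "loc_max_at \<Omega> (\<lambda>w. v w - a * ((w - y) \<bullet> (w - y))) z"
        unfolding loc_max_at_def
      proof (intro exI[of _ "r - dist x0 z"] conjI ballI impI)
        show "r - dist x0 z > 0" using zr by simp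
        fix w assume "dist w z < r - dist x0 z"
        then have "w \<in> cball x0 r"
          using dist_triangle[of x0 w z] by (simp add: dist_commute)
        then show "v w - a * ((w - y) \<bullet> (w - y)) \<le> v z - a * ((z - y) \<bullet> (z - y))"
          unfolding sq by (rule mz)
      qed
      from gsub_radial[OF v _ zy, where \<psi> = "\<lambda>s. a * s" and \<psi>' = "\<lambda>_. a" and \<psi>'' = "\<lambda>_. 0", OF _ _ _ _ this]
      have "\<sigma> \<le> 2 * a"
        using z r a by (auto intro!: derivative_eq_intros)
      then show False using a by simp
    qed
    then show ?thesis using mz[of x] x d by simp
  qed
  have "v x = v x0" if "x \<in> ball x0 d" for x
    by (rule quadratic_increment_imp_constant[OF _ d(1) that]) (rule inc)
  then show ?thesis using d that[of d] by blast
qed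

text \<open>The expansion of \<open>Dphi\<close> at \<open>x0\<close>, with slack
  \<open>2 * a - l\<close>, makes \<open>phi\<close> minus the paraboloid nonincreasing along every
  short ray from \<open>x0\<close>.\<close>

lemma second_order_upper_bound:
  assumes C2: "C2_on \<Omega> phi Dphi D2phi" and x0: "x0 \<in> \<Omega>" "open \<Omega>" and D: "Dphi x0 = 0"
    and l: "\<And>q. norm q = 1 \<Longrightarrow> q \<bullet> D2phi x0 q \<le> l" and a: "l < 2 * a"
  obtains r where "r > 0" "cball x0 r \<subseteq> \<Omega>" "\<And>x. x \<in> cball x0 r \<Longrightarrow> phi x \<le> phi x0 + a * (dist x x0)\<^sup>2"
proof -
  obtain r1 where r1: "r1 > 0" "cball x0 r1 \<subseteq> \<Omega>" using x0 open_contains_cball by blast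
  have dD: "(Dphi has_derivative D2phi x0) (at x0)" using C2 x0 by (simp add: C2_on_def)
  then have lin: "linear (D2phi x0)" by (rule has_derivative_linear)
  have l2: "h \<bullet> D2phi x0 h \<le> l * (norm h)\<^sup>2" for h
  proof (cases "h = 0")
    case False
    have "D2phi x0 (h /\<^sub>R norm h) = D2phi x0 h /\<^sub>R norm h"
      using lin by (simp add: linear_cmul)
    then have "(h /\<^sub>R norm h) \<bullet> D2phi x0 (h /\<^sub>R norm h) = (h \<bullet> D2phi x0 h) / (norm h)\<^sup>2"
      by (simp add: power2_eq_square divide_inverse)
    then show ?thesis using l[of "h /\<^sub>R norm h"] False by (simp add: divide_le_eq)
  qed (simp add: linear_0[OF lin])
  define e where "e = 2 * a - l"
  have e: "e > 0" using a by (simp add: e_def)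
  obtain r2 where r2: "r2 > 0" and b2: "\<And>y. norm (y - x0) < r2 \<Longrightarrow> norm (Dphi y - Dphi x0 - D2phi x0 (y - x0)) \<le> e * norm (y - x0)"
    using dD[unfolded has_derivative_at_alt] e by blast
  define r where "r = min r1 (r2 / 2)"
  have r: "r > 0" "r \<le> r1" "r < r2" using r1 r2 by (auto simp: r_def)
  have "phi x \<le> phi x0 + a * (dist x x0)\<^sup>2" if x: "x \<in> cball x0 r" for x
  proof -
    define h where "h = x - x0"
    have hr: "norm h \<le> r" using x by (simp add: h_def dist_norm norm_minus_commute)
    define g where "g t = phi (x0 + t *\<^sub>R h) - a * t\<^sup>2 * (norm h)\<^sup>2" for t
    have g': "(g has_real_derivative (Dphi (x0 + t *\<^sub>R h) \<bullet> h - 2 * a * t * (norm h)\<^sup>2)) (at t)"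
      if t: "0 \<le> t" "t \<le> 1" for t
    proof -
      have "norm (t *\<^sub>R h) \<le> r" using t hr mult_left_le_one_le[of "norm h" t] by simp
      then have "x0 + t *\<^sub>R h \<in> \<Omega>" using r r1 by (auto simp: dist_norm subset_iff)
      then have p: "(phi has_derivative (\<lambda>k. Dphi (x0 + t *\<^sub>R h) \<bullet> k)) (at (x0 + t *\<^sub>R h))"
        using C2 by (simp add: C2_on_def)
      have "((\<lambda>t. x0 + t *\<^sub>R h) has_derivative (\<lambda>s. s *\<^sub>R h)) (at t)"
        by (auto intro!: derivative_eq_intros)
      from has_derivative_compose[OF this p]
      have "((\<lambda>t. phi (x0 + t *\<^sub>R h)) has_real_derivative (Dphi (x0 + t *\<^sub>R h) \<bullet> h)) (at t)"
        unfolding has_field_derivative_def by (rule has_derivative_eq_rhs) (simp add: fun_eq_iff)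
      then show ?thesis unfolding g_def
        by (auto intro!: derivative_eq_intros)
    qed
    have "g 1 \<le> g 0"
    proof (rule DERIV_nonpos_imp_nonincreasing[of 0 1])
      fix t :: real assume t: "0 \<le> t" "t \<le> 1"
      have nt: "norm (t *\<^sub>R h) \<le> r" using t hr mult_left_le_one_le[of "norm h" t] by simp
      define E where "E = Dphi (x0 + t *\<^sub>R h) - D2phi x0 (t *\<^sub>R h)"
      have "norm E \<le> e * (t * norm h)"
        using b2[of "x0 + t *\<^sub>R h"] nt r t by (simp add: D E_def)
      then have "E \<bullet> h \<le> e * (t * norm h) * norm h"
        using norm_cauchy_schwarz[of E h] mult_right_mono[of "norm E" "e * (t * norm h)" "norm h"] by simp
      moreover have "Dphi (x0 + t *\<^sub>R h) = E + t *\<^sub>R D2phi x0 h"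
        using lin by (simp add: E_def linear_cmul)
      moreover have "t * (h \<bullet> D2phi x0 h) \<le> t * (l * (norm h)\<^sup>2)"
        using l2 t by (intro mult_left_mono) auto
      ultimately have "Dphi (x0 + t *\<^sub>R h) \<bullet> h - 2 * a * t * (norm h)\<^sup>2 \<le> 0"
        by (simp add: e_def inner_add_left inner_commute power2_eq_square algebra_simps)
      then show "\<exists>y. DERIV g t :> y \<and> y \<le> 0" using g'[OF t] by blast
    qed simp
    then show ?thesis by (simp add: g_def h_def dist_norm)
  qed
  then show ?thesis using r r1 that[of r] by (meson order_trans subset_cball)
qed

text \<open>The two conclusions serve different signs: for \<open>\<sigma> = 1\<close> local
  constancy is a flat piece, while for \<open>\<sigma> = -1\<close> the paraboloid has
  \<open>a < 0\<close> and contradicts local constancy.\<close>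

lemma gsub_second_order:
  assumes v: "gsub \<sigma> \<Omega> v" and op: "open \<Omega>" and x0: "x0 \<in> \<Omega>"
    and C2: "C2_on \<Omega> phi Dphi D2phi" and mx: "loc_max_at \<Omega> (\<lambda>y. v y - phi y) x0"
    and D: "Dphi x0 = 0" and l: "\<And>q. norm q = 1 \<Longrightarrow> q \<bullet> D2phi x0 q \<le> l" and ls: "l < \<sigma>"
  obtains a r where "2 * a < \<sigma>" "r > 0" "ball x0 r \<subseteq> \<Omega>" "\<And>x. x \<in> ball x0 r \<Longrightarrow> v x = v x0"
    "\<And>x. x \<in> ball x0 r \<Longrightarrow> v x \<le> v x0 + a * (dist x x0)\<^sup>2"
proof -
  have "\<exists>a. l < 2 * a \<and> 2 * a < \<sigma>"
    by (rule exI[of _ "(l + \<sigma>) / 4"]) (use ls in auto)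
  then obtain a' where a': "l < 2 * a'" "2 * a' < \<sigma>" by blast
  \<comment> \<open>The sliding paraboloid must have a nonzero gradient off its vertex. If the
    midpoint of \<open>a'\<close> and \<open>\<sigma> / 2\<close> happens to be zero, the midpoint
    between it and \<open>a'\<close> is taken.\<close>
  obtain a where a: "a' < a" "2 * a < \<sigma>" "a \<noteq> 0"
  proof (cases "(a' + \<sigma> / 2) / 2 = 0")
    case True
    then show ?thesis using a' that[of "(a' + (a' + \<sigma>/2)/2)/2"] by auto
  next
    case False
    then show ?thesis using a' that[of "(a' + \<sigma>/2)/2"] by auto
  qed
  obtain r where r: "r > 0" "cball x0 r \<subseteq> \<Omega>"
    and p: "\<And>x. x \<in> cball x0 r \<Longrightarrow> phi x \<le> phi x0 + a' * (dist x x0)\<^sup>2"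
    using second_order_upper_bound[OF C2 x0 op D l a'(1)] by blast
  obtain e where e: "e > 0" and mx: "\<And>y. y \<in> \<Omega> \<Longrightarrow> dist y x0 < e \<Longrightarrow> v y - phi y \<le> v x0 - phi x0"
    using mx unfolding loc_max_at_def by blast
  define \<rho> where "\<rho> = min r (e / 2)"
  have \<rho>: "\<rho> > 0" "\<rho> \<le> r" "\<rho> < e" using r e by (auto simp: \<rho>_def)
  have sub: "cball x0 \<rho> \<subseteq> \<Omega>" using r \<rho> by auto
  have q: "v x \<le> v x0 + a' * (dist x x0)\<^sup>2" if "x \<in> cball x0 \<rho>" for x
  proof -
    have "dist x x0 < e" "x \<in> cball x0 r" "x \<in> \<Omega>" using that \<rho> sub by (auto simp: dist_commute)
    then show ?thesis using mx[of x] p[of x] by linarith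
  qed
  obtain d where "d > 0" "d \<le> \<rho>" "\<And>x. x \<in> ball x0 d \<Longrightarrow> v x = v x0"
    using gsub_below_paraboloid_imp_constant[OF v \<rho>(1) sub a(1) a(3) a(2) q] by blast
  moreover from this have "ball x0 d \<subseteq> cball x0 \<rho>" by auto
  ultimately show ?thesis using that[of a' d] a' q sub by blast
qed

lemma D2_attains:
  fixes D2 :: "'a::euclidean_space \<Rightarrow> 'a"
  assumes "linear D2"
  obtains p where "norm p = 1" "\<And>q. norm q = 1 \<Longrightarrow> q \<bullet> D2 q \<le> p \<bullet> D2 p"
proof -
  have "continuous_on (sphere 0 1) (\<lambda>q. q \<bullet> D2 q)"
    by (intro continuous_intros linear_continuous_on linear_conv_bounded_linear[THEN iffD1] assms)
  then show ?thesis
    using continuous_attains_sup[of "sphere (0::'a) 1" "\<lambda>q. q \<bullet> D2 q"] that by (auto simp: dist_norm)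
qed

text \<open>The constant itself is an admissible test function; its Hessian vanishes, so no
  direction reaches the required value \<open>1\<close>.\<close>

lemma flat_piece_imp_not_normalized:
  assumes "has_flat_piece \<Omega> u" shows "\<not> visc_sol_normalized \<Omega> u"
proof
  assume n: "visc_sol_normalized \<Omega> u"
  obtain U c x where U: "open U" "U \<subseteq> \<Omega>" "\<And>x. x \<in> U \<Longrightarrow> u x = c" and x: "x \<in> U"
    using assms unfolding has_flat_piece_def by blast
  obtain e where e: "e > 0" "ball x e \<subseteq> U" using U x openE by blast
  have "loc_max_at \<Omega> (\<lambda>y. u y - c) x"
    unfolding loc_max_at_def using e U x by (intro exI[of _ e]) (auto simp: dist_commute subset_iff)
  moreover have "C2_on \<Omega> (\<lambda>_. c) (\<lambda>_. 0) (\<lambda>_ _. 0)" by (auto simp: C2_on_def)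
  ultimately show False
    using n[unfolded visc_sol_normalized_def, THEN conjunct2, THEN conjunct1, rule_format,
        of "\<lambda>_. c" "\<lambda>_. 0" "\<lambda>_ _. 0" x] x U by auto
qed

lemma no_flat_piece_imp_normalized:
  assumes op: "open \<Omega>" and u: "visc_sol_inflap_grad \<Omega> u" and nf: "\<not> has_flat_piece \<Omega> u"
  shows "visc_sol_normalized \<Omega> u"
  unfolding visc_sol_normalized_def
proof (intro conjI allI impI)
  show "continuous_on \<Omega> u" using u by (simp add: visc_sol_inflap_grad_def)
next
  fix phi Dphi D2phi x
  assume *: "C2_on \<Omega> phi Dphi D2phi \<and> x \<in> \<Omega> \<and> loc_max_at \<Omega> (\<lambda>y. u y - phi y) x"
  have lin: "linear (D2phi x)" using * by (auto simp: C2_on_def intro: has_derivative_linear)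
  show "if Dphi x \<noteq> 0 then inf_lap Dphi D2phi x / (norm (Dphi x))\<^sup>2 \<ge> 1
     else \<exists>p. norm p = 1 \<and> (\<forall>q. norm q = 1 \<longrightarrow> q \<bullet> D2phi x q \<le> p \<bullet> D2phi x p) \<and> p \<bullet> D2phi x p \<ge> 1"
  proof (cases "Dphi x = 0")
    case False
    have "inf_lap Dphi D2phi x - (norm (Dphi x))\<^sup>2 \<ge> 0"
      using u * unfolding visc_sol_inflap_grad_def by blast
    then show ?thesis using False by (simp add: le_divide_eq)
  next
    case True
    obtain p where p: "norm p = 1" "\<And>q. norm q = 1 \<Longrightarrow> q \<bullet> D2phi x q \<le> p \<bullet> D2phi x p"
      using D2_attains[OF lin] by blast
    have "p \<bullet> D2phi x p \<ge> 1"
    proof (rule ccontr)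
      assume "\<not> ?thesis"
      then have "p \<bullet> D2phi x p < 1" by simp
      then obtain r where r: "r > 0" "ball x r \<subseteq> \<Omega>" "\<And>y. y \<in> ball x r \<Longrightarrow> u y = u x"
        using gsub_second_order[OF gsub_if_visc_sol[OF u] op, of x phi Dphi D2phi "p \<bullet> D2phi x p"] * True p(2)
        by metis
      have "has_flat_piece \<Omega> u"
        unfolding has_flat_piece_def using r open_ball[of x r] centre_in_ball[of x r] by blast
      then show False using nf by simp
    qed
    then show ?thesis using p True by auto
  qed
next
  fix phi Dphi D2phi x
  assume *: "C2_on \<Omega> phi Dphi D2phi \<and> x \<in> \<Omega> \<and> loc_min_at \<Omega> (\<lambda>y. u y - phi y) x"
  have "linear (D2phi x)" using * by (auto simp: C2_on_def intro: has_derivative_linear)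
  then have lin: "linear (\<lambda>h. - D2phi x h)" by (rule linear_compose_neg)
  show "if Dphi x \<noteq> 0 then inf_lap Dphi D2phi x / (norm (Dphi x))\<^sup>2 \<le> 1
     else \<exists>p. norm p = 1 \<and> (\<forall>q. norm q = 1 \<longrightarrow> p \<bullet> D2phi x p \<le> q \<bullet> D2phi x q) \<and> p \<bullet> D2phi x p \<le> 1"
  proof (cases "Dphi x = 0")
    case False
    have "inf_lap Dphi D2phi x - (norm (Dphi x))\<^sup>2 \<le> 0"
      using u * unfolding visc_sol_inflap_grad_def by blast
    then show ?thesis using False by (simp add: divide_le_eq)
  next
    case True
    obtain p where p: "norm p = 1" "\<And>q. norm q = 1 \<Longrightarrow> q \<bullet> - D2phi x q \<le> p \<bullet> - D2phi x p"
      using D2_attains[OF lin] by blast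
    have "p \<bullet> D2phi x p \<le> 1"
    proof (rule ccontr)
      assume "\<not> ?thesis"
      then have l: "p \<bullet> - D2phi x p < -1" by simp
      obtain e where "e > 0" "\<And>y. y \<in> \<Omega> \<Longrightarrow> dist y x < e \<Longrightarrow> u y - phi y \<ge> u x - phi x"
        using * unfolding loc_min_at_def by blast
      then have mx: "loc_max_at \<Omega> (\<lambda>y. - u y - - phi y) x"
        unfolding loc_max_at_def by (intro exI[of _ e]) force
      have C2: "C2_on \<Omega> (\<lambda>x. - phi x) (\<lambda>x. - Dphi x) (\<lambda>x h. - D2phi x h)" and x: "x \<in> \<Omega>"
        using * C2_on_uminus by blast+
      have D: "- Dphi x = 0" using True by simp
      obtain a r where a: "2 * a < -1" and r: "r > 0" "\<And>y. y \<in> ball x r \<Longrightarrow> - u y = - u x"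
        and le: "\<And>y. y \<in> ball x r \<Longrightarrow> - u y \<le> - u x + a * (dist y x)\<^sup>2"
        using gsub_second_order[OF gsub_uminus_if_visc_sol[OF u] op x C2 mx D p(2) l] by metis
      \<comment> \<open>Since \<open>a < 0\<close>, any point of the ball other than the centre
        refutes local constancy; \<open>p\<close> supplies a unit direction.\<close>
      have dy: "dist (x + (r / 2) *\<^sub>R p) x = r / 2" using r p by (simp add: dist_norm)
      then have y: "x + (r / 2) *\<^sub>R p \<in> ball x r" using r by (simp add: dist_commute)
      have "0 \<le> a * (r / 2)\<^sup>2" using le[OF y] r(2)[OF y] unfolding dy by simp
      moreover have "a * (r / 2)\<^sup>2 < 0" using a r by (simp add: mult_neg_pos)
      ultimately show False by simp
    qed
    then show ?thesis using p True by auto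
  qed
qed

section \<open>Slopes measured by maxima on spheres\<close>

text \<open>A derivative-free form of \<open>norm (Dv x) \<ge> b\<close>. The growth of the cone is
  required on every sphere whose ball lies in \<open>V\<close>, not merely on small ones; this makes
  the property stable under limits and usable for steps of any admissible size. The guard restricts
  to radii at which the cone still increases.\<close>

definition slope :: "real \<Rightarrow> 'a::euclidean_space set \<Rightarrow> ('a \<Rightarrow> real) \<Rightarrow> 'a \<Rightarrow> real \<Rightarrow> bool" where
  "slope \<sigma> V v x b \<longleftrightarrow> (\<forall>R>0. b + \<sigma> * R > 0 \<longrightarrow> cball x R \<subseteq> V \<longrightarrow>
     (\<exists>p\<in>sphere x R. v x + b * R + \<sigma> / 2 * R\<^sup>2 \<le> v p))"

lemma slope_mono: "slope \<sigma> V v x b \<Longrightarrow> b' \<le> b \<Longrightarrow> slope \<sigma> V v x b'"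
  unfolding slope_def
proof (intro allI impI)
  fix R assume *: "\<forall>R>0. b + \<sigma> * R > 0 \<longrightarrow> cball x R \<subseteq> V \<longrightarrow> (\<exists>p\<in>sphere x R. v x + b * R + \<sigma> / 2 * R\<^sup>2 \<le> v p)"
    and b: "b' \<le> b" and R: "(0::real) < R" "b' + \<sigma> * R > 0" "cball x R \<subseteq> V"
  then obtain p where "p \<in> sphere x R" "v x + b * R + \<sigma> / 2 * R\<^sup>2 \<le> v p"
    by (metis add_le_cancel_right order_less_le_trans)
  moreover have "b' * R \<le> b * R" using b R by simp
  ultimately show "\<exists>p\<in>sphere x R. v x + b' * R + \<sigma> / 2 * R\<^sup>2 \<le> v p"
    by (intro bexI[of _ p]) auto
qed

lemma slope_limit:
  fixes x :: "'a::euclidean_space"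
  assumes v: "gsub \<sigma> \<Omega> v" and op: "open \<Omega>"
    and z: "z \<longlonglongrightarrow> x" and \<delta>: "\<delta> \<longlonglongrightarrow> 0" "\<And>n. \<delta> n > 0" and \<beta>: "\<beta> \<longlonglongrightarrow> b" and b: "b > 0"
    and q: "\<And>n::nat. dist (q n) (z n) = \<delta> n"
    and inc: "\<And>n. v (z n) + \<beta> n * \<delta> n + \<sigma> / 2 * (\<delta> n)\<^sup>2 \<le> v (q n)"
    and V: "V \<subseteq> \<Omega>"
  shows "slope \<sigma> V v x b"
  unfolding slope_def
proof (intro allI impI)
  fix R assume R: "(0::real) < R" "b + \<sigma> * R > 0" "cball x R \<subseteq> V"
  have "cball x R \<subseteq> \<Omega>" using R V by simp
  \<comment> \<open>The spheres are centred at \<open>z n\<close> instead of \<open>x\<close>, which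
    takes some room beyond radius \<open>R\<close>. The point \<open>w\<close> below is the radial
    projection of \<open>y\<close> to the sphere.\<close>
  then obtain R' where R': "R' > R" "cball x R' \<subseteq> \<Omega>"
  proof -
    have "compact (cball x R)" by simp
    from compact_subset_open_imp_ball_epsilon_subset[OF this op \<open>cball x R \<subseteq> \<Omega>\<close>]
    obtain e where e: "e > 0" "(\<Union>y\<in>cball x R. ball y e) \<subseteq> \<Omega>" by metis
    have "cball x (R + e / 2) \<subseteq> \<Omega>"
    proof
      fix y assume y: "y \<in> cball x (R + e / 2)"
      show "y \<in> \<Omega>"
      proof (cases "y \<in> cball x R")
        case True then show ?thesis using \<open>cball x R \<subseteq> \<Omega>\<close> by blast
      next
        case False
        then have yR: "dist x y > R" by simp
        define w where "w = x + (R / dist x y) *\<^sub>R (y - x)"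
        have xy: "x \<noteq> y" using yR R by auto
        then have "dist x w = R" using R by (simp add: w_def dist_norm norm_minus_commute)
        moreover have "dist w y < e"
        proof -
          have "w - y = (R / dist x y - 1) *\<^sub>R (y - x)" by (simp add: w_def algebra_simps)
          then have "dist w y = \<bar>R / dist x y - 1\<bar> * dist x y" by (simp add: dist_norm norm_minus_commute)
          also have "\<dots> = dist x y - R" using yR R xy by (simp add: abs_if field_simps)
          finally show ?thesis using y e by simp
        qed
        ultimately have "y \<in> (\<Union>y\<in>cball x R. ball y e)" by (intro UN_I[of w]) auto
        then show ?thesis using e by blast
      qed
    qed
    then show ?thesis using that[of "R + e / 2"] e by simp
  qed
  \<comment> \<open>The deduction of \<open>1 / Suc n\<close> provides the strict inequality that
    cone comparison contradicts, and it vanishes in the limit.\<close>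
  define \<gamma> where "\<gamma> n = \<beta> n - 1 / Suc n" for n
  have "\<gamma> \<longlonglongrightarrow> b - 0" unfolding \<gamma>_def
    using LIMSEQ_inverse_real_of_nat by (intro tendsto_diff \<beta>) (simp add: inverse_eq_divide)
  then have \<gamma>: "\<gamma> \<longlonglongrightarrow> b" by simp
  have "(\<lambda>n. \<gamma> n + \<sigma> * R) \<longlonglongrightarrow> b + \<sigma> * R" by (intro tendsto_intros \<gamma>)
  then have "\<forall>\<^sub>F n in sequentially. \<gamma> n + \<sigma> * R > 0" using R by (simp add: order_tendsto_iff)
  moreover have "\<forall>\<^sub>F n in sequentially. \<gamma> n > 0" using \<gamma> b by (simp add: order_tendsto_iff)
  moreover have "\<forall>\<^sub>F n in sequentially. \<delta> n < R" using \<delta> R by (simp add: order_tendsto_iff)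
  moreover have "\<forall>\<^sub>F n in sequentially. dist (z n) x < R' - R" using z R' by (simp add: tendsto_iff)
  ultimately have "\<forall>\<^sub>F n in sequentially. \<exists>p. p \<in> sphere (z n) R \<and> p \<in> cball x R' \<and> v (z n) + \<gamma> n * R + \<sigma> / 2 * R\<^sup>2 \<le> v p"
  proof eventually_elim
    case (elim n)
    have cb: "cball (z n) R \<subseteq> cball x R'" using elim(4) by (intro subsetI) (simp, metis add.commute dist_commute dist_triangle_le add_mono less_eq_real_def add_diff_cancel_left' diff_add_cancel)
    show ?case
    proof (rule ccontr)
      assume "\<not> ?thesis"
      then have bd: "v p \<le> v (z n) + \<gamma> n * R + \<sigma> / 2 * R\<^sup>2" if "p \<in> sphere (z n) R" for p
        using cb that by (metis linorder_le_cases subsetD sphere_cball)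
      have "q n \<in> cball (z n) R" using q[of n] elim by (simp add: dist_commute)
      from cone_comparison[OF v _ R(1) _ elim(1) bd this] have "v (q n) \<le> v (z n) + \<gamma> n * \<delta> n + \<sigma> / 2 * (\<delta> n)\<^sup>2"
        using cb R' elim by (auto simp: q)
      then have "\<beta> n * \<delta> n \<le> \<gamma> n * \<delta> n" using inc[of n] by linarith
      then have "\<beta> n \<le> \<gamma> n" using \<delta>(2)[of n] by simp
      then show False by (simp add: \<gamma>_def)
    qed
  qed
  then obtain N where "\<And>n. n \<ge> N \<Longrightarrow> \<exists>p. p \<in> sphere (z n) R \<and> p \<in> cball x R' \<and> v (z n) + \<gamma> n * R + \<sigma> / 2 * R\<^sup>2 \<le> v p"
    unfolding eventually_sequentially by blast
  then have "\<exists>p. p \<in> sphere (z (n + N)) R \<and> p \<in> cball x R' \<and> v (z (n + N)) + \<gamma> (n + N) * R + \<sigma> / 2 * R\<^sup>2 \<le> v p" for n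
    by simp
  then obtain p where p1: "\<And>n. dist (z (n + N)) (p n) = R" and p2: "\<And>n. p n \<in> cball x R'"
    and p3: "\<And>n. v (z (n + N)) + \<gamma> (n + N) * R + \<sigma> / 2 * R\<^sup>2 \<le> v (p n)"
    by (simp only: mem_sphere) metis
  obtain l r where l: "l \<in> cball x R'" and r: "strict_mono (r::nat\<Rightarrow>nat)" and pl: "(p \<circ> r) \<longlonglongrightarrow> l"
    using p2 compact_cball[of x R'] unfolding compact_def by meson
  have sub: "filterlim (\<lambda>n. r n + N) at_top sequentially"
    using filterlim_subseq[OF r] by (rule filterlim_at_top_mono) auto
  have zr: "(\<lambda>n. z (r n + N)) \<longlonglongrightarrow> x" by (rule filterlim_compose[OF z sub])
  have \<gamma>r: "(\<lambda>n. \<gamma> (r n + N)) \<longlonglongrightarrow> b" by (rule filterlim_compose[OF \<gamma> sub])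
  have cont: "isCont v y" if "y \<in> \<Omega>" for y
    using v that op unfolding gsub_def by (metis continuous_on_eq_continuous_at)
  have lO: "l \<in> \<Omega>" "x \<in> \<Omega>" using l R' R by auto
  have 1: "(\<lambda>n. v (p (r n))) \<longlonglongrightarrow> v l"
    using isCont_tendsto_compose[OF cont[OF lO(1)] pl] by (simp add: o_def)
  have 2: "(\<lambda>n. v (z (r n + N)) + \<gamma> (r n + N) * R + \<sigma> / 2 * R\<^sup>2) \<longlonglongrightarrow> v x + b * R + \<sigma> / 2 * R\<^sup>2"
    by (intro tendsto_intros isCont_tendsto_compose[OF cont[OF lO(2)] zr] \<gamma>r)
  have "v x + b * R + \<sigma> / 2 * R\<^sup>2 \<le> v l"
    by (rule LIMSEQ_le[OF 2 1]) (use p3 in auto)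
  moreover have "(\<lambda>n. dist (z (r n + N)) (p (r n))) \<longlonglongrightarrow> dist x l"
    using pl by (intro tendsto_intros zr) (simp add: o_def)
  then have "dist x l = R" by (simp add: p1 LIMSEQ_const_iff)
  ultimately show "\<exists>p\<in>sphere x R. v x + b * R + \<sigma> / 2 * R\<^sup>2 \<le> v p" by auto
qed

text \<open>The cone with vertex \<open>x\<close> through the largest value on the sphere bounds
  \<open>v\<close> from above on the ball. Hence \<open>v\<close> rises along the radius into its
  maximum point \<open>x1\<close> at least as fast as this cone, and the slope passes from
  \<open>b\<close> to the derivative of the cone at radius \<open>R\<close>.\<close>

lemma slope_step:
  fixes x :: "'a::euclidean_space"
  assumes v: "gsub \<sigma> \<Omega> v" and op: "open \<Omega>" and V: "V \<subseteq> \<Omega>"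
    and s: "slope \<sigma> V v x b" and b: "b > 0" and R: "R > 0" "b + \<sigma> * R > 0" "cball x R \<subseteq> V"
  obtains x1 where "dist x x1 = R" "v x + b * R + \<sigma> / 2 * R\<^sup>2 \<le> v x1" "slope \<sigma> V v x1 (b + \<sigma> * R)"
proof -
  have cb: "cball x R \<subseteq> \<Omega>" using R V by blast
  then have "continuous_on (sphere x R) v"
    using v sphere_cball[of x R] unfolding gsub_def by (meson continuous_on_subset order_trans)
  then obtain x1 where x1: "x1 \<in> sphere x R" and mx: "\<And>y. y \<in> sphere x R \<Longrightarrow> v y \<le> v x1"
    using continuous_attains_sup[of "sphere x R" v] R by (auto simp: less_imp_le)
  have d1: "dist x x1 = R" using x1 by simp
  obtain p where "p \<in> sphere x R" "v x + b * R + \<sigma> / 2 * R\<^sup>2 \<le> v p"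
    using s R unfolding slope_def by blast
  then have g: "v x + b * R + \<sigma> / 2 * R\<^sup>2 \<le> v x1" using mx by fastforce
  \<comment> \<open>The slope for which the cone passes exactly through the maximum; it may exceed
    \<open>b\<close>.\<close>
  define B where "B = (v x1 - v x - \<sigma> / 2 * R\<^sup>2) / R"
  have BR: "v x + B * R + \<sigma> / 2 * R\<^sup>2 = v x1" using R by (simp add: B_def)
  have Bb: "b \<le> B" using g R by (simp add: B_def field_simps)
  have cone: "v y \<le> v x + B * dist y x + \<sigma> / 2 * (dist y x)\<^sup>2" if "y \<in> cball x R" for y
    by (rule cone_comparison[OF v cb R(1) _ _ _ that]) (use Bb b R BR mx in auto)
  define \<delta> where "\<delta> n = R / 2 * inverse (real (Suc n))" for n :: nat
  have \<delta>: "\<delta> n > 0" "\<delta> n < R" for n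
  proof -
    show "\<delta> n > 0" using R by (simp add: \<delta>_def)
    have "inverse (real (Suc n)) \<le> 1" by (simp add: field_simps)
    then have "\<delta> n \<le> R / 2 * 1" unfolding \<delta>_def using R by (intro mult_left_mono) auto
    then show "\<delta> n < R" using R by simp
  qed
  have \<delta>0: "\<delta> \<longlonglongrightarrow> 0" unfolding \<delta>_def
    using tendsto_mult[OF tendsto_const[of "R / 2"] LIMSEQ_inverse_real_of_nat] by simp
  define z where "z n = x1 + (\<delta> n / R) *\<^sub>R (x - x1)" for n
  have "z \<longlonglongrightarrow> x1 + (0 / R) *\<^sub>R (x - x1)" unfolding z_def using R by (intro tendsto_intros \<delta>0) auto
  then have zl: "z \<longlonglongrightarrow> x1" by simp
  have q: "dist x1 (z n) = \<delta> n" for n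
    using \<delta>[of n] R d1 by (simp add: z_def dist_norm)
  have zx: "dist (z n) x = R - \<delta> n" for n
  proof -
    have "z n - x = (1 - \<delta> n / R) *\<^sub>R (x1 - x)" by (simp add: z_def algebra_simps)
    then have "dist (z n) x = \<bar>1 - \<delta> n / R\<bar> * R" using d1 by (simp add: dist_norm norm_minus_commute)
    moreover have "\<delta> n / R < 1" using \<delta>[of n] R by simp
    ultimately show ?thesis using R by (simp add: left_diff_distrib)
  qed
  have inc: "v (z n) + (B + \<sigma> * R - \<sigma> * \<delta> n) * \<delta> n + \<sigma> / 2 * (\<delta> n)\<^sup>2 \<le> v x1" for n
  proof -
    have "v (z n) \<le> v x + B * (R - \<delta> n) + \<sigma> / 2 * (R - \<delta> n)\<^sup>2"
      using cone[of "z n"] zx[of n] \<delta>[of n] by (simp add: dist_commute)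
    moreover have "v x + B * (R - \<delta> n) + \<sigma> / 2 * (R - \<delta> n)\<^sup>2 + (B + \<sigma> * R - \<sigma> * \<delta> n) * \<delta> n + \<sigma> / 2 * (\<delta> n)\<^sup>2
        = v x + B * R + \<sigma> / 2 * R\<^sup>2"
      by (simp add: power2_eq_square field_simps)
    ultimately show ?thesis using BR by linarith
  qed
  have "(\<lambda>n. B + \<sigma> * R - \<sigma> * \<delta> n) \<longlonglongrightarrow> B + \<sigma> * R - \<sigma> * 0" by (intro tendsto_intros \<delta>0)
  then have \<beta>: "(\<lambda>n. B + \<sigma> * R - \<sigma> * \<delta> n) \<longlonglongrightarrow> B + \<sigma> * R" by simp
  have "slope \<sigma> V v x1 (B + \<sigma> * R)"
    by (rule slope_limit[OF v op zl \<delta>0 _ \<beta> _ q inc V]) (use \<delta> Bb R in auto)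
  then have "slope \<sigma> V v x1 (b + \<sigma> * R)" using Bb by (elim slope_mono) simp
  then show ?thesis using that d1 g by blast
qed

text \<open>A discrete gradient flow: jumping from maximum to maximum on small spheres gains at least the
  increment of the cone with initial slope \<open>b\<close> and can only stop at the boundary.\<close>

lemma slope_chain_to_frontier:
  fixes x0 :: "'a::euclidean_space"
  assumes v: "gsub \<sigma> \<Omega> v" and op: "open \<Omega>" and V: "open V" "bounded V" "closure V \<subseteq> \<Omega>"
    and \<sigma>: "\<bar>\<sigma>\<bar> \<le> 1" and x0: "x0 \<in> V" and s0: "slope \<sigma> V v x0 b" and m: "m > 0" "b \<ge> m"
    and F: "continuous_on (closure V) F"
    and F1: "\<And>p q. closed_segment p q \<subseteq> V \<Longrightarrow> \<bar>F p - F q\<bar> \<le> dist p q"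
    and H: "\<And>x s. x \<in> V \<Longrightarrow> 0 \<le> s \<Longrightarrow> b + \<sigma> * s > 0 \<Longrightarrow> v x0 + b * s + \<sigma> / 2 * s\<^sup>2 \<le> v x \<Longrightarrow> m \<le> b + \<sigma> * s \<and> s \<le> S"
  obtains x s where "x \<in> frontier V" "s > 0" "v x0 + b * s + \<sigma> / 2 * s\<^sup>2 \<le> v x" "\<bar>F x - F x0\<bar> \<le> s" "m \<le> b + \<sigma> * s"
proof -
  have Vne: "- V \<noteq> {}" using V(2) not_bounded_UNIV by (metis double_complement Compl_empty_eq)
  \<comment> \<open>Half the distance to the complement keeps a jump inside \<open>V\<close>, and
    \<open>m / 2\<close> keeps the slope positive during it. As \<open>D\<close> is continuous and
    positive on \<open>V\<close>, the jumps can die out only at the frontier.\<close>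
  define D where "D x = min (m / 2) (infdist x (- V) / 2)" for x
  have D0: "D x > 0" if "x \<in> V" for x
    using that V(1) Vne m by (auto simp: D_def intro!: infdist_pos_not_in_closed)
  have DV: "cball x (D x) \<subseteq> V" if "x \<in> V" for x
  proof
    fix y assume y: "y \<in> cball x (D x)"
    show "y \<in> V"
    proof (rule ccontr)
      assume "y \<notin> V"
      then have "infdist x (- V) \<le> dist x y" by (intro infdist_le) auto
      then show False using y D0[OF that] by (simp add: D_def)
    qed
  qed
  \<comment> \<open>\<open>s\<close> is the length travelled so far, which also bounds the change of
    \<open>F\<close>.\<close>
  define I where "I = (\<lambda>(x, s). x \<in> V \<and> 0 \<le> s \<and> m \<le> b + \<sigma> * s \<and> slope \<sigma> V v x (b + \<sigma> * s) \<and>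
      v x0 + b * s + \<sigma> / 2 * s\<^sup>2 \<le> v x \<and> \<bar>F x - F x0\<bar> \<le> s)"
  have "\<exists>f. \<forall>n. I (f n) \<and> (dist (fst (f n)) (fst (f (Suc n))) = snd (f (Suc n)) - snd (f n)
       \<and> snd (f (Suc n)) = snd (f n) + D (fst (f n)))"
  proof (rule dependent_nat_choice)
    show "\<exists>x. I x" by (rule exI[of _ "(x0, 0)"]) (use x0 s0 m in \<open>auto simp: I_def\<close>)
  next
    fix f :: "'a \<times> real" and n
    assume If: "I f"
    obtain x s where f: "f = (x, s)" by fastforce
    have i: "x \<in> V" "0 \<le> s" "m \<le> b + \<sigma> * s" "slope \<sigma> V v x (b + \<sigma> * s)"
      "v x0 + b * s + \<sigma> / 2 * s\<^sup>2 \<le> v x" "\<bar>F x - F x0\<bar> \<le> s"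
      using If by (auto simp: I_def f)
    define R where "R = D x"
    have R: "R > 0" "R \<le> m / 2" "cball x R \<subseteq> V" using D0 DV i by (auto simp: R_def D_def)
    have "\<bar>\<sigma> * R\<bar> \<le> m / 2" using mult_mono[OF \<sigma>, of R "m / 2"] R m by (simp add: abs_mult)
    then have pos: "b + \<sigma> * s + \<sigma> * R > 0" using i m by (auto simp: abs_le_iff)
    obtain x1 where x1: "dist x x1 = R" "v x + (b + \<sigma> * s) * R + \<sigma> / 2 * R\<^sup>2 \<le> v x1"
      "slope \<sigma> V v x1 (b + \<sigma> * s + \<sigma> * R)"
      using slope_step[OF v op _ i(4) _ R(1) pos R(3)] V(3) closure_subset[of V] i m by (metis order_less_le_trans order_trans)
    have x1V: "x1 \<in> V" using x1 R by (auto simp: subset_iff)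
    have v1: "v x0 + b * (s + R) + \<sigma> / 2 * (s + R)\<^sup>2 \<le> v x1"
    proof -
      have "v x0 + b * (s + R) + \<sigma> / 2 * (s + R)\<^sup>2 = (v x0 + b * s + \<sigma> / 2 * s\<^sup>2) + (b + \<sigma> * s) * R + \<sigma> / 2 * R\<^sup>2"
        by (simp add: power2_eq_square field_simps)
      then show ?thesis using x1 i by linarith
    qed
    have "closed_segment x x1 \<subseteq> cball x R"
      by (intro closed_segment_subset) (use x1 R in auto)
    then have "\<bar>F x - F x1\<bar> \<le> R" using F1[of x x1] R x1 by auto
    then have F': "\<bar>F x1 - F x0\<bar> \<le> s + R" using i by linarith
    \<comment> \<open>The jump by itself only leaves the slope positive; \<open>H\<close> recovers
      the bound \<open>m\<close> from the value that was reached.\<close>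
    have "m \<le> b + \<sigma> * (s + R)" using H[OF x1V _ _ v1] pos i R by (simp add: algebra_simps)
    then have "I (x1, s + R)" using x1V i R x1 v1 F' by (simp add: I_def algebra_simps)
    then show "\<exists>g. I g \<and> (dist (fst f) (fst g) = snd g - snd f \<and> snd g = snd f + D (fst f))"
      by (intro exI[of _ "(x1, s + R)"]) (simp add: f x1 R_def)
  qed
  then obtain f where f: "\<And>n. I (f n)" "\<And>n. dist (fst (f n)) (fst (f (Suc n))) = snd (f (Suc n)) - snd (f n)"
    "\<And>n. snd (f (Suc n)) = snd (f n) + D (fst (f n))" by blast
  define x s where "x n = fst (f n)" and "s n = snd (f n)" for n
  have i: "x n \<in> V" "0 \<le> s n" "m \<le> b + \<sigma> * s n" "v x0 + b * s n + \<sigma> / 2 * (s n)\<^sup>2 \<le> v (x n)" "\<bar>F (x n) - F x0\<bar> \<le> s n" for n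
    using f(1)[of n] by (auto simp: I_def x_def s_def case_prod_unfold)
  have st: "dist (x n) (x (Suc n)) = s (Suc n) - s n" "s (Suc n) = s n + D (x n)" for n
    using f(2,3)[of n] by (auto simp: x_def s_def)
  have inc: "incseq s" by (rule incseq_SucI) (use st D0 i in \<open>auto simp: less_imp_le\<close>)
  \<comment> \<open>The travelled length is bounded, so the chain converges and its jumps tend to
    zero.\<close>
  have "s n \<le> S" for n using H[OF i(1) i(2) _ i(4)] i(3)[of n] m by auto
  then have "convergent s" using inc i(2) by (intro Bseq_monoseq_convergent BseqI'[of _ S]) (auto simp: incseq_imp_monoseq)
  then obtain l where sl: "s \<longlonglongrightarrow> l" by (auto simp: convergent_def)
  have dx: "dist (x n) (x (n + k)) \<le> s (n + k) - s n" for n k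
  proof (induction k)
    case (Suc k)
    then show ?case using st(1)[of "n + k"] dist_triangle[of "x n" "x (n + Suc k)" "x (n + k)"] by simp
  qed simp
  have "Cauchy x"
  proof (rule CauchyI')
    fix e :: real assume e: "e > 0"
    obtain M where M: "\<And>m n. m \<ge> M \<Longrightarrow> n \<ge> M \<Longrightarrow> dist (s m) (s n) < e"
      using LIMSEQ_imp_Cauchy[OF sl] e unfolding Cauchy_def by meson
    show "\<exists>M. \<forall>m\<ge>M. \<forall>n>m. dist (x m) (x n) < e"
    proof (intro exI[of _ M] allI impI)
      fix m n assume "M \<le> m" "m < n"
      then show "dist (x m) (x n) < e" using dx[of m "n - m"] M[of m n] by (simp add: dist_real_def)
    qed
  qed
  then obtain y where xy: "x \<longlonglongrightarrow> y" using Cauchy_convergent_iff convergent_def by blast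
  have ycl: "y \<in> closure V" using xy i(1) closure_sequential by blast
  have "(\<lambda>n. s (Suc n) - s n) \<longlonglongrightarrow> l - l" by (intro tendsto_diff LIMSEQ_Suc sl)
  then have "(\<lambda>n. D (x n)) \<longlonglongrightarrow> 0" by (simp add: st)
  moreover have "(\<lambda>n. D (x n)) \<longlonglongrightarrow> D y" unfolding D_def by (intro tendsto_intros xy) auto
  ultimately have "D y = 0" using LIMSEQ_unique by blast
  then have "y \<notin> V" using D0 by force
  then have yf: "y \<in> frontier V" using ycl V(1) by (simp add: frontier_def interior_open)
  have l: "l > 0"
    using incseq_le[OF inc sl, of 1] st(2)[of 0] D0[OF i(1)[of 0]] i(2)[of 0] by simp
  have vc: "continuous_on (closure V) v" using v V unfolding gsub_def by (metis continuous_on_subset)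
  have xcl: "x n \<in> closure V" for n using i(1) closure_subset by blast
  have vl: "(\<lambda>n. v (x n)) \<longlonglongrightarrow> v y"
    by (rule continuous_on_tendsto_compose[OF vc xy ycl]) (use xcl in auto)
  have "(\<lambda>n. v x0 + b * s n + \<sigma> / 2 * (s n)\<^sup>2) \<longlonglongrightarrow> v x0 + b * l + \<sigma> / 2 * l\<^sup>2" by (intro tendsto_intros sl)
  from LIMSEQ_le[OF this vl] have 1: "v x0 + b * l + \<sigma> / 2 * l\<^sup>2 \<le> v y" using i(4) by blast
  have "(\<lambda>n. F (x n)) \<longlonglongrightarrow> F y"
    by (rule continuous_on_tendsto_compose[OF F xy ycl]) (use xcl in auto)
  then have "(\<lambda>n. \<bar>F (x n) - F x0\<bar>) \<longlonglongrightarrow> \<bar>F y - F x0\<bar>" by (intro tendsto_intros)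
  from LIMSEQ_le[OF this sl] have 2: "\<bar>F y - F x0\<bar> \<le> l" using i(5) by blast
  have "(\<lambda>n. b + \<sigma> * s n) \<longlonglongrightarrow> b + \<sigma> * l" by (intro tendsto_intros sl)
  from LIMSEQ_le_const[OF this] have "m \<le> b + \<sigma> * l" using i(3) by blast
  then show ?thesis using that yf l 1 2 by blast
qed

section \<open>Lipschitz estimates for the transformed solution and for subsolutions\<close>

text \<open>Bisection, since the estimate is additive over adjacent subintervals. \<open>V\<close>
  may fail to be convex, so a local constant spreads only along segments inside
  \<open>V\<close>.\<close>

lemma lipschitz_on_segment_if_locally:
  fixes F :: "'a::real_normed_vector \<Rightarrow> real"
  assumes loc: "\<And>x. x \<in> V \<Longrightarrow> \<exists>r>0. \<forall>p\<in>ball x r. \<forall>q\<in>ball x r. \<bar>F p - F q\<bar> \<le> C * dist p q"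
    and seg: "closed_segment a b \<subseteq> V"
  shows "\<bar>F a - F b\<bar> \<le> C * dist a b"
proof (cases "a = b")
  case False
  define g where "g t = a + t *\<^sub>R (b - a)" for t :: real
  have dg: "dist (g s) (g t) = \<bar>s - t\<bar> * dist a b" for s t
  proof -
    have "g s - g t = (s - t) *\<^sub>R (b - a)" by (simp add: g_def algebra_simps)
    then show ?thesis by (simp add: dist_norm norm_minus_commute)
  qed
  have gV: "g t \<in> V" if "0 \<le> t" "t \<le> 1" for t
    using seg that by (force simp: g_def closed_segment_image_interval algebra_simps)
  have "(0::real) \<le> 1" by simp
  then have "\<bar>F (g 0) - F (g 1)\<bar> \<le> C * (1 - 0) * dist a b"
  proof (induction rule: Bolzano)
    case (trans s t u)
    have "C * (u - s) * dist a b = C * (t - s) * dist a b + C * (u - t) * dist a b" by (simp add: algebra_simps)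
    then show ?case using trans by linarith
  next
    case (local t)
    obtain r where r: "r > 0" "\<And>p q. p \<in> ball (g t) r \<Longrightarrow> q \<in> ball (g t) r \<Longrightarrow> \<bar>F p - F q\<bar> \<le> C * dist p q"
      using loc[OF gV[OF local]] by blast
    show ?case
    proof (intro exI[of _ "r / dist a b"] conjI allI impI)
      show "r / dist a b > 0" using r False by simp
      fix s u assume su: "s \<le> t \<and> t \<le> u \<and> u - s < r / dist a b"
      then have "(u - s) * dist a b < r" using False by (simp add: field_simps)
      moreover have "(t - s) * dist a b \<le> (u - s) * dist a b" "(u - t) * dist a b \<le> (u - s) * dist a b"
        using su by (auto intro!: mult_right_mono)
      ultimately have "g s \<in> ball (g t) r" "g u \<in> ball (g t) r" using su by (auto simp: dg)
      from r(2)[OF this] show "\<bar>F (g s) - F (g u)\<bar> \<le> C * (u - s) * dist a b"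
        using su by (simp add: dg)
    qed
  qed
  then show ?thesis by (simp add: g_def)
qed simp

text \<open>\<open>F0\<close>, \<open>Fp\<close>, \<open>Fm\<close> are values of the transformed
  competitor at the start, the upper end and the lower end; \<open>B\<close> is the transformed
  solution at the start, and it reaches at least \<open>B + sp\<close> above and at most
  \<open>B - sm\<close> below. On the boundary the two are linked by
  \<open>sqrt (t\<^sup>2 + 2 * \<kappa>)\<close>, which strictly shortens distances, so a gain of
  \<open>sp + sm\<close> cannot come from a change of at most \<open>sp + sm\<close> in
  \<open>t\<close>.\<close>

lemma sqrt_diff_strict:
  fixes B F0 Fp Fm sp sm \<kappa> :: real
  assumes \<kappa>: "\<kappa> > 0" and B: "B > sm" and sp: "sp > 0" and sm: "sm > 0"
    and nn: "Fp \<ge> 0" "Fm \<ge> 0" "F0 \<ge> 0"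
    and p: "(B + sp)\<^sup>2 - 2 * \<kappa> \<le> Fp\<^sup>2" "Fp \<le> F0 + sp"
    and m: "Fm\<^sup>2 \<le> (B - sm)\<^sup>2 - 2 * \<kappa>" "F0 - sm \<le> Fm"
  shows False
proof -
  have "Fp\<^sup>2 \<le> (F0 + sp)\<^sup>2" using p nn by (intro power_mono) auto
  then have 1: "(B + sp)\<^sup>2 - 2 * \<kappa> \<le> (F0 + sp)\<^sup>2" using p by linarith
  show False
  \<comment> \<open>If \<open>F0 < sm\<close>, the lower bound \<open>F0 - sm\<close> is negative
    and cannot be squared; then \<open>F0 < sm < B\<close> and
    \<open>2 * \<kappa> \<le> (B - sm)\<^sup>2\<close> give the contradiction.\<close>
  proof (cases "F0 \<ge> sm")
    case True
    have "(F0 - sm)\<^sup>2 \<le> Fm\<^sup>2" using m True by (intro power_mono) auto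
    then have 2: "(F0 - sm)\<^sup>2 \<le> (B - sm)\<^sup>2 - 2 * \<kappa>" using m by linarith
    have "B * (sp + sm) \<le> F0 * (sp + sm)" using 1 2 by (simp add: power2_eq_square algebra_simps)
    then have "B \<le> F0" using sp sm by simp
    then have "(B - sm)\<^sup>2 \<le> (F0 - sm)\<^sup>2" using B by (intro power_mono) auto
    then show False using 2 \<kappa> by linarith
  next
    case False
    have "2 * \<kappa> \<le> (B - sm)\<^sup>2" using m zero_le_power2[of Fm] by linarith
    then have 3: "(B + sp)\<^sup>2 - (B - sm)\<^sup>2 \<le> (F0 + sp)\<^sup>2" using 1 by linarith
    have "F0\<^sup>2 \<le> sm\<^sup>2" using False nn by (intro power_mono) auto
    moreover have "F0 * sp \<le> B * sp" using False B sp by (intro mult_right_mono) auto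
    moreover have "sm * sm < B * sm" using B sm by simp
    ultimately show False using 3 by (simp add: power2_eq_square algebra_simps)
  qed
qed

text \<open>If the transformed function \<open>sqrt (2 * (u + A))\<close> had slope greater than one somewhere, then the
  chains of slope for \<open>u\<close> (upwards) and \<open>- u\<close> (downwards) would join two boundary points, between
  which the competitor, transformed with \<open>k < A\<close>, cannot grow fast enough.\<close>

lemma transformed_lipschitz:
  fixes u :: "'a::euclidean_space \<Rightarrow> real"
  assumes u: "gsub 1 \<Omega> u" "gsub (-1) \<Omega> (\<lambda>x. - u x)" and op: "open \<Omega>"
    and V: "open V" "bounded V" "closure V \<subseteq> \<Omega>"
    and A: "k < A" and uk: "\<And>x. x \<in> V \<Longrightarrow> - k \<le> u x"
    and F: "continuous_on (closure V) F" and F0: "\<And>x. F x \<ge> 0"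
    and F1: "\<And>p q. closed_segment p q \<subseteq> V \<Longrightarrow> \<bar>F p - F q\<bar> \<le> dist p q"
    and bd: "\<And>x. x \<in> frontier V \<Longrightarrow> u x = (F x)\<^sup>2 / 2 - k"
    and seg: "closed_segment y z \<subseteq> V"
  shows "sqrt (2 * (u z + A)) - sqrt (2 * (u y + A)) \<le> dist y z"
proof (rule ccontr)
  assume contr: "\<not> ?thesis"
  define w where "w x = sqrt (2 * (u x + A))" for x
  define g where "g t = y + t *\<^sub>R (z - y)" for t :: real
  define \<Lambda> where "\<Lambda> = dist y z"
  have dg: "dist (g s) (g t) = \<bar>s - t\<bar> * \<Lambda>" for s t
  proof -
    have "g s - g t = (s - t) *\<^sub>R (z - y)" by (simp add: g_def algebra_simps)
    then show ?thesis by (simp add: dist_norm norm_minus_commute \<Lambda>_def)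
  qed
  have gV: "g t \<in> V" if "0 \<le> t" "t \<le> 1" for t
    using seg that by (force simp: g_def closed_segment_image_interval algebra_simps)
  have w2: "(w x)\<^sup>2 = 2 * (u x + A)" if "x \<in> V" for x using uk[OF that] A by (simp add: w_def)
  have wp: "w x > 0" if "x \<in> V" for x using uk[OF that] A by (simp add: w_def)
  have "y \<noteq> z" using contr by auto
  then have \<Lambda>: "\<Lambda> > 0" by (simp add: \<Lambda>_def)
  have "\<exists>t\<ge>0. t \<le> 1 \<and> (\<forall>d>0. \<exists>a b. a \<le> t \<and> t \<le> b \<and> b - a < d \<and> 0 \<le> a \<and> b \<le> 1 \<and> w (g b) - w (g a) > (b - a) * \<Lambda>)"
  proof (rule ccontr)
    assume *: "\<not> ?thesis"
    define P where "P a b \<longleftrightarrow> (0 \<le> a \<and> b \<le> 1 \<longrightarrow> w (g b) - w (g a) \<le> (b - a) * \<Lambda>)" for a b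
    have "(0::real) \<le> 1" by simp
    then have "P 0 1"
    proof (induction rule: Bolzano)
      case (trans a b c)
      have "(c - a) * \<Lambda> = (b - a) * \<Lambda> + (c - b) * \<Lambda>" by (simp add: algebra_simps)
      then show ?case using trans unfolding P_def by auto
    next
      case (local t)
      then obtain d where "d > 0"
        "\<not> (\<exists>a b. a \<le> t \<and> t \<le> b \<and> b - a < d \<and> 0 \<le> a \<and> b \<le> 1 \<and> w (g b) - w (g a) > (b - a) * \<Lambda>)"
        using * by blast
      then show ?case unfolding P_def by (intro exI[of _ d]) (meson not_le)
    qed
    then have "w (g 1) - w (g 0) \<le> \<Lambda>" by (simp add: P_def)
    then show False using contr by (simp add: w_def g_def \<Lambda>_def)
  qed
  then obtain t where t: "0 \<le> t" "t \<le> 1"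
    and "\<And>d. d > 0 \<Longrightarrow> \<exists>a b. a \<le> t \<and> t \<le> b \<and> b - a < d \<and> 0 \<le> a \<and> b \<le> 1 \<and> w (g b) - w (g a) > (b - a) * \<Lambda>" by blast
  then have "\<exists>a b. a \<le> t \<and> t \<le> b \<and> b - a < inverse (real (Suc n)) \<and> 0 \<le> a \<and> b \<le> 1 \<and> w (g b) - w (g a) > (b - a) * \<Lambda>" for n
    by simp
  then obtain a b where ab: "\<And>n. a n \<le> t" "\<And>n. t \<le> b n" "\<And>n. b n - a n < inverse (real (Suc n))" "\<And>n. 0 \<le> a n" "\<And>n. b n \<le> 1"
    and wab: "\<And>n. w (g (b n)) - w (g (a n)) > (b n - a n) * \<Lambda>" by metis
  have lim0: "(\<lambda>n. b n - a n) \<longlonglongrightarrow> 0"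
    by (rule tendsto_sandwich[OF _ _ tendsto_const LIMSEQ_inverse_real_of_nat])
      (use ab in \<open>auto intro!: always_eventually simp: less_imp_le intro: order_trans\<close>)
  have al: "a \<longlonglongrightarrow> t"
  proof (rule tendsto_sandwich[of "\<lambda>n. t - (b n - a n)" _ _ "\<lambda>_. t"])
    show "(\<lambda>n. t - (b n - a n)) \<longlonglongrightarrow> t" using tendsto_diff[OF tendsto_const[of t] lim0] by simp
  qed (use ab in \<open>auto intro!: always_eventually simp: algebra_simps\<close>)
  have bl: "b \<longlonglongrightarrow> t" using tendsto_add[OF lim0 al] by simp
  define x0 where "x0 = g t"
  have x0: "x0 \<in> V" using gV t by (simp add: x0_def)
  define B where "B = w x0"
  have B: "B > 0" "B\<^sup>2 = 2 * (u x0 + A)" using wp w2 x0 by (auto simp: B_def)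
  have aV: "g (a n) \<in> V" and bV: "g (b n) \<in> V" for n
    using gV[of "a n"] gV[of "b n"] ab(1)[of n] ab(2)[of n] ab(4)[of n] ab(5)[of n] t by linarith+
  have ga: "(\<lambda>n. g (a n)) \<longlonglongrightarrow> x0" unfolding g_def x0_def by (intro tendsto_intros al)
  have gb: "(\<lambda>n. g (b n)) \<longlonglongrightarrow> x0" unfolding g_def x0_def by (intro tendsto_intros bl)
  have VO: "V \<subseteq> \<Omega>" using V closure_subset by blast
  have ucont: "isCont u x" if "x \<in> V" for x
    using u(1) that op VO unfolding gsub_def by (metis continuous_on_eq_continuous_at subsetD)
  have wa: "(\<lambda>n. w (g (a n))) \<longlonglongrightarrow> B"
    unfolding w_def B_def by (intro tendsto_intros isCont_tendsto_compose[OF ucont[OF x0] ga])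
  have wb: "(\<lambda>n. w (g (b n))) \<longlonglongrightarrow> B"
    unfolding w_def B_def by (intro tendsto_intros isCont_tendsto_compose[OF ucont[OF x0] gb])
  define \<delta> where "\<delta> n = (b n - a n) * \<Lambda>" for n
  have \<delta>0: "\<delta> \<longlonglongrightarrow> 0" unfolding \<delta>_def using tendsto_mult[OF lim0 tendsto_const[of \<Lambda>]] by simp
  have "b n \<noteq> a n" for n using wab[of n] by auto
  then have \<delta>p: "\<delta> n > 0" for n using ab(1)[of n] ab(2)[of n] \<Lambda> by (auto simp: \<delta>_def less_le)
  have d1: "dist (g (b n)) (g (a n)) = \<delta> n" for n
    using ab(1)[of n] ab(2)[of n] by (simp add: dg \<delta>_def)
  \<comment> \<open>Squaring the growth of \<open>w\<close> turns it into growth of \<open>u\<close>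
    along a cone whose slope is the value of \<open>w\<close>. Read from \<open>b n\<close> back to
    \<open>a n\<close>, the same growth gives the corresponding estimate for \<open>- u\<close>; in
    the limit both slopes are \<open>B\<close>.\<close>
  have inc1: "u (g (a n)) + w (g (a n)) * \<delta> n + 1 / 2 * (\<delta> n)\<^sup>2 \<le> u (g (b n))" for n
  proof -
    have "(w (g (a n)) + \<delta> n)\<^sup>2 \<le> (w (g (b n)))\<^sup>2"
      using wab[of n] wp[OF aV[of n]] \<delta>p[of n] by (intro power_mono) (auto simp: \<delta>_def)
    then show ?thesis using w2[OF aV[of n]] w2[OF bV[of n]] by (simp add: power2_sum algebra_simps)
  qed
  have s1: "slope 1 V u x0 B"
    by (rule slope_limit[OF u(1) op ga \<delta>0 \<delta>p wa B(1) d1 inc1 VO])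
  have inc2: "- u (g (b n)) + w (g (b n)) * \<delta> n + -1 / 2 * (\<delta> n)\<^sup>2 \<le> - u (g (a n))" for n
  proof -
    have "(w (g (a n)))\<^sup>2 \<le> (w (g (b n)) - \<delta> n)\<^sup>2"
      using wab[of n] wp[OF aV[of n]] by (intro power_mono) (auto simp: \<delta>_def)
    then show ?thesis using w2[OF aV[of n]] w2[OF bV[of n]] by (simp add: power2_diff algebra_simps)
  qed
  have d2: "dist (g (a n)) (g (b n)) = \<delta> n" for n using d1[of n] by (simp add: dist_commute)
  have s2: "slope (-1) V (\<lambda>x. - u x) x0 B"
    by (rule slope_limit[OF u(2) op gb \<delta>0 \<delta>p wb B(1) d2 inc2 VO])
  have "compact (closure V)" using V(2) by simp
  moreover have "continuous_on (closure V) u" using u(1) V unfolding gsub_def by (metis continuous_on_subset)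
  ultimately have "bounded (u ` closure V)" using compact_continuous_image compact_imp_bounded by blast
  then obtain M where M: "\<And>x. x \<in> V \<Longrightarrow> \<bar>u x\<bar> \<le> M"
    unfolding bounded_iff using closure_subset[of V] by fastforce
  \<comment> \<open>For \<open>u\<close> the slope grows along the chain, so \<open>m = B\<close>.
    Each unit of length gains at least \<open>B\<close>, and the oscillation of \<open>u\<close> is
    at most \<open>2 * M\<close>.\<close>
  obtain xp sp where xp: "xp \<in> frontier V" "sp > 0" "u x0 + B * sp + 1 / 2 * sp\<^sup>2 \<le> u xp" "\<bar>F xp - F x0\<bar> \<le> sp"
  proof (rule slope_chain_to_frontier[OF u(1) op V _ x0 s1 B(1) order_refl F F1, where S = "2 * M / B"])
    fix x s assume x: "x \<in> V" and s: "0 \<le> s" and le: "u x0 + B * s + 1 / 2 * s\<^sup>2 \<le> u x"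
    have "B * s \<le> 2 * M" using le M[OF x] M[OF x0] zero_le_power2[of s] by linarith
    then show "B \<le> B + 1 * s \<and> s \<le> 2 * M / B" using s B by (simp add: field_simps)
  qed auto
  define \<kappa> where "\<kappa> = A - k"
  have \<kappa>: "\<kappa> > 0" using A by (simp add: \<kappa>_def)
  have mB: "sqrt (2 * \<kappa>) \<le> B" using uk[OF x0] by (simp add: B_def w_def \<kappa>_def)
  \<comment> \<open>For \<open>- u\<close> the slope \<open>B - s\<close> decreases with the length.
    It stays at least \<open>sqrt (2 * \<kappa>)\<close>, because the chain reaches values with
    \<open>2 * (u x + A) \<le> (B - s)\<^sup>2\<close> while \<open>- k \<le> u x\<close>.\<close>
  obtain xm sm where xm: "xm \<in> frontier V" "sm > 0" "- u x0 + B * sm + -1 / 2 * sm\<^sup>2 \<le> - u xm" "\<bar>F xm - F x0\<bar> \<le> sm"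
    "sqrt (2 * \<kappa>) \<le> B + -1 * sm"
  proof (rule slope_chain_to_frontier[OF u(2) op V _ x0 s2 _ mB F F1, where S = B])
    fix x s assume x: "x \<in> V" and s: "0 \<le> s" "0 < B + -1 * s" and le: "- u x0 + B * s + -1 / 2 * s\<^sup>2 \<le> - u x"
    have "2 * (u x + A) \<le> (B - s)\<^sup>2" using le B by (simp add: power2_diff)
    then have "2 * \<kappa> \<le> (B - s)\<^sup>2" using uk[OF x] by (simp add: \<kappa>_def)
    then have "sqrt (2 * \<kappa>) \<le> B - s" using s by (intro real_le_lsqrt) auto
    then show "sqrt (2 * \<kappa>) \<le> B + -1 * s \<and> s \<le> B" using s by simp
  qed (use \<kappa> in auto)
  have "sqrt (2 * \<kappa>) > 0" using \<kappa> by simp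
  then have "B > sm" using xm(5) by linarith
  moreover have "(B + sp)\<^sup>2 - 2 * \<kappa> \<le> (F xp)\<^sup>2"
    using xp(3) bd[OF xp(1)] B(2) by (simp add: \<kappa>_def power2_sum)
  moreover have "(F xm)\<^sup>2 \<le> (B - sm)\<^sup>2 - 2 * \<kappa>"
    using xm(3) bd[OF xm(1)] B(2) by (simp add: \<kappa>_def power2_diff)
  moreover have "F xp \<le> F x0 + sp" "F x0 - sm \<le> F xm" using xp(4) xm(4) by (auto simp: abs_le_iff)
  ultimately show False
    using sqrt_diff_strict[OF \<kappa>, of sm B sp "F xp" "F xm" "F x0"] xp xm F0 by auto
qed

text \<open>A cone of slope \<open>2 * M / R\<close> exceeds the oscillation of \<open>u\<close> on
  the sphere of radius \<open>R\<close>; comparison is applied with the vertex at either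
  point.\<close>

lemma gsub_locally_lipschitz:
  fixes u :: "'a::euclidean_space \<Rightarrow> real"
  assumes u: "gsub 1 \<Omega> u" and R: "R > 0" and M: "\<And>x. x \<in> \<Omega> \<Longrightarrow> \<bar>u x\<bar> \<le> M"
    and p: "cball p R \<subseteq> \<Omega>" and q: "cball q R \<subseteq> \<Omega>" and d: "dist p q \<le> R"
  shows "\<bar>u p - u q\<bar> \<le> (2 * M / R + R) * dist p q"
proof -
  have *: "u b - u a \<le> (2 * M / R + R) * dist p q"
    if a: "cball a R \<subseteq> \<Omega>" and b: "cball b R \<subseteq> \<Omega>" and ab: "dist b a = dist p q" for a b
  proof -
    have aO: "a \<in> \<Omega>" using a R by auto
    have M0: "M \<ge> 0" using M[OF aO] by linarith
    have "u b \<le> u a + (2 * M / R) * dist b a + 1 / 2 * (dist b a)\<^sup>2"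
    proof (rule cone_comparison[OF u a R])
      fix x assume "x \<in> sphere a R"
      then have "x \<in> \<Omega>" using a by auto
      then have "u x \<le> u a + 2 * M" using M[of x] M[OF aO] by linarith
      moreover have "2 * M / R * R = 2 * M" using R by simp
      ultimately show "u x \<le> u a + 2 * M / R * R + 1 / 2 * R\<^sup>2" using zero_le_power2[of R] by linarith
    qed (use M0 R ab d in \<open>auto simp: dist_commute intro!: add_nonneg_pos\<close>)
    moreover have "(dist p q)\<^sup>2 \<le> R * dist p q"
      unfolding power2_eq_square using d by (intro mult_right_mono) auto
    moreover have "(2 * M / R + R) * dist p q = (2 * M / R) * dist p q + R * dist p q" by (rule distrib_right)
    ultimately show ?thesis unfolding ab using zero_le_power2[of "dist p q"] by linarith
  qed
  show ?thesis using *[OF p q] *[OF q p] by (simp add: dist_commute abs_le_iff)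
qed

section \<open>Integration against bounded and compactly supported factors\<close>

lemma lborel_integral_translate:
  fixes f :: "'a::euclidean_space \<Rightarrow> real"
  assumes "f \<in> borel_measurable borel"
  shows "(LBINT x. f (c + x)) = (LBINT x. f x)"
proof -
  have "(LBINT x. f x) = (\<integral>x. f x \<partial>(distr lborel borel ((+) c)))" by (simp add: lborel_distr_plus)
  also have "\<dots> = (LBINT x. f (c + x))" using assms by (subst integral_distr) auto
  finally show ?thesis by simp
qed

lemma integrable_mult_bounded:
  fixes f g :: "'a \<Rightarrow> real"
  assumes f: "integrable M f" and g: "g \<in> borel_measurable M" and C: "\<And>x. \<bar>g x\<bar> \<le> C"
  shows "integrable M (\<lambda>x. f x * g x)"
proof (rule Bochner_Integration.integrable_bound)
  show "integrable M (\<lambda>x. C * f x)" using f by simp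
  show "(\<lambda>x. f x * g x) \<in> borel_measurable M" using f g by measurable
  show "AE x in M. norm (f x * g x) \<le> norm (C * f x)"
  proof (rule AE_I2)
    fix x
    have "\<bar>g x\<bar> \<le> \<bar>C\<bar>" using C[of x] by linarith
    then have "\<bar>f x\<bar> * \<bar>g x\<bar> \<le> \<bar>f x\<bar> * \<bar>C\<bar>" by (intro mult_left_mono) auto
    then show "norm (f x * g x) \<le> norm (C * f x)" by (simp add: abs_mult mult.commute)
  qed
qed

lemma compact_support_bounded:
  fixes f :: "'a::euclidean_space \<Rightarrow> 'b::real_normed_vector"
  assumes "continuous_on UNIV f" "compact K" "\<And>x. x \<notin> K \<Longrightarrow> f x = 0"
  obtains C where "C \<ge> 0" "\<And>x. norm (f x) \<le> C"
proof -
  have "bounded (f ` K)"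
    by (intro compact_imp_bounded compact_continuous_image continuous_on_subset[OF assms(1)] assms(2)) auto
  then obtain C where "\<And>x. x \<in> K \<Longrightarrow> norm (f x) \<le> C" by (auto simp: bounded_iff)
  then have "norm (f x) \<le> max 0 C" for x using assms(3)[of x] by (cases "x \<in> K") (auto simp: le_max_iff_disj)
  then show ?thesis using that[of "max 0 C"] by simp
qed

lemma integrable_mult_compact_support:
  fixes f p :: "'a::euclidean_space \<Rightarrow> real"
  assumes f: "set_integrable lborel K f" and K: "compact K"
    and p: "continuous_on UNIV p" and z: "\<And>x. x \<notin> K \<Longrightarrow> p x = 0"
  shows "integrable lborel (\<lambda>x. f x * p x)"
proof -
  obtain C where C: "\<And>x. norm (p x) \<le> C" using compact_support_bounded[OF p K z] by blast
  have "integrable lborel (\<lambda>x. (indicator K x *\<^sub>R f x) * p x)"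
    using f C borel_measurable_continuous_onI[OF p] unfolding set_integrable_def
    by (intro integrable_mult_bounded[where C = C]) auto
  also have "(\<lambda>x. (indicator K x *\<^sub>R f x) * p x) = (\<lambda>x. f x * p x)"
    using z by (auto simp: fun_eq_iff indicator_def)
  finally show ?thesis .
qed

section \<open>Weak gradients\<close>

subsection \<open>Test functions\<close>

lemma C1c_test_D:
  assumes "C1c_test V phi Dphi"
  shows C1c_test_has_derivative: "(phi has_derivative (\<lambda>h. Dphi x \<bullet> h)) (at x)"
    and C1c_test_continuous: "continuous_on UNIV phi"
    and C1c_test_continuous_grad: "continuous_on UNIV Dphi"
    and C1c_test_compact: "compact (closure {x. phi x \<noteq> 0})"
    and C1c_test_support: "closure {x. phi x \<noteq> 0} \<subseteq> V"
    and C1c_test_zero: "x \<notin> closure {x. phi x \<noteq> 0} \<Longrightarrow> phi x = 0"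
    and C1c_test_grad_zero: "x \<notin> closure {x. phi x \<noteq> 0} \<Longrightarrow> Dphi x = 0"
proof -
  show d: "(phi has_derivative (\<lambda>h. Dphi x \<bullet> h)) (at x)" for x using assms by (simp add: C1c_test_def)
  show "continuous_on UNIV phi"
    using has_derivative_continuous[OF d] by (intro continuous_at_imp_continuous_on) auto
  show "continuous_on UNIV Dphi" "compact (closure {x. phi x \<noteq> 0})" "closure {x. phi x \<noteq> 0} \<subseteq> V"
    using assms by (auto simp: C1c_test_def)
  assume x: "x \<notin> closure {x. phi x \<noteq> 0}"
  have z: "phi y = 0" if "y \<in> - closure {x. phi x \<noteq> 0}" for y
    using that closure_subset[of "{x. phi x \<noteq> 0}"] by auto
  show "phi x = 0" by (rule z) (use x in blast)
  have "(phi has_derivative (\<lambda>h. 0)) (at x)"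
    by (rule has_derivative_transform_within_open[OF has_derivative_const, of "- closure {x. phi x \<noteq> 0}"])
      (use x in \<open>auto intro: z[symmetric]\<close>)
  from fun_cong[OF has_derivative_unique[OF d this], of "Dphi x"] have "Dphi x \<bullet> Dphi x = 0" .
  then show "Dphi x = 0" by simp
qed

lemma C1c_test_mono: "C1c_test U phi Dphi \<Longrightarrow> U \<subseteq> V \<Longrightarrow> C1c_test V phi Dphi"
  unfolding C1c_test_def by blast

lemma C1c_testI:
  assumes "\<And>x. (phi has_derivative (\<lambda>h. Dphi x \<bullet> h)) (at x)" "continuous_on UNIV Dphi"
    "compact K" "K \<subseteq> V" "\<And>x. x \<notin> K \<Longrightarrow> phi x = 0"
  shows "C1c_test V phi Dphi"
proof -
  have "closure {x. phi x \<noteq> 0} \<subseteq> K"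
    using assms(3,5) by (intro closure_minimal compact_imp_closed) auto
  moreover from this have "compact (closure {x. phi x \<noteq> 0})"
    using compact_imp_bounded[OF assms(3)] closure_subset[of "{x. phi x \<noteq> 0}"]
    by (auto simp: compact_closure intro: bounded_subset)
  ultimately show ?thesis
    unfolding C1c_test_def using assms(1,2,4) by (intro conjI allI) auto
qed

lemma C1c_test_lincomb:
  assumes "C1c_test V phi Dphi" "C1c_test V psi Dpsi"
  shows "C1c_test V (\<lambda>x. a * phi x + b * psi x) (\<lambda>x. a *\<^sub>R Dphi x + b *\<^sub>R Dpsi x)"
proof (rule C1c_testI)
  show "((\<lambda>x. a * phi x + b * psi x) has_derivative (\<lambda>h. (a *\<^sub>R Dphi x + b *\<^sub>R Dpsi x) \<bullet> h)) (at x)" for x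
    using has_derivative_add[OF has_derivative_mult_right[OF C1c_test_has_derivative[OF assms(1)], of a]
        has_derivative_mult_right[OF C1c_test_has_derivative[OF assms(2)], of b]]
    by (simp add: inner_add_left)
  show "continuous_on UNIV (\<lambda>x. a *\<^sub>R Dphi x + b *\<^sub>R Dpsi x)"
    by (intro continuous_intros C1c_test_continuous_grad[OF assms(1)] C1c_test_continuous_grad[OF assms(2)])
  show "compact (closure {x. phi x \<noteq> 0} \<union> closure {x. psi x \<noteq> 0})"
    "closure {x. phi x \<noteq> 0} \<union> closure {x. psi x \<noteq> 0} \<subseteq> V"
    using assms by (auto simp: C1c_test_def)
  show "a * phi x + b * psi x = 0" if "x \<notin> closure {x. phi x \<noteq> 0} \<union> closure {x. psi x \<noteq> 0}" for x
    using that C1c_test_zero[OF assms(1), of x] C1c_test_zero[OF assms(2), of x] by simp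
qed

lemma C1c_test_mult:
  assumes "C1c_test V phi Dphi" "C1c_test V psi Dpsi"
  shows "C1c_test V (\<lambda>x. phi x * psi x) (\<lambda>x. phi x *\<^sub>R Dpsi x + psi x *\<^sub>R Dphi x)"
proof (rule C1c_testI)
  show "((\<lambda>x. phi x * psi x) has_derivative (\<lambda>h. (phi x *\<^sub>R Dpsi x + psi x *\<^sub>R Dphi x) \<bullet> h)) (at x)" for x
    using has_derivative_mult[OF C1c_test_has_derivative[OF assms(1)] C1c_test_has_derivative[OF assms(2)]]
    by (simp add: inner_add_left mult.commute)
  show "continuous_on UNIV (\<lambda>x. phi x *\<^sub>R Dpsi x + psi x *\<^sub>R Dphi x)"
    by (intro continuous_intros C1c_test_continuous_grad[OF assms(1)] C1c_test_continuous_grad[OF assms(2)]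
        C1c_test_continuous[OF assms(1)] C1c_test_continuous[OF assms(2)])
  show "compact (closure {x. phi x \<noteq> 0})" "closure {x. phi x \<noteq> 0} \<subseteq> V"
    using assms by (auto simp: C1c_test_def)
  show "phi x * psi x = 0" if "x \<notin> closure {x. phi x \<noteq> 0}" for x
    using that C1c_test_zero[OF assms(1), of x] by simp
qed

lemma C1c_test_LINT:
  assumes "C1c_test V phi Dphi"
  shows "(LINT x:V|lborel. f x * (Dphi x \<bullet> v)) = (LBINT x. f x * (Dphi x \<bullet> v))"
    and "(LINT x:V|lborel. h x * phi x) = (LBINT x. h x * phi x)"
proof -
  have *: "x \<notin> V \<Longrightarrow> phi x = 0 \<and> Dphi x = 0" for x
    using C1c_test_support[OF assms] C1c_test_zero[OF assms, of x] C1c_test_grad_zero[OF assms, of x] by blast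
  show "(LINT x:V|lborel. f x * (Dphi x \<bullet> v)) = (LBINT x. f x * (Dphi x \<bullet> v))"
    "(LINT x:V|lborel. h x * phi x) = (LBINT x. h x * phi x)"
    unfolding set_lebesgue_integral_def
    using * by (auto intro!: Bochner_Integration.integral_cong simp: indicator_def)
qed

subsection \<open>Lipschitz functions tested with derivatives\<close>

text \<open>The constant is uniform while the radii vary, as fits an open set that may fail to be
  convex.\<close>

definition loc_lip :: "'a::euclidean_space set \<Rightarrow> real \<Rightarrow> ('a \<Rightarrow> real) \<Rightarrow> bool" where
  "loc_lip V L u \<longleftrightarrow> (\<forall>x\<in>V. \<exists>r>0. \<forall>p\<in>ball x r. \<forall>q\<in>ball x r. \<bar>u p - u q\<bar> \<le> L * dist p q)"

lemma loc_lip_isCont: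
  assumes "loc_lip V L u" "x \<in> V"
  shows "isCont u x"
proof -
  obtain r where r: "r > 0" "\<And>p q. p \<in> ball x r \<Longrightarrow> q \<in> ball x r \<Longrightarrow> \<bar>u p - u q\<bar> \<le> L * dist p q"
    using assms unfolding loc_lip_def by blast
  show ?thesis
  proof (rule continuous_at_eps_delta[THEN iffD2], intro allI impI)
    fix e :: real assume e: "e > 0"
    show "\<exists>d>0. \<forall>x'. dist x' x < d \<longrightarrow> dist (u x') (u x) < e"
    proof (intro exI[of _ "min r (e / (\<bar>L\<bar> + 1))"] conjI allI impI)
      show "min r (e / (\<bar>L\<bar> + 1)) > 0" using e r by simp
      fix y assume y: "dist y x < min r (e / (\<bar>L\<bar> + 1))"
      have "dist (u y) (u x) \<le> L * dist y x" using r(2)[of y x] y r(1) by (simp add: dist_real_def dist_commute)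
      also have "\<dots> \<le> (\<bar>L\<bar> + 1) * dist y x" by (intro mult_right_mono) auto
      also have "\<dots> < e" using y by (simp add: field_simps)
      finally show "dist (u y) (u x) < e" .
    qed
  qed
qed

lemma loc_lip_continuous_on: "loc_lip V L u \<Longrightarrow> continuous_on V u"
  by (intro continuous_at_imp_continuous_on ballI loc_lip_isCont)

text \<open>Summation by parts for difference quotients: a translation moves the increment from
  \<open>phi\<close> to \<open>u\<close>, where the Lipschitz bound applies. The \<open>L^1\<close>
  norm of \<open>phi\<close> on the right is what the representation of the functional asks
  for.\<close>

lemma loc_lip_test_bound:
  fixes u :: "'a::euclidean_space \<Rightarrow> real"
  assumes V: "open V" and u: "loc_lip V L u" and t: "C1c_test V phi Dphi"
  shows "\<bar>LBINT x. u x * (Dphi x \<bullet> v)\<bar> \<le> L * norm v * (LBINT x. \<bar>phi x\<bar>)"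
proof -
  define K where "K = closure {x. phi x \<noteq> 0}"
  have K: "compact K" "K \<subseteq> V" using C1c_test_compact[OF t] C1c_test_support[OF t] by (auto simp: K_def)
  have zK: "phi x = 0" "Dphi x = 0" if "x \<notin> K" for x
    using that C1c_test_zero[OF t, of x] C1c_test_grad_zero[OF t, of x] by (auto simp: K_def)
  define \<G> where "\<G> = {ball x r | x r. ball x r \<subseteq> V \<and> (\<forall>p\<in>ball x r. \<forall>q\<in>ball x r. \<bar>u p - u q\<bar> \<le> L * dist p q)}"
  have "\<exists>G\<in>\<G>. x \<in> G" if x: "x \<in> K" for x
  proof -
    obtain r1 where r1: "r1 > 0" "ball x r1 \<subseteq> V" using V K x openE by blast
    obtain r2 where r2: "r2 > 0" "\<forall>p\<in>ball x r2. \<forall>q\<in>ball x r2. \<bar>u p - u q\<bar> \<le> L * dist p q"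
      using u K x unfolding loc_lip_def by blast
    have "ball x (min r1 r2) \<in> \<G>" unfolding \<G>_def mem_Collect_eq
      by (rule exI[of _ x], rule exI[of _ "min r1 r2"]) (use r1 r2 in \<open>auto simp: subset_iff\<close>)
    then show ?thesis using r1 r2 by (intro bexI[of _ "ball x (min r1 r2)"]) auto
  qed
  then have cov: "K \<subseteq> \<Union>\<G>" by blast
  have "open G" if "G \<in> \<G>" for G using that unfolding \<G>_def by auto
  \<comment> \<open>A Lebesgue number of the cover: points within \<open>e\<close> of the support
    share a ball with the Lipschitz estimate.\<close>
  from Heine_Borel_lemma[OF K(1) cov this] obtain e where e: "e > 0" and eb: "\<And>x. x \<in> K \<Longrightarrow> \<exists>G\<in>\<G>. ball x e \<subseteq> G"
    by blast
  have eV: "y \<in> V" and eL: "\<bar>u x - u y\<bar> \<le> L * dist x y" if "x \<in> K" "dist x y < e" for x y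
  proof -
    obtain G where G: "G \<in> \<G>" "ball x e \<subseteq> G" using eb \<open>x \<in> K\<close> by blast
    then have "x \<in> G" "y \<in> G" using e that(2) by (auto simp: subset_iff)
    then show "y \<in> V" "\<bar>u x - u y\<bar> \<le> L * dist x y" using G(1) unfolding \<G>_def by blast+
  qed
  define K' where "K' = (\<lambda>(x, y). x + y) ` (K \<times> cball 0 (e / 2))"
  have K'c: "compact K'" unfolding K'_def
    by (intro compact_continuous_image compact_Times K compact_cball) (auto intro!: continuous_intros simp: case_prod_unfold)
  have K'I: "x + k \<in> K'" if "x \<in> K" "norm k \<le> e / 2" for x k using that unfolding K'_def by force
  have KK': "x \<in> K'" if "x \<in> K" for x using K'I[OF that, of 0] e by simp
  have K'V: "K' \<subseteq> V" unfolding K'_def using eV e by (auto simp: dist_norm)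
  have cu: "continuous_on K' u" using loc_lip_continuous_on[OF u] K'V continuous_on_subset by blast
  \<comment> \<open>Nothing is known about \<open>u\<close> outside \<open>V\<close>. The cutoff at
    a compact neighbourhood of the support makes it integrable and leaves it unchanged at all
    shifted points.\<close>
  define U where "U x = indicator K' x *\<^sub>R u x" for x
  have intU: "integrable lborel U" unfolding U_def by (rule borel_integrable_compact[OF K'c cu])
  have mU[measurable]: "U \<in> borel_measurable borel" using borel_measurable_integrable[OF intU] by simp
  have pc: "continuous_on UNIV phi" and Dc: "continuous_on UNIV Dphi"
    using C1c_test_continuous[OF t] C1c_test_continuous_grad[OF t] by auto
  have mp[measurable]: "phi \<in> borel_measurable borel" using borel_measurable_continuous_onI[OF pc] by simp
  obtain C where C: "C \<ge> 0" "\<And>x. norm (Dphi x) \<le> C" using compact_support_bounded[OF Dc K(1) zK(2)] by blast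
  obtain C1 where C1: "\<And>x. norm (phi x) \<le> C1" using compact_support_bounded[OF pc K(1) zK(1)] by blast
  have plip: "\<bar>phi x - phi y\<bar> \<le> C * norm (x - y)" for x y
  proof -
    have "norm (phi x - phi y) \<le> C * norm (x - y)"
    proof (rule differentiable_bound[of UNIV phi "\<lambda>x h. Dphi x \<bullet> h"])
      show "(phi has_derivative (\<lambda>h. Dphi x \<bullet> h)) (at x within UNIV)" for x using C1c_test_has_derivative[OF t] by simp
      show "onorm (\<lambda>h. Dphi x \<bullet> h) \<le> C" for x
      proof (rule onorm_bound[OF C(1)])
        fix h show "norm (Dphi x \<bullet> h) \<le> C * norm h"
          using Cauchy_Schwarz_ineq2[of "Dphi x" h] mult_right_mono[OF C(2)[of x], of "norm h"] by simp
      qed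
    qed auto
    then show ?thesis by simp
  qed
  have intp: "integrable lborel phi"
  proof -
    have "integrable lborel (\<lambda>x. indicator K x *\<^sub>R phi x)" 
      by (rule borel_integrable_compact[OF K(1)]) (use pc continuous_on_subset in blast)
    also have "(\<lambda>x. indicator K x *\<^sub>R phi x) = phi" using zK by (auto simp: fun_eq_iff indicator_def)
    finally show ?thesis .
  qed
  \<comment> \<open>The factor ensures \<open>h n * norm v \<le> e / 2\<close>, so shifts of
    \<open>K\<close> stay in \<open>K'\<close>; the summand \<open>1\<close> covers
    \<open>v = 0\<close>.\<close>
  define h where "h n = e / (2 * (norm v + 1)) * inverse (real (Suc n))" for n
  have h0: "h n > 0" for n using e norm_ge_zero[of v] by (simp add: h_def add_nonneg_pos)
  have hk: "norm (h n *\<^sub>R v) \<le> e / 2" for n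
  proof -
    have nv: "norm v + 1 > 0" using norm_ge_zero[of v] by linarith
    have "inverse (real (Suc n)) \<le> 1" by (simp add: field_simps)
    then have "h n \<le> e / (2 * (norm v + 1)) * 1"
      unfolding h_def using e nv by (intro mult_left_mono divide_nonneg_nonneg) auto
    then have "h n * norm v \<le> e / (2 * (norm v + 1)) * norm v" by (intro mult_right_mono) auto
    also have "\<dots> = e / 2 * (norm v / (norm v + 1))" by simp
    also have "\<dots> \<le> e / 2 * 1" using e nv by (intro mult_left_mono) (auto simp: divide_le_eq)
    finally show ?thesis using h0[of n] by simp
  qed
  have hl: "h \<longlonglongrightarrow> 0" unfolding h_def
    using tendsto_mult[OF tendsto_const[of "e / (2 * (norm v + 1))"] LIMSEQ_inverse_real_of_nat] by simp
  define Q where "Q n x = U x * ((phi x - phi (x - h n *\<^sub>R v)) / h n)" for n x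
  have Qlim: "(\<lambda>n. integral\<^sup>L lborel (Q n)) \<longlonglongrightarrow> (LBINT x. U x * (Dphi x \<bullet> v))"
  proof (rule integral_dominated_convergence[where w = "\<lambda>x. C * norm v * \<bar>U x\<bar>"])
    have "(\<lambda>x. Dphi x \<bullet> v) \<in> borel_measurable borel"
      by (rule borel_measurable_continuous_onI) (intro continuous_intros Dc)
    then show "(\<lambda>x. U x * (Dphi x \<bullet> v)) \<in> borel_measurable lborel" by measurable
    show "Q n \<in> borel_measurable lborel" for n unfolding Q_def by measurable
    show "integrable lborel (\<lambda>x. C * norm v * \<bar>U x\<bar>)" using intU by simp
    show "AE x in lborel. (\<lambda>n. Q n x) \<longlonglongrightarrow> U x * (Dphi x \<bullet> v)"
    proof (rule AE_I2)
      fix x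
      have dl: "((\<lambda>s. x - s *\<^sub>R v) has_derivative (\<lambda>s. - (s *\<^sub>R v))) (at 0)"
        by (auto intro!: derivative_eq_intros)
      have "((\<lambda>s. phi (x - s *\<^sub>R v)) has_derivative (\<lambda>s. Dphi x \<bullet> (- (s *\<^sub>R v)))) (at 0)"
        using has_derivative_compose[OF dl, of phi "\<lambda>h. Dphi x \<bullet> h"] C1c_test_has_derivative[OF t] by simp
      then have "((\<lambda>s. phi (x - s *\<^sub>R v)) has_real_derivative (- (Dphi x \<bullet> v))) (at 0)"
        unfolding has_field_derivative_def by (rule has_derivative_eq_rhs) (simp add: fun_eq_iff)
      then have "((\<lambda>s. (phi (x - s *\<^sub>R v) - phi x) / s) \<longlongrightarrow> - (Dphi x \<bullet> v)) (at 0)"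
        by (simp add: DERIV_def)
      moreover have "filterlim h (at 0) sequentially"
        unfolding filterlim_at using hl h0 by (auto simp: less_le intro!: always_eventually)
      ultimately have "(\<lambda>n. (phi (x - h n *\<^sub>R v) - phi x) / h n) \<longlonglongrightarrow> - (Dphi x \<bullet> v)"
        by (rule filterlim_compose)
      from tendsto_mult[OF tendsto_const[of "- U x"] this]
      show "(\<lambda>n. Q n x) \<longlonglongrightarrow> U x * (Dphi x \<bullet> v)"
        by (simp add: Q_def diff_divide_distrib algebra_simps)
    qed
    show "AE x in lborel. norm (Q n x) \<le> C * norm v * \<bar>U x\<bar>" for n
    proof (rule AE_I2)
      fix x
      have "\<bar>phi x - phi (x - h n *\<^sub>R v)\<bar> \<le> C * (h n * norm v)" using plip[of x "x - h n *\<^sub>R v"] h0[of n] by simp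
      then have "\<bar>(phi x - phi (x - h n *\<^sub>R v)) / h n\<bar> \<le> C * norm v" using h0[of n] by (simp add: abs_divide field_simps)
      from mult_left_mono[OF this, of "\<bar>U x\<bar>"] show "norm (Q n x) \<le> C * norm v * \<bar>U x\<bar>"
        by (simp add: Q_def abs_mult mult.commute)
    qed
  qed
  have Qb: "\<bar>integral\<^sup>L lborel (Q n)\<bar> \<le> L * norm v * (LBINT x. \<bar>phi x\<bar>)" for n
  proof -
    let ?k = "h n *\<^sub>R v"
    have i1: "integrable lborel (\<lambda>x. U x * phi x)"
      using C1 by (intro integrable_mult_bounded[OF intU]) auto
    have i2: "integrable lborel (\<lambda>x. U x * phi (x - ?k))"
      using C1 by (intro integrable_mult_bounded[OF intU]) auto
    have i3: "integrable lborel (\<lambda>x. U (?k + x) * phi x)"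
    proof -
      have "integrable (distr lborel borel ((+) ?k)) (\<lambda>x. U x * phi (x - ?k))" using i2 by (simp add: lborel_distr_plus)
      then have "integrable lborel (\<lambda>x. U (?k + x) * phi (?k + x - ?k))"
        by (subst (asm) integrable_distr_eq) auto
      then show ?thesis by simp
    qed
    have "(LBINT x. U x * phi (x - ?k)) = (LBINT x. U (?k + x) * phi (?k + x - ?k))"
      by (rule lborel_integral_translate[symmetric]) measurable
    then have tr: "(LBINT x. U x * phi (x - ?k)) = (LBINT x. U (?k + x) * phi x)" by simp
    have "integral\<^sup>L lborel (Q n) = (LBINT x. (U x * phi x - U x * phi (x - ?k)) / h n)"
      by (intro Bochner_Integration.integral_cong) (auto simp: Q_def algebra_simps diff_divide_distrib)
    also have "\<dots> = (LBINT x. U x * phi x - U (?k + x) * phi x) / h n"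
      using i1 i2 i3 tr by simp
    finally have eq: "integral\<^sup>L lborel (Q n) = (LBINT x. U x * phi x - U (?k + x) * phi x) / h n" .
    have "norm (LBINT x. U x * phi x - U (?k + x) * phi x) \<le> (LBINT x. L * norm ?k * \<bar>phi x\<bar>)"
    proof (rule order_trans[OF integral_norm_bound integral_mono])
      show "integrable lborel (\<lambda>x. norm (U x * phi x - U (?k + x) * phi x))" using i1 i3 by simp
      show "integrable lborel (\<lambda>x. L * norm ?k * \<bar>phi x\<bar>)" using intp by simp
      fix x
      show "norm (U x * phi x - U (?k + x) * phi x) \<le> L * norm ?k * \<bar>phi x\<bar>"
      proof (cases "x \<in> K")
        case True
        have "?k + x \<in> K'" using K'I[OF True hk[of n]] by (simp add: add.commute)
        then have "U x = u x" "U (?k + x) = u (?k + x)" using KK'[OF True] by (auto simp: U_def)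
        moreover have "\<bar>u x - u (?k + x)\<bar> \<le> L * norm ?k"
          using eL[OF True, of "?k + x"] hk[of n] e by (simp add: dist_norm)
        from mult_right_mono[OF this, of "\<bar>phi x\<bar>"]
        have "\<bar>u x - u (?k + x)\<bar> * \<bar>phi x\<bar> \<le> L * norm ?k * \<bar>phi x\<bar>" by simp
        ultimately show ?thesis by (simp only: left_diff_distrib[symmetric] real_norm_def abs_mult)
      qed (simp add: zK)
    qed
    also have "\<dots> = h n * (L * norm v * (LBINT x. \<bar>phi x\<bar>))" using h0[of n] by simp
    finally show ?thesis unfolding eq using h0[of n] by (simp add: abs_divide divide_le_eq mult.commute)
  qed
  have "(LBINT x. U x * (Dphi x \<bullet> v)) = (LBINT x. u x * (Dphi x \<bullet> v))"
  proof (intro Bochner_Integration.integral_cong refl)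
    fix x show "U x * (Dphi x \<bullet> v) = u x * (Dphi x \<bullet> v)"
      using zK(2)[of x] KK'[of x] by (cases "x \<in> K") (auto simp: U_def)
  qed
  moreover have "\<bar>LBINT x. U x * (Dphi x \<bullet> v)\<bar> \<le> L * norm v * (LBINT x. \<bar>phi x\<bar>)"
    by (rule LIMSEQ_le_const2[OF tendsto_rabs[OF Qlim]]) (use Qb in auto)
  ultimately show ?thesis by simp
qed

text \<open>Riesz representation on the (not necessarily closed) space of test functions \<open>\<phi>\<close>, where
  \<open>P \<phi> t\<close> says that the functional has the value \<open>t\<close> at \<open>\<phi>\<close>: a minimising sequence of
  \<open>(\<integral>\<phi>\<^sup>2) / 2 - t\<close> is fast Cauchy in \<open>L\<^sup>1\<close>.\<close>

lemma riesz_bounded_functional: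
  fixes P :: "('a \<Rightarrow> real) \<Rightarrow> real \<Rightarrow> bool"
  assumes fin: "finite_measure M"
    and ne: "P \<phi>0 t0"
    and lin: "\<And>\<phi> s \<psi> t a b. P \<phi> s \<Longrightarrow> P \<psi> t \<Longrightarrow> P (\<lambda>x. a * \<phi> x + b * \<psi> x) (a * s + b * t)"
    and meas: "\<And>\<phi> t. P \<phi> t \<Longrightarrow> \<phi> \<in> borel_measurable M"
    and bdd: "\<And>\<phi> t. P \<phi> t \<Longrightarrow> \<exists>C. \<forall>x. \<bar>\<phi> x\<bar> \<le> C"
    and bd: "\<And>\<phi> t. P \<phi> t \<Longrightarrow> \<bar>t\<bar> \<le> L * (\<integral>x. \<bar>\<phi> x\<bar> \<partial>M)"
  obtains g where "integrable M g" "\<And>\<phi> t. P \<phi> t \<Longrightarrow> t = (\<integral>x. g x * \<phi> x \<partial>M)"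
proof -
  interpret finite_measure M by fact
  define \<mu> where "\<mu> = measure M (space M)"
  have int: "integrable M \<phi>" if p: "P \<phi> t" for \<phi> t
  proof -
    obtain C where "\<And>x. \<bar>\<phi> x\<bar> \<le> C" using bdd[OF p] by blast
    then show ?thesis using meas[OF p] by (intro integrable_const_bound[of _ C]) auto
  qed
  have intm: "integrable M (\<lambda>x. \<phi> x * \<psi> x)" if p: "P \<phi> t" "integrable M \<psi>" for \<phi> t \<psi>
  proof -
    obtain C where C: "\<And>x. \<bar>\<phi> x\<bar> \<le> C" using bdd[OF p(1)] by blast
    have "integrable M (\<lambda>x. C * \<psi> x)" using that(2) by simp
    then show ?thesis
    proof (rule Bochner_Integration.integrable_bound)
      show "(\<lambda>x. \<phi> x * \<psi> x) \<in> borel_measurable M" using meas[OF that(1)] that(2) by measurable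
      show "AE x in M. norm (\<phi> x * \<psi> x) \<le> norm (C * \<psi> x)"
      proof (rule AE_I2)
        fix x
        have "\<bar>\<phi> x\<bar> \<le> \<bar>C\<bar>" using C[of x] by linarith
        then show "norm (\<phi> x * \<psi> x) \<le> norm (C * \<psi> x)" by (simp add: abs_mult mult_right_mono)
      qed
    qed
  qed
  have int2: "integrable M (\<lambda>x. \<phi> x * \<psi> x)" if "P \<phi> s" "P \<psi> t" for \<phi> \<psi> s t
    by (rule intm[OF that(1) int[OF that(2)]])
  define N where "N \<phi> \<psi> = (\<integral>x. \<phi> x * \<psi> x \<partial>M)" for \<phi> \<psi> :: "'a \<Rightarrow> real"
  define J where "J \<phi> t = N \<phi> \<phi> / 2 - t" for \<phi> t
  have Nlin: "N (\<lambda>x. a * \<phi> x + b * \<psi> x) (\<lambda>x. a * \<phi> x + b * \<psi> x) = a\<^sup>2 * N \<phi> \<phi> + 2 * a * b * N \<phi> \<psi> + b\<^sup>2 * N \<psi> \<psi>"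
    if "P \<phi> s" "P \<psi> t" for \<phi> \<psi> s t a b
  proof -
    have "N (\<lambda>x. a * \<phi> x + b * \<psi> x) (\<lambda>x. a * \<phi> x + b * \<psi> x)
       = (\<integral>x. a\<^sup>2 * (\<phi> x * \<phi> x) + 2 * a * b * (\<phi> x * \<psi> x) + b\<^sup>2 * (\<psi> x * \<psi> x) \<partial>M)"
      unfolding N_def by (intro Bochner_Integration.integral_cong) (auto simp: power2_eq_square algebra_simps)
    also have "\<dots> = a\<^sup>2 * N \<phi> \<phi> + 2 * a * b * N \<phi> \<psi> + b\<^sup>2 * N \<psi> \<psi>"
      unfolding N_def using int2[OF that(1) that(1)] int2[OF that] int2[OF that(2) that(2)] by simp
    finally show ?thesis .
  qed
  \<comment> \<open>Young's inequality with a free parameter, which bounds the \<open>L^1\<close>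
    norm by the quadratic form on a finite measure space. The choice \<open>l = 1 / K\<close> bounds
    \<open>J\<close> from below, and \<open>l = 2^n\<close> yields geometric decay.\<close>
  have L1: "2 * (\<integral>x. \<bar>\<phi> x\<bar> \<partial>M) \<le> l * N \<phi> \<phi> + \<mu> / l" if "P \<phi> t" "l > 0" for \<phi> t l
  proof -
    have "(\<integral>x. 2 * \<bar>\<phi> x\<bar> \<partial>M) \<le> (\<integral>x. l * (\<phi> x * \<phi> x) + 1 / l \<partial>M)"
    proof (rule integral_mono)
      show "integrable M (\<lambda>x. 2 * \<bar>\<phi> x\<bar>)" using int[OF that(1)] by simp
      show "integrable M (\<lambda>x. l * (\<phi> x * \<phi> x) + 1 / l)" using int2[OF that(1) that(1)] by simp
      fix x
      have "0 \<le> (l * \<bar>\<phi> x\<bar> - 1)\<^sup>2 / l" using that by simp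
      also have "\<dots> = l * (\<phi> x * \<phi> x) + 1 / l - 2 * \<bar>\<phi> x\<bar>"
        using that(2) by (simp add: power2_diff power_mult_distrib field_simps power2_eq_square abs_mult_self_eq)
      finally show "2 * \<bar>\<phi> x\<bar> \<le> l * (\<phi> x * \<phi> x) + 1 / l" by simp
    qed
    then show ?thesis using int2[OF that(1) that(1)] by (simp add: N_def \<mu>_def)
  qed
  define K where "K = \<bar>L\<bar> + 1"
  have K: "K > 0" "L \<le> K" by (auto simp: K_def)
  have Jlow: "- (K\<^sup>2 * \<mu> / 2) \<le> J \<phi> t" if "P \<phi> t" for \<phi> t
  proof -
    have nn: "0 \<le> (\<integral>x. \<bar>\<phi> x\<bar> \<partial>M)" by simp
    have "t \<le> L * (\<integral>x. \<bar>\<phi> x\<bar> \<partial>M)" using bd[OF that] by linarith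
    also have "\<dots> \<le> K * (\<integral>x. \<bar>\<phi> x\<bar> \<partial>M)" using K nn by (intro mult_right_mono) auto
    finally have "2 * t \<le> K * (2 * (\<integral>x. \<bar>\<phi> x\<bar> \<partial>M))" by simp
    also have "\<dots> \<le> K * (1 / K * N \<phi> \<phi> + \<mu> / (1 / K))"
      using K by (intro mult_left_mono L1[OF that]) auto
    also have "\<dots> = N \<phi> \<phi> + K\<^sup>2 * \<mu>" using K by (simp add: field_simps power2_eq_square)
    finally show ?thesis by (simp add: J_def)
  qed
  define S where "S = {J \<phi> t | \<phi> t. P \<phi> t}"
  define m where "m = Inf S"
  have Sne: "S \<noteq> {}" using ne by (auto simp: S_def)
  have Sbd: "bdd_below S" using Jlow by (auto simp: S_def bdd_below_def)
  have mle: "m \<le> J \<phi> t" if "P \<phi> t" for \<phi> t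
    unfolding m_def using that by (intro cInf_lower Sbd) (auto simp: S_def)
  \<comment> \<open>The rate \<open>(1/4)^n\<close> outweighs the factor \<open>2^n\<close> that is
    spent in passing to \<open>L^1\<close>.\<close>
  have "\<exists>\<phi> t. P \<phi> t \<and> J \<phi> t < m + (1/4)^n" for n :: nat
  proof -
    have "\<exists>z\<in>S. z < m + (1/4)^n" unfolding m_def using Sne Sbd by (intro cInf_lessD) auto
    then show ?thesis by (auto simp: S_def)
  qed
  then obtain \<phi> t where P: "\<And>n. P (\<phi> n) (t n)" and Jn: "\<And>n. J (\<phi> n) (t n) < m + (1/4)^n" by metis
  define d where "d n x = \<phi> (Suc n) x - \<phi> n x" for n x
  have Pd: "P (d n) (t (Suc n) - t n)" for n
    using lin[OF P[of "Suc n"] P[of n], of 1 "-1"] by (simp add: d_def[abs_def])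
  \<comment> \<open>Parallelogram law: the midpoint of two near-minimisers still has value at least
    \<open>m\<close>, so they are close.\<close>
  have dN: "N (d n) (d n) \<le> 8 * (1/4)^n" for n
  proof -
    have "m \<le> J (\<lambda>x. 1/2 * \<phi> (Suc n) x + 1/2 * \<phi> n x) (1/2 * t (Suc n) + 1/2 * t n)"
      by (rule mle) (rule lin[OF P P])
    also have "\<dots> = (1/4 * N (\<phi> (Suc n)) (\<phi> (Suc n)) + 1/2 * N (\<phi> (Suc n)) (\<phi> n) + 1/4 * N (\<phi> n) (\<phi> n)) / 2 - (1/2 * t (Suc n) + 1/2 * t n)"
      unfolding J_def Nlin[OF P P] by (simp add: power2_eq_square)
    finally have 1: "m \<le> \<dots>" .
    have 2: "N (d n) (d n) = N (\<phi> (Suc n)) (\<phi> (Suc n)) - 2 * N (\<phi> (Suc n)) (\<phi> n) + N (\<phi> n) (\<phi> n)"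
      using Nlin[OF P[of "Suc n"] P[of n], of 1 "-1"] by (simp add: d_def[abs_def])
    have 3: "a - 2 * c + b \<le> 8 * e"
      if "m \<le> (1/4 * a + 1/2 * c + 1/4 * b) / 2 - (1/2 * r + 1/2 * s)" "b / 2 - s < m + e" "a / 2 - r < m + e'" "e' \<le> e"
      for a b c e e' r s :: real
      using that by (simp add: field_simps)
    show ?thesis unfolding 2
      by (rule 3[OF 1 Jn[of n, unfolded J_def] Jn[of "Suc n", unfolded J_def]]) simp
  qed
  have dL1: "(\<integral>x. \<bar>d n x\<bar> \<partial>M) \<le> (4 + \<mu> / 2) * (1/2)^n" for n
  proof -
    have "2 * (\<integral>x. \<bar>d n x\<bar> \<partial>M) \<le> 2^n * N (d n) (d n) + \<mu> / 2^n" by (rule L1[OF Pd]) simp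
    also have "\<dots> \<le> 2^n * (8 * (1/4)^n) + \<mu> / 2^n" using dN[of n] by simp
    also have "(2::real)^n * (8 * (1/4)^n) = 8 * (1/2)^n"
      by (simp add: power_mult_distrib[symmetric] mult.left_commute)
    finally show ?thesis by (simp add: field_simps)
  qed
  have intd: "integrable M (d n)" for n by (rule int[OF Pd])
  have sumd: "summable (\<lambda>n. \<integral>x. norm (d n x) \<partial>M)"
  proof (rule summable_comparison_test[of _ "\<lambda>n. (4 + \<mu> / 2) * (1/2)^n"])
    show "summable (\<lambda>n. (4 + \<mu> / 2) * (1/2)^n)" by (intro summable_mult summable_geometric) simp
    show "\<exists>N. \<forall>n\<ge>N. norm (\<integral>x. norm (d n x) \<partial>M) \<le> (4 + \<mu> / 2) * (1/2)^n"
      using dL1 by auto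
  qed
  have AEs: "AE x in M. summable (\<lambda>n. norm (d n x))"
  proof -
    have "(\<integral>\<^sup>+x. (\<Sum>n. ennreal (norm (d n x))) \<partial>M) = (\<Sum>n. \<integral>\<^sup>+x. ennreal (norm (d n x)) \<partial>M)"
      using intd by (intro nn_integral_suminf) auto
    also have "\<dots> = (\<Sum>n. ennreal (\<integral>x. norm (d n x) \<partial>M))"
      using intd by (intro suminf_cong nn_integral_eq_integral) auto
    also have "\<dots> \<noteq> \<infinity>" using sumd by (simp add: ennreal_suminf_neq_top)
    finally have "(\<integral>\<^sup>+x. (\<Sum>n. ennreal (norm (d n x))) \<partial>M) \<noteq> \<infinity>" .
    then have "AE x in M. (\<Sum>n. ennreal (norm (d n x))) \<noteq> \<infinity>"
      using intd by (intro nn_integral_noteq_infinite) auto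
    then show ?thesis
      by eventually_elim (intro summable_suminf_not_top, auto)
  qed
  define g where "g x = \<phi> 0 x + (\<Sum>n. d n x)" for x
  have ig: "integrable M g" unfolding g_def
    by (intro Bochner_Integration.integrable_add int[OF P] integrable_suminf intd AEs sumd)
  have rep: "s = (\<integral>x. g x * \<psi> x \<partial>M)" if Ps: "P \<psi> s" for \<psi> s
  proof -
    obtain C where C: "\<And>x. \<bar>\<psi> x\<bar> \<le> C" using bdd[OF Ps] by blast
    have idp: "integrable M (\<lambda>x. d n x * \<psi> x)" for n by (rule int2[OF Pd Ps])
    have AEp: "AE x in M. summable (\<lambda>n. norm (d n x * \<psi> x))"
      using AEs by eventually_elim (simp add: abs_mult summable_mult2)
    have sump: "summable (\<lambda>n. \<integral>x. norm (d n x * \<psi> x) \<partial>M)"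
    proof (rule summable_comparison_test[of _ "\<lambda>n. (\<integral>x. norm (d n x) \<partial>M) * C"])
      show "summable (\<lambda>n. (\<integral>x. norm (d n x) \<partial>M) * C)" by (intro summable_mult2 sumd)
      show "\<exists>N. \<forall>n\<ge>N. norm (\<integral>x. norm (d n x * \<psi> x) \<partial>M) \<le> (\<integral>x. norm (d n x) \<partial>M) * C"
      proof (intro exI[of _ 0] allI impI)
        fix n
        have "(\<integral>x. norm (d n x * \<psi> x) \<partial>M) \<le> (\<integral>x. norm (d n x) * C \<partial>M)"
        proof (rule integral_mono)
          show "norm (d n x * \<psi> x) \<le> norm (d n x) * C" for x
            using C[of x] by (simp add: abs_mult mult_left_mono)
        qed (use idp[of n] intd[of n] in auto)
        then show "norm (\<integral>x. norm (d n x * \<psi> x) \<partial>M) \<le> (\<integral>x. norm (d n x) \<partial>M) * C" by simp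
      qed
    qed
    have "(\<lambda>n. \<integral>x. d n x * \<psi> x \<partial>M) sums (\<integral>x. (\<Sum>n. d n x * \<psi> x) \<partial>M)"
      by (rule sums_integral[OF idp AEp sump])
    then have "(\<lambda>n. \<Sum>i<n. \<integral>x. d i x * \<psi> x \<partial>M) \<longlonglongrightarrow> (\<integral>x. (\<Sum>n. d n x * \<psi> x) \<partial>M)"
      by (simp add: sums_def)
    moreover have "(\<Sum>i<n. \<integral>x. d i x * \<psi> x \<partial>M) = N (\<phi> n) \<psi> - N (\<phi> 0) \<psi>" for n
    proof (induction n)
      case (Suc n)
      have "(\<integral>x. d n x * \<psi> x \<partial>M) = (\<integral>x. \<phi> (Suc n) x * \<psi> x - \<phi> n x * \<psi> x \<partial>M)"
        by (intro Bochner_Integration.integral_cong) (auto simp: d_def algebra_simps)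
      also have "\<dots> = N (\<phi> (Suc n)) \<psi> - N (\<phi> n) \<psi>"
        using int2[OF P[of "Suc n"] Ps] int2[OF P[of n] Ps] by (simp add: N_def)
      finally show ?case using Suc by simp
    qed simp
    ultimately have l1: "(\<lambda>n. N (\<phi> n) \<psi> - N (\<phi> 0) \<psi>) \<longlonglongrightarrow> (\<integral>x. (\<Sum>n. d n x * \<psi> x) \<partial>M)" by simp
    have "(\<integral>x. g x * \<psi> x \<partial>M) = (\<integral>x. \<phi> 0 x * \<psi> x + (\<Sum>n. d n x * \<psi> x) \<partial>M)"
    proof (rule integral_cong_AE)
      show "(\<lambda>x. g x * \<psi> x) \<in> borel_measurable M" using ig meas[OF Ps] by measurable
      show "(\<lambda>x. \<phi> 0 x * \<psi> x + (\<Sum>n. d n x * \<psi> x)) \<in> borel_measurable M"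
        using int2[OF P[of 0] Ps] integrable_suminf[OF idp AEp sump] by measurable
      show "AE x in M. g x * \<psi> x = \<phi> 0 x * \<psi> x + (\<Sum>n. d n x * \<psi> x)"
        using AEs by eventually_elim (simp add: g_def distrib_right suminf_mult2[OF summable_norm_cancel])
    qed
    also have "\<dots> = N (\<phi> 0) \<psi> + (\<integral>x. (\<Sum>n. d n x * \<psi> x) \<partial>M)"
      using int2[OF P[of 0] Ps] integrable_suminf[OF idp AEp sump] by (simp add: N_def)
    finally have "(\<lambda>n. N (\<phi> n) \<psi>) \<longlonglongrightarrow> (\<integral>x. g x * \<psi> x \<partial>M)"
      using tendsto_add[OF tendsto_const[of "N (\<phi> 0) \<psi>"] l1] by simp
    then have lim: "(\<lambda>n. N (\<phi> n) \<psi> - s) \<longlonglongrightarrow> (\<integral>x. g x * \<psi> x \<partial>M) - s" by (intro tendsto_intros)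
    define a where "a = (\<integral>x. g x * \<psi> x \<partial>M) - s"
    define Q where "Q = N \<psi> \<psi>"
    have Q: "Q \<ge> 0" by (simp add: Q_def N_def)
    \<comment> \<open>First variation: \<open>J\<close> at \<open>\<phi> n + r * \<psi>\<close> is
      at least \<open>m\<close>. In the limit a quadratic in \<open>r\<close> without constant term
      is nonnegative, which forces its linear coefficient \<open>a\<close> to vanish.\<close>
    have var: "0 \<le> r * a + r\<^sup>2 * Q / 2" for r
    proof -
      have "- ((1/4)^n) \<le> r * (N (\<phi> n) \<psi> - s) + r\<^sup>2 * Q / 2" for n
      proof -
        have "m \<le> J (\<lambda>x. 1 * \<phi> n x + r * \<psi> x) (1 * t n + r * s)" by (rule mle) (rule lin[OF P Ps])
        also have "\<dots> = J (\<phi> n) (t n) + r * (N (\<phi> n) \<psi> - s) + r\<^sup>2 * Q / 2"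
          unfolding J_def Nlin[OF P Ps] by (simp add: Q_def field_simps)
        finally show ?thesis using Jn[of n] by simp
      qed
      moreover have "(\<lambda>n. - ((1/4::real)^n)) \<longlonglongrightarrow> - 0" by (intro tendsto_minus LIMSEQ_power_zero) simp
      moreover have "(\<lambda>n. r * (N (\<phi> n) \<psi> - s) + r\<^sup>2 * Q / 2) \<longlonglongrightarrow> r * a + r\<^sup>2 * Q / 2"
        unfolding a_def by (intro tendsto_intros lim)
      ultimately show ?thesis using LIMSEQ_le[of "\<lambda>n. - ((1/4::real)^n)" 0] by fastforce
    qed
    have "a = 0"
    proof (rule ccontr)
      assume "a \<noteq> 0"
      define c where "c = a / (Q + 1)"
      have ac: "a = c * (Q + 1)" and c: "c \<noteq> 0" using Q \<open>a \<noteq> 0\<close> by (auto simp: c_def)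
      have "0 \<le> (- c) * a + (- c)\<^sup>2 * Q / 2" by (rule var)
      also have "\<dots> = - (c\<^sup>2 * (Q / 2 + 1))" unfolding ac by (simp add: field_simps power2_eq_square)
      also have "\<dots> < 0" using Q c by simp
      finally show False by simp
    qed
    then show ?thesis by (simp add: a_def)
  qed
  show ?thesis by (rule that[OF ig rep])
qed

subsection \<open>Bump functions\<close>

text \<open>The remainder is uniform in \<open>t\<close>: this gives the derivative, and later the
  expansion of a bump in its centre.\<close>

lemma pospart_sq_expansion:
  fixes t k :: real
  shows "\<bar>(max 0 (t + k))\<^sup>2 - (max 0 t)\<^sup>2 - 2 * max 0 t * k\<bar> \<le> k\<^sup>2"
proof -
  consider "t \<ge> 0" "t + k \<ge> 0" | "t \<ge> 0" "t + k < 0" | "t < 0" "t + k \<ge> 0" | "t < 0" "t + k < 0" by linarith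
  then show ?thesis
  proof cases
    case 2
    then have "t\<^sup>2 \<le> (- k)\<^sup>2" by (intro power_mono) auto
    moreover have "t * (t + k) \<le> 0" using 2 by (simp add: mult_nonneg_nonpos)
    moreover have "t * k \<le> 0" using 2 by (simp add: mult_nonneg_nonpos)
    moreover have "k * k \<ge> 0" "(t + k)\<^sup>2 \<ge> 0" by simp_all
    ultimately show ?thesis using 2 by (simp add: abs_le_iff power2_eq_square algebra_simps)
  next
    case 3
    then have "(t + k)\<^sup>2 \<le> k\<^sup>2" by (intro power_mono) auto
    then show ?thesis using 3 by simp
  qed (auto simp: power2_eq_square algebra_simps)
qed

lemma pospart_sq_DERIV: "((\<lambda>t. (max 0 t)\<^sup>2) has_real_derivative 2 * max 0 t) (at (t::real))"
  unfolding has_field_derivative_def has_derivative_at_alt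
proof (intro conjI allI impI)
  show "bounded_linear ((*) (2 * max 0 t))" by (rule bounded_linear_mult_right)
  fix e :: real assume e: "e > 0"
  show "\<exists>d>0. \<forall>y. norm (y - t) < d \<longrightarrow> norm ((max 0 y)\<^sup>2 - (max 0 t)\<^sup>2 - 2 * max 0 t * (y - t)) \<le> e * norm (y - t)"
  proof (intro exI[of _ e] conjI allI impI)
    fix y assume y: "norm (y - t) < e"
    have "\<bar>(max 0 y)\<^sup>2 - (max 0 t)\<^sup>2 - 2 * max 0 t * (y - t)\<bar> \<le> \<bar>y - t\<bar> * \<bar>y - t\<bar>"
      using pospart_sq_expansion[of t "y - t"] by (simp add: power2_eq_square)
    also have "\<dots> \<le> e * \<bar>y - t\<bar>" using y by (intro mult_right_mono) auto
    finally show "norm ((max 0 y)\<^sup>2 - (max 0 t)\<^sup>2 - 2 * max 0 t * (y - t)) \<le> e * norm (y - t)" by simp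
  qed fact
qed

text \<open>Squaring the positive part is just enough for a \<open>C^1\<close> test function with an
  explicit gradient.\<close>

definition bump :: "'a::euclidean_space \<Rightarrow> real \<Rightarrow> 'a \<Rightarrow> real" where
  "bump c r x = (max 0 (r\<^sup>2 - (x - c) \<bullet> (x - c)))\<^sup>2"

definition Dbump :: "'a::euclidean_space \<Rightarrow> real \<Rightarrow> 'a \<Rightarrow> 'a" where
  "Dbump c r x = (- 4 * max 0 (r\<^sup>2 - (x - c) \<bullet> (x - c))) *\<^sub>R (x - c)"

lemma bump_nonneg: "bump c r x \<ge> 0" by (simp add: bump_def)

lemma bump_pos_iff: "r > 0 \<Longrightarrow> bump c r x > 0 \<longleftrightarrow> x \<in> ball c r"
proof -
  assume r: "r > 0"
  have "(x - c) \<bullet> (x - c) < r\<^sup>2 \<longleftrightarrow> dist c x < r"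
    using r norm_lt_square[of "x - c" r] by (simp add: dist_norm norm_minus_commute[of c x])
  then show ?thesis by (auto simp: bump_def max_def)
qed

lemma bump_zero: "r > 0 \<Longrightarrow> x \<notin> ball c r \<Longrightarrow> bump c r x = 0"
  using bump_pos_iff[of r c x] bump_nonneg[of c r x] by linarith

lemma bump_le: "bump c r x \<le> r^4"
proof -
  have "max 0 (r\<^sup>2 - (x - c) \<bullet> (x - c)) \<le> r\<^sup>2" by simp
  then have "bump c r x \<le> (r\<^sup>2)\<^sup>2" unfolding bump_def by (intro power_mono) auto
  then show ?thesis by simp
qed

lemma bump_test:
  assumes r: "r > 0" and V: "cball c r \<subseteq> V"
  shows "C1c_test V (bump c r) (Dbump c r)"
proof (rule C1c_testI)
  show "(bump c r has_derivative (\<lambda>h. Dbump c r x \<bullet> h)) (at x)" for x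
  proof -
    have "((\<lambda>x. r\<^sup>2 - (x - c) \<bullet> (x - c)) has_derivative (\<lambda>h. - (2 * ((x - c) \<bullet> h)))) (at x)"
      by (auto intro!: derivative_eq_intros simp: inner_commute)
    from DERIV_compose_FDERIV[OF pospart_sq_DERIV this]
    show ?thesis unfolding bump_def[abs_def] by (rule has_derivative_eq_rhs) (simp add: Dbump_def fun_eq_iff)
  qed
  show "continuous_on UNIV (Dbump c r)" unfolding Dbump_def by (intro continuous_intros)
  show "bump c r x = 0" if "x \<notin> cball c r" for x using that r by (intro bump_zero) auto
qed (use V in auto)

text \<open>A further ball replaces \<open>\<alpha>\<close> by
  \<open>1 - (1 - \<alpha>) * (1 - \<gamma>)\<close>, which stays in the unit interval and is
  positive exactly where one of the two is.\<close>

lemma test_positive_on_balls: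
  fixes I :: "('a::euclidean_space \<times> real) set"
  assumes "finite I" "\<And>c r. (c, r) \<in> I \<Longrightarrow> r > 0 \<and> cball c r \<subseteq> V"
  shows "\<exists>\<beta> D\<beta>. C1c_test V \<beta> D\<beta> \<and> (\<forall>x. 0 \<le> \<beta> x \<and> \<beta> x \<le> 1 \<and> (0 < \<beta> x \<longleftrightarrow> x \<in> (\<Union>(c, r)\<in>I. ball c r)))"
  using assms
proof (induction I rule: finite_induct)
  case empty
  have "C1c_test V (\<lambda>_. 0) (\<lambda>_. 0)" by (rule C1c_testI[of _ _ "{}"]) auto
  then show ?case by (intro exI[of _ "\<lambda>_. 0"]) auto
next
  case (insert p I)
  obtain c r where p: "p = (c, r)" by fastforce
  have r: "r > 0" "cball c r \<subseteq> V" using insert.prems[of c r] p by auto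
  obtain \<alpha> D\<alpha> where \<alpha>: "C1c_test V \<alpha> D\<alpha>" "\<And>x. 0 \<le> \<alpha> x" "\<And>x. \<alpha> x \<le> 1" "\<And>x. 0 < \<alpha> x \<longleftrightarrow> x \<in> (\<Union>(c, r)\<in>I. ball c r)"
    using insert.IH insert.prems by blast
  \<comment> \<open>Normalised by the upper bound \<open>r^4\<close>; the zero summand brings the
    function into the form of a linear combination.\<close>
  define \<gamma> where "\<gamma> x = 1 / r^4 * bump c r x + 0 * bump c r x" for x
  have \<gamma>t: "C1c_test V \<gamma> (\<lambda>x. (1 / r^4) *\<^sub>R Dbump c r x + 0 *\<^sub>R Dbump c r x)"
    unfolding \<gamma>_def by (rule C1c_test_lincomb[OF bump_test[OF r] bump_test[OF r]])
  have \<gamma>: "0 \<le> \<gamma> x" "\<gamma> x \<le> 1" "0 < \<gamma> x \<longleftrightarrow> x \<in> ball c r" for x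
    using r bump_nonneg[of c r x] bump_le[of c r x] bump_pos_iff[OF r(1), of c x] by (auto simp: \<gamma>_def zero_less_divide_iff)
  define \<beta> where "\<beta> x = 1 * (1 * \<alpha> x + 1 * \<gamma> x) + (-1) * (\<alpha> x * \<gamma> x)" for x
  have "\<exists>D\<beta>. C1c_test V \<beta> D\<beta>"
    unfolding \<beta>_def by (rule exI, rule C1c_test_lincomb[OF C1c_test_lincomb[OF \<alpha>(1) \<gamma>t] C1c_test_mult[OF \<alpha>(1) \<gamma>t]])
  then obtain D\<beta> where t: "C1c_test V \<beta> D\<beta>" by blast
  have eq: "1 - \<beta> x = (1 - \<alpha> x) * (1 - \<gamma> x)" for x by (simp add: \<beta>_def algebra_simps)
  have eq2: "\<beta> x = \<alpha> x + \<gamma> x * (1 - \<alpha> x)" "\<beta> x = \<gamma> x + \<alpha> x * (1 - \<gamma> x)" for x by (simp_all add: \<beta>_def algebra_simps)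
  have "0 \<le> \<beta> x \<and> \<beta> x \<le> 1 \<and> (0 < \<beta> x \<longleftrightarrow> x \<in> (\<Union>(c, r)\<in>insert p I. ball c r))" for x
  proof -
    have 1: "0 \<le> (1 - \<alpha> x) * (1 - \<gamma> x)" "0 \<le> \<gamma> x * (1 - \<alpha> x)" "0 \<le> \<alpha> x * (1 - \<gamma> x)" using \<alpha>(2,3)[of x] \<gamma>(1,2)[of x] by auto
    have 2: "0 \<le> \<beta> x" unfolding eq2(1) by (rule add_nonneg_nonneg[OF \<alpha>(2) 1(2)])
    have "0 \<le> 1 - \<beta> x" unfolding eq by (rule 1(1))
    then have 3: "\<beta> x \<le> 1" by simp
    have "0 < \<beta> x \<longleftrightarrow> 0 < \<alpha> x \<or> 0 < \<gamma> x"
    proof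
      assume "0 < \<beta> x"
      then show "0 < \<alpha> x \<or> 0 < \<gamma> x" using \<alpha>(2)[of x] \<gamma>(1)[of x] by (auto simp: \<beta>_def less_le)
    next
      assume "0 < \<alpha> x \<or> 0 < \<gamma> x"
      then show "0 < \<beta> x"
      proof
        assume "0 < \<alpha> x" then show ?thesis unfolding eq2(1) by (rule add_pos_nonneg[OF _ 1(2)])
      next
        assume "0 < \<gamma> x" then show ?thesis unfolding eq2(2) by (rule add_pos_nonneg[OF _ 1(3)])
      qed
    qed
    then show ?thesis using 2 3 \<alpha>(4)[of x] \<gamma>(3)[of x] by (auto simp: p)
  qed
  then show ?case using t by blast
qed

text \<open>For \<open>0 \<le> \<beta> \<le> 1\<close> these functions increase with
  \<open>n\<close> to the indicator of the set where \<open>\<beta>\<close> is positive.\<close>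

lemma test_one_minus_power:
  assumes "C1c_test V \<beta> D\<beta>"
  shows "C1c_test V (\<lambda>x. 1 - (1 - \<beta> x)^n) (\<lambda>x. (real n * (1 - \<beta> x)^(n - 1)) *\<^sub>R D\<beta> x)"
proof (rule C1c_testI)
  show "((\<lambda>x. 1 - (1 - \<beta> x)^n) has_derivative (\<lambda>h. ((real n * (1 - \<beta> x)^(n - 1)) *\<^sub>R D\<beta> x) \<bullet> h)) (at x)" for x
  proof -
    have "((\<lambda>s. 1 - (1 - s)^n) has_real_derivative (real n * (1 - \<beta> x)^(n - 1))) (at (\<beta> x))"
      by (auto intro!: derivative_eq_intros)
    from DERIV_compose_FDERIV[OF this C1c_test_has_derivative[OF assms]]
    show ?thesis by (rule has_derivative_eq_rhs) (simp add: fun_eq_iff)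
  qed
  show "continuous_on UNIV (\<lambda>x. (real n * (1 - \<beta> x)^(n - 1)) *\<^sub>R D\<beta> x)"
    by (intro continuous_intros C1c_test_continuous[OF assms] C1c_test_continuous_grad[OF assms])
  show "compact (closure {x. \<beta> x \<noteq> 0})" "closure {x. \<beta> x \<noteq> 0} \<subseteq> V"
    by (rule C1c_test_compact[OF assms], rule C1c_test_support[OF assms])
  show "1 - (1 - \<beta> x)^n = 0" if "x \<notin> closure {x. \<beta> x \<noteq> 0}" for x
    using C1c_test_zero[OF assms that] by simp
qed

subsection \<open>The fundamental lemma of the calculus of variations\<close>

lemma open_countable_Union_balls:
  fixes W :: "'a::euclidean_space set"
  assumes "open W"
  obtains I :: "('a \<times> real) set" where "countable I" "\<And>c r. (c, r) \<in> I \<Longrightarrow> r > 0 \<and> cball c r \<subseteq> W" "W = (\<Union>(c, r)\<in>I. ball c r)"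
proof -
  define A where "A = {(c, r). r > 0 \<and> cball c r \<subseteq> W}"
  obtain F where F: "F \<subseteq> (\<lambda>(c, r). ball c r) ` A" "countable F" "\<Union>F = \<Union>((\<lambda>(c, r). ball c r) ` A)"
    by (rule Lindelof[of "(\<lambda>(c, r). ball c r) ` A"]) auto
  obtain I where I: "countable I" "I \<subseteq> A" "F = (\<lambda>(c, r). ball c r) ` I"
    using F(1,2) countable_subset_image[of F "\<lambda>(c, r). ball c r" A] by blast
  have "W = \<Union>((\<lambda>(c, r). ball c r) ` A)"
  proof
    show "W \<subseteq> \<Union>((\<lambda>(c, r). ball c r) ` A)"
    proof
      fix x assume x: "x \<in> W"
      then obtain r where r: "r > 0" "cball x r \<subseteq> W" using assms open_contains_cball by blast
      then show "x \<in> \<Union>((\<lambda>(c, r). ball c r) ` A)" by (intro UN_I[of "(x, r)"]) (auto simp: A_def)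
    qed
  next
    show "\<Union>((\<lambda>(c, r). ball c r) ` A) \<subseteq> W" unfolding A_def using ball_subset_cball by blast
  qed
  then have "W = (\<Union>(c, r)\<in>I. ball c r)" using F(3) I(3) by simp
  moreover have "r > 0 \<and> cball c r \<subseteq> W" if "(c, r) \<in> I" for c r using that I(2) unfolding A_def by blast
  ultimately show ?thesis using that[of I] I(1) by blast
qed

text \<open>The indicator of a finite union of balls is a pointwise limit of test functions, and
  that of \<open>W\<close> is a limit of such indicators. Both limits are dominated by
  \<open>h\<close> on \<open>B\<close>.\<close>

lemma open_integral_nonneg_if_test_nonneg:
  fixes h :: "'a::euclidean_space \<Rightarrow> real"
  assumes W: "open W" "W \<subseteq> B" "B \<in> sets borel" and h: "integrable lborel (\<lambda>x. indicator B x * h x)"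
    and t: "\<And>phi Dphi. C1c_test W phi Dphi \<Longrightarrow> (\<And>x. 0 \<le> phi x) \<Longrightarrow> 0 \<le> (LBINT x. h x * phi x)"
  shows "0 \<le> (LBINT x. indicator W x * h x)"
proof -
  obtain I where I: "countable I" "\<And>c r. (c, r) \<in> I \<Longrightarrow> r > 0 \<and> cball c r \<subseteq> W" "W = (\<Union>(c, r)\<in>I. ball c r)"
    using open_countable_Union_balls[OF W(1)] by blast
  define g where "g x = indicator B x * h x" for x
  have ig: "integrable lborel g" using h by (simp add: g_def[abs_def])
  have mg[measurable]: "g \<in> borel_measurable borel" using borel_measurable_integrable[OF ig] by simp
  have fin: "0 \<le> (LBINT x. indicator (\<Union>(c, r)\<in>J. ball c r) x * h x)" if J: "finite J" "J \<subseteq> I" for J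
  proof -
    let ?U = "\<Union>(c, r)\<in>J. ball c r"
    have UB: "?U \<subseteq> B" using J I W by blast
    have oU: "open ?U" by auto
    have J2: "\<And>c r. (c, r) \<in> J \<Longrightarrow> r > 0 \<and> cball c r \<subseteq> W" using J I by blast
    obtain \<beta> D\<beta> where \<beta>: "C1c_test W \<beta> D\<beta>" "\<And>x. 0 \<le> \<beta> x" "\<And>x. \<beta> x \<le> 1" "\<And>x. 0 < \<beta> x \<longleftrightarrow> x \<in> ?U"
      using test_positive_on_balls[OF J(1) J2] by blast
    have [measurable]: "\<beta> \<in> borel_measurable borel" using borel_measurable_continuous_onI[OF C1c_test_continuous[OF \<beta>(1)]] by simp
    define p where "p n x = 1 - (1 - \<beta> x)^n" for n x
    have p: "0 \<le> p n x" "p n x \<le> 1" for n x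
      using \<beta>(2,3)[of x] by (auto simp: p_def power_le_one)
    have pz: "p n x = 0" if "x \<notin> ?U" for n x using that \<beta>(4)[of x] \<beta>(2)[of x] by (auto simp: p_def less_le)
    have "(\<lambda>n. LBINT x. g x * p n x) \<longlonglongrightarrow> (LBINT x. g x * indicator ?U x)"
    proof (rule integral_dominated_convergence[where w = "\<lambda>x. \<bar>g x\<bar>"])
      show "(\<lambda>x. g x * indicator ?U x) \<in> borel_measurable lborel" 
        by (intro borel_measurable_times borel_measurable_indicator) (use oU in auto)
      show "(\<lambda>x. g x * p n x) \<in> borel_measurable lborel" for n unfolding p_def by measurable
      show "integrable lborel (\<lambda>x. \<bar>g x\<bar>)" using ig by simp
      show "AE x in lborel. (\<lambda>n. g x * p n x) \<longlonglongrightarrow> g x * indicator ?U x"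
      proof (rule AE_I2)
        fix x
        have "(\<lambda>n. p n x) \<longlonglongrightarrow> indicator ?U x"
        proof (cases "x \<in> ?U")
          case True
          then have "(\<lambda>n. (1 - \<beta> x)^n) \<longlonglongrightarrow> 0" using \<beta>(3)[of x] \<beta>(4)[of x] by (intro LIMSEQ_power_zero) auto
          from tendsto_diff[OF tendsto_const[of 1] this] show ?thesis using True by (simp add: p_def)
        next
          case False then show ?thesis by (simp add: pz)
        qed
        then show "(\<lambda>n. g x * p n x) \<longlonglongrightarrow> g x * indicator ?U x" by (intro tendsto_intros)
      qed
      show "AE x in lborel. norm (g x * p n x) \<le> \<bar>g x\<bar>" for n
        using p by (auto intro!: AE_I2 mult_left_le simp: abs_mult)
    qed
    moreover have "0 \<le> (LBINT x. g x * p n x)" for n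
    proof -
      have "(LBINT x. g x * p n x) = (LBINT x. h x * p n x)"
        using pz[of _ n] UB by (intro Bochner_Integration.integral_cong) (auto simp: g_def indicator_def)
      then show ?thesis using t[OF test_one_minus_power[OF \<beta>(1), of n]] p(1)[of n] by (simp add: p_def)
    qed
    ultimately have "0 \<le> (LBINT x. g x * indicator ?U x)" by (intro LIMSEQ_le_const) auto
    moreover have "(LBINT x. g x * indicator ?U x) = (LBINT x. indicator ?U x * h x)"
      using UB by (intro Bochner_Integration.integral_cong) (auto simp: g_def indicator_def)
    ultimately show ?thesis by simp
  qed
  show ?thesis
  proof (cases "I = {}")
    case True then show ?thesis using I(3) by simp
  next
    case False
    define f where "f = from_nat_into I"
    have fI: "f i \<in> I" for i using False by (simp add: f_def from_nat_into)
    have rf: "range f = I" using I(1) False by (simp add: f_def range_from_nat_into)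
    define U where "U n = (\<Union>(c, r)\<in>f ` {..n}. ball c r)" for n :: nat
    have oU: "open (U n)" for n unfolding U_def by (intro open_UN ballI) (auto split: prod.split)
    have UW: "U n \<subseteq> W" for n
    proof -
      have "f ` {..n} \<subseteq> I" using fI by auto
      then show ?thesis unfolding U_def I(3) by (rule UN_mono) auto
    qed
    have "(\<lambda>n. LBINT x. g x * indicator (U n) x) \<longlonglongrightarrow> (LBINT x. g x * indicator W x)"
    proof (rule integral_dominated_convergence[where w = "\<lambda>x. \<bar>g x\<bar>"])
      show "(\<lambda>x. g x * indicator W x) \<in> borel_measurable lborel" 
        by (intro borel_measurable_times borel_measurable_indicator) (use W in auto)
      show "(\<lambda>x. g x * indicator (U n) x) \<in> borel_measurable lborel" for n 
        by (intro borel_measurable_times borel_measurable_indicator) (use oU in auto)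
      show "integrable lborel (\<lambda>x. \<bar>g x\<bar>)" using ig by simp
      show "AE x in lborel. (\<lambda>n. g x * indicator (U n) x) \<longlonglongrightarrow> g x * indicator W x"
      proof (rule AE_I2)
        fix x
        have "(\<lambda>n. indicator (U n) x :: real) \<longlonglongrightarrow> indicator W x"
        proof (cases "x \<in> W")
          case True
          then obtain c r where "(c, r) \<in> I" "x \<in> ball c r" using I(3) by blast
          then obtain N where "f N = (c, r)" using rf by (metis rangeE)
          then have "x \<in> U n" if "n \<ge> N" for n using that \<open>x \<in> ball c r\<close> unfolding U_def by force
          then have "\<forall>\<^sub>F n in sequentially. indicator (U n) x = (indicator W x :: real)"
            using True unfolding eventually_sequentially by (intro exI[of _ N]) auto
          then show ?thesis by (rule tendsto_eventually)
        next
          case False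
          then have "x \<notin> U n" for n using UW by blast
          then show ?thesis using False by simp
        qed
        then show "(\<lambda>n. g x * indicator (U n) x) \<longlonglongrightarrow> g x * indicator W x" by (intro tendsto_intros)
      qed
      show "AE x in lborel. norm (g x * indicator (U n) x) \<le> \<bar>g x\<bar>" for n
        by (auto intro!: AE_I2 simp: indicator_def)
    qed
    moreover have eq: "(LBINT x. g x * indicator Z x) = (LBINT x. indicator Z x * h x)" if "Z \<subseteq> W" for Z
      using that W by (intro Bochner_Integration.integral_cong) (auto simp: g_def indicator_def)
    moreover have "0 \<le> (LBINT x. indicator (U n) x * h x)" for n
      unfolding U_def by (rule fin) (use fI in auto)
    ultimately show ?thesis
      using eq[OF UW] eq[OF order_refl] LIMSEQ_le_const[of "\<lambda>n. LBINT x. g x * indicator (U n) x" _ 0] by simp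
  qed
qed

text \<open>Compare the measures whose densities are the negative and the positive part of
  \<open>g\<close>. The first is below the second on open sets, hence by outer regularity on the
  Borel set where \<open>g < 0\<close>, which is null for the second.\<close>

lemma AE_nonneg_if_open_integral_nonneg:
  fixes g :: "'a::euclidean_space \<Rightarrow> real"
  assumes g: "integrable lborel g" and W: "\<And>W. open W \<Longrightarrow> 0 \<le> (LBINT x. indicator W x * g x)"
  shows "AE x in lborel. 0 \<le> g x"
proof -
  have mg[measurable]: "g \<in> borel_measurable borel" using borel_measurable_integrable[OF g] by simp
  define M1 where "M1 = density lborel (\<lambda>x. ennreal (max 0 (g x)))"
  define M2 where "M2 = density lborel (\<lambda>x. ennreal (max 0 (- g x)))"
  have ip: "integrable lborel (\<lambda>x. max 0 (g x))" "integrable lborel (\<lambda>x. max 0 (- g x))"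
    using g by auto
  have em1: "emeasure M1 A = ennreal (LBINT x. indicator A x * max 0 (g x))"
    and em2: "emeasure M2 A = ennreal (LBINT x. indicator A x * max 0 (- g x))" 
    and ia: "integrable lborel (\<lambda>x. indicator A x * max 0 (g x))" "integrable lborel (\<lambda>x. indicator A x * max 0 (- g x))"
    if [measurable]: "A \<in> sets borel" for A
  proof -
    show i1: "integrable lborel (\<lambda>x. indicator A x * max 0 (g x))"
      by (rule Bochner_Integration.integrable_bound[OF ip(1)]) (auto simp: indicator_def)
    show i2: "integrable lborel (\<lambda>x. indicator A x * max 0 (- g x))"
      by (rule Bochner_Integration.integrable_bound[OF ip(2)]) (auto simp: indicator_def)
    have "emeasure M1 A = (\<integral>\<^sup>+x. ennreal (indicator A x * max 0 (g x)) \<partial>lborel)"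
      unfolding M1_def by (subst emeasure_density) (auto intro!: nn_integral_cong simp: indicator_def)
    also have "\<dots> = ennreal (LBINT x. indicator A x * max 0 (g x))"
      by (rule nn_integral_eq_integral[OF i1]) auto
    finally show "emeasure M1 A = ennreal (LBINT x. indicator A x * max 0 (g x))" .
    have "emeasure M2 A = (\<integral>\<^sup>+x. ennreal (indicator A x * max 0 (- g x)) \<partial>lborel)"
      unfolding M2_def by (subst emeasure_density) (auto intro!: nn_integral_cong simp: indicator_def)
    also have "\<dots> = ennreal (LBINT x. indicator A x * max 0 (- g x))"
      by (rule nn_integral_eq_integral[OF i2]) auto
    finally show "emeasure M2 A = ennreal (LBINT x. indicator A x * max 0 (- g x))" .
  qed
  have sb: "sets M1 = sets borel" "sets M2 = sets borel" by (simp_all add: M1_def M2_def)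
  have fin: "emeasure M1 (space M1) \<noteq> \<infinity>" "emeasure M2 (space M2) \<noteq> \<infinity>"
    using em1[of UNIV] em2[of UNIV] by (simp_all add: M1_def M2_def)
  have op: "emeasure M2 U \<le> emeasure M1 U" if U: "open U" for U
  proof -
    have Ub: "U \<in> sets borel" using U by simp
    have "(LBINT x. indicator U x * g x) = (LBINT x. indicator U x * max 0 (g x) - indicator U x * max 0 (- g x))"
      by (intro Bochner_Integration.integral_cong) (auto simp: indicator_def max_def)
    also have "\<dots> = (LBINT x. indicator U x * max 0 (g x)) - (LBINT x. indicator U x * max 0 (- g x))"
      using ia[OF Ub] by simp
    finally show ?thesis using W[OF U] by (simp add: em1[OF Ub] em2[OF Ub] ennreal_leI)
  qed
  define S where "S = {x. g x < 0}"
  have S: "S \<in> sets borel" unfolding S_def by measurable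
  have "emeasure M2 S = (INF U \<in> {U. S \<subseteq> U \<and> open U}. emeasure M2 U)" by (rule outer_regular[OF sb(2) fin(2) S])
  also have "\<dots> \<le> (INF U \<in> {U. S \<subseteq> U \<and> open U}. emeasure M1 U)" by (rule INF_mono) (use op in auto)
  also have "\<dots> = emeasure M1 S" by (rule outer_regular[OF sb(1) fin(1) S, symmetric])
  also have "\<dots> = 0"
  proof -
    have "(\<lambda>x. indicator S x * max 0 (g x)) = (\<lambda>x. 0)" by (auto simp: S_def indicator_def fun_eq_iff)
    then show ?thesis unfolding em1[OF S] by simp
  qed
  finally have "emeasure M2 S = 0" by simp
  then have "(LBINT x. indicator S x * max 0 (- g x)) \<le> 0" unfolding em2[OF S] by (simp add: ennreal_eq_0_iff)
  moreover have "0 \<le> (LBINT x. indicator S x * max 0 (- g x))" by (intro integral_nonneg_AE) auto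
  ultimately have "(LBINT x. indicator S x * max 0 (- g x)) = 0" by linarith
  then have "AE x in lborel. indicator S x * max 0 (- g x) = 0"
    using ia(2)[OF S] by (subst (asm) integral_nonneg_eq_0_iff_AE) auto
  then show ?thesis by eventually_elim (auto simp: S_def indicator_def max_def split: if_splits)
qed

text \<open>\<open>h\<close> is only locally integrable, so the claim is settled on each ball of a
  countable cover with closed balls inside \<open>V\<close>.\<close>

lemma AE_nonneg_if_test_nonneg:
  fixes h :: "'a::euclidean_space \<Rightarrow> real"
  assumes V: "open V" and h: "\<And>K. compact K \<Longrightarrow> K \<subseteq> V \<Longrightarrow> set_integrable lborel K h"
    and t: "\<And>phi Dphi. C1c_test V phi Dphi \<Longrightarrow> (\<And>x. 0 \<le> phi x) \<Longrightarrow> 0 \<le> (LBINT x. h x * phi x)"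
  shows "AE x in lborel. x \<in> V \<longrightarrow> 0 \<le> h x"
proof -
  obtain I where I: "countable I" "\<And>c r. (c, r) \<in> I \<Longrightarrow> r > 0 \<and> cball c r \<subseteq> V" "V = (\<Union>(c, r)\<in>I. ball c r)"
    using open_countable_Union_balls[OF V] by blast
  have "AE x in lborel. \<forall>p\<in>I. x \<in> ball (fst p) (snd p) \<longrightarrow> 0 \<le> h x"
  proof (rule AE_ball_countable'[OF _ I(1)])
    fix p assume "p \<in> I"
    then obtain c r where p: "p = (c, r)" "cball c r \<subseteq> V" using I(2) by (metis surj_pair)
    define B where "B = ball c r"
    have BV: "B \<subseteq> V" using p ball_subset_cball[of c r] by (auto simp: B_def)
    have ic: "integrable lborel (\<lambda>x. indicator (cball c r) x *\<^sub>R h x)"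
      using h[OF compact_cball p(2)] by (simp add: set_integrable_def)
    have "(\<lambda>x. indicator B x * (indicator (cball c r) x *\<^sub>R h x)) \<in> borel_measurable lborel"
      unfolding B_def by (intro borel_measurable_times borel_measurable_indicator borel_measurable_integrable[OF ic]) auto
    moreover have "(\<lambda>x. indicator B x * (indicator (cball c r) x *\<^sub>R h x)) = (\<lambda>x. indicator B x * h x)"
      by (auto simp: B_def indicator_def fun_eq_iff)
    ultimately have "(\<lambda>x. indicator B x * h x) \<in> borel_measurable lborel" by simp
    then have iB: "integrable lborel (\<lambda>x. indicator B x * h x)"
      by (rule Bochner_Integration.integrable_bound[OF ic]) (auto simp: B_def indicator_def)
    have "AE x in lborel. 0 \<le> indicator B x * h x"
    proof (rule AE_nonneg_if_open_integral_nonneg[OF iB])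
      fix W :: "'a set" assume W: "open W"
      have "0 \<le> (LBINT x. indicator (W \<inter> B) x * h x)"
      proof (rule open_integral_nonneg_if_test_nonneg[OF _ _ _ iB])
        fix phi Dphi assume "C1c_test (W \<inter> B) phi Dphi" "\<And>x. 0 \<le> phi x"
        then show "0 \<le> (LBINT x. h x * phi x)" using t C1c_test_mono BV by (metis inf.coboundedI2)
      qed (use W in \<open>auto simp: B_def\<close>)
      also have "\<dots> = (LBINT x. indicator W x * (indicator B x * h x))"
        by (intro Bochner_Integration.integral_cong) (auto simp: indicator_def)
      finally show "0 \<le> (LBINT x. indicator W x * (indicator B x * h x))" .
    qed
    then show "AE x in lborel. x \<in> ball (fst p) (snd p) \<longrightarrow> 0 \<le> h x"
      by eventually_elim (auto simp: p B_def)
  qed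
  then show ?thesis by eventually_elim (use I(3) in force)
qed

subsection \<open>Weak gradients of Lipschitz functions\<close>

lemma weak_grad_test:
  assumes "weak_grad V f G" "C1c_test V phi Dphi"
  shows "(LBINT x. f x * (Dphi x \<bullet> v)) = - (LBINT x. (G x \<bullet> v) * phi x)"
proof -
  have "(LINT x:V|lborel. f x * (Dphi x \<bullet> v)) = - (LINT x:V|lborel. (G x \<bullet> v) * phi x)"
    using assms unfolding weak_grad_def by blast
  then show ?thesis unfolding C1c_test_LINT[OF assms(2)] .
qed

lemma set_integrable_const_compact: "compact (K::'a::euclidean_space set) \<Longrightarrow> set_integrable lborel K (\<lambda>x. c::real)"
  unfolding set_integrable_def by (rule borel_integrable_compact) (auto intro: continuous_intros)

lemma set_integrable_inner:
  assumes "set_integrable lborel K (G :: 'a::euclidean_space \<Rightarrow> 'a)"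
  shows "set_integrable lborel K (\<lambda>x. G x \<bullet> v)"
proof -
  have "integrable lborel (\<lambda>x. (indicator K x *\<^sub>R G x) \<bullet> v)"
    using assms unfolding set_integrable_def by (intro integrable_inner_left) auto
  then show ?thesis unfolding set_integrable_def by simp
qed

lemma C1c_test_integrable:
  assumes "C1c_test V phi Dphi"
  shows "integrable lborel phi"
proof -
  have "integrable lborel (\<lambda>x. (1::real) * phi x)"
    by (rule integrable_mult_compact_support[OF set_integrable_const_compact[OF C1c_test_compact[OF assms]]
          C1c_test_compact[OF assms] C1c_test_continuous[OF assms] C1c_test_zero[OF assms]])
  then show ?thesis by simp
qed

lemma weak_grad_test_integrable:
  assumes "weak_grad V f G" "C1c_test V phi Dphi"
  shows "integrable lborel (\<lambda>x. (G x \<bullet> v) * phi x)"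
proof -
  have "set_integrable lborel (closure {x. phi x \<noteq> 0}) G"
    using assms(1) C1c_test_compact[OF assms(2)] C1c_test_support[OF assms(2)] unfolding weak_grad_def by blast
  from integrable_mult_compact_support[OF set_integrable_inner[OF this] C1c_test_compact[OF assms(2)]
      C1c_test_continuous[OF assms(2)] C1c_test_zero[OF assms(2)]]
  show ?thesis .
qed

text \<open>Each direction \<open>v\<close> has its own exceptional null set, so the directions
  first range over a countable dense set; continuity in \<open>v\<close> then allows
  \<open>v = G x\<close>.\<close>

lemma weak_grad_bound:
  fixes u :: "'a::euclidean_space \<Rightarrow> real"
  assumes U: "open U" "U \<subseteq> V" and G: "weak_grad V u G" and u: "loc_lip U L u"
  shows "AE x in lborel. x \<in> U \<longrightarrow> norm (G x) \<le> L"
proof -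
  have dir: "AE x in lborel. x \<in> U \<longrightarrow> 0 \<le> L * norm v - G x \<bullet> v" for v
  proof (rule AE_nonneg_if_test_nonneg[OF U(1)])
    show "set_integrable lborel K (\<lambda>x. L * norm v - G x \<bullet> v)" if K: "compact K" "K \<subseteq> U" for K
    proof -
      have "set_integrable lborel K G" using G K U unfolding weak_grad_def by blast
      then show ?thesis using set_integrable_const_compact[OF K(1)]
        by (intro set_integral_diff set_integrable_inner)
    qed
    fix phi Dphi assume t: "C1c_test U phi Dphi" and nn: "\<And>x. 0 \<le> phi x"
    have tV: "C1c_test V phi Dphi" by (rule C1c_test_mono[OF t U(2)])
    have i1: "integrable lborel (\<lambda>x. (G x \<bullet> v) * phi x)" by (rule weak_grad_test_integrable[OF G tV])
    have i2: "integrable lborel phi" by (rule C1c_test_integrable[OF t])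
    have "\<bar>LBINT x. u x * (Dphi x \<bullet> v)\<bar> \<le> L * norm v * (LBINT x. \<bar>phi x\<bar>)"
      by (rule loc_lip_test_bound[OF U(1) u t])
    then have "\<bar>LBINT x. (G x \<bullet> v) * phi x\<bar> \<le> L * norm v * (LBINT x. phi x)"
      unfolding weak_grad_test[OF G tV] using nn by simp
    moreover have "(LBINT x. (L * norm v - G x \<bullet> v) * phi x) = L * norm v * (LBINT x. phi x) - (LBINT x. (G x \<bullet> v) * phi x)"
      using i1 i2 by (simp add: left_diff_distrib)
    ultimately show "0 \<le> (LBINT x. (L * norm v - G x \<bullet> v) * phi x)" by linarith
  qed
  obtain D :: "'a set" where D: "countable D" "\<And>X. open X \<Longrightarrow> X \<noteq> {} \<Longrightarrow> \<exists>d\<in>D. d \<in> X"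
    using countable_dense_setE by blast
  have "AE x in lborel. \<forall>v\<in>D. x \<in> U \<longrightarrow> 0 \<le> L * norm v - G x \<bullet> v"
    by (rule AE_ball_countable'[OF dir D(1)])
  then show ?thesis
  proof eventually_elim
    case (elim x)
    show ?case
    proof
      assume xU: "x \<in> U"
      have all: "0 \<le> L * norm v - G x \<bullet> v" for v
      proof (rule ccontr)
        assume neg: "\<not> ?thesis"
        define X where "X = {w. L * norm w - G x \<bullet> w < 0}"
        have "open X" unfolding X_def by (intro open_Collect_less continuous_intros)
        moreover have "v \<in> X" using neg by (simp add: X_def)
        ultimately obtain w where "w \<in> D" "w \<in> X" using D(2)[of X] by blast
        then show False using elim xU by (auto simp: X_def)
      qed
      show "norm (G x) \<le> L"
      \<comment> \<open>A zero gradient gives no vector to divide by, but any unit vector shows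
        \<open>0 \<le> L\<close>.\<close>
      proof (cases "G x = 0")
        case True
        obtain b :: 'a where "b \<in> Basis" using nonempty_Basis by blast
        then show ?thesis using all[of b] True by simp
      next
        case False
        have "norm (G x) * norm (G x) \<le> L * norm (G x)"
          using all[of "G x"] by (simp add: power2_norm_eq_inner[symmetric] power2_eq_square)
        then show ?thesis using False by simp
      qed
    qed
  qed
qed

text \<open>Each basis direction gives a functional on test functions bounded in \<open>L^1\<close>,
  hence an integrable component. The essential bound on the gradient is then the matter of
  \<open>weak_grad_bound\<close>.\<close>

lemma loc_lip_weak_grad_exists:
  fixes u :: "'a::euclidean_space \<Rightarrow> real"
  assumes V: "open V" "bounded V" and u: "loc_lip V L u"
  shows "\<exists>G. weak_grad V u G"
proof -
  define M where "M = restrict_space lborel V"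
  have Vs: "V \<inter> space lborel \<in> sets lborel" using V by simp
  have fin: "finite_measure M"
  proof (rule finite_measureI)
    have "emeasure lborel V < \<infinity>" using emeasure_bounded_finite[OF V(2)] .
    then show "emeasure M (space M) \<noteq> \<infinity>"
      unfolding M_def using V by (simp add: emeasure_restrict_space space_restrict_space)
  qed
  have cu: "continuous_on V u" by (rule loc_lip_continuous_on[OF u])
  have iu: "integrable lborel (\<lambda>x. u x * (Dphi x \<bullet> e))" if t: "C1c_test V phi Dphi" for phi Dphi e
  proof (rule integrable_mult_compact_support)
    show "compact (closure {x. phi x \<noteq> 0})" by (rule C1c_test_compact[OF t])
    then show "set_integrable lborel (closure {x. phi x \<noteq> 0}) u"
      unfolding set_integrable_def
      by (rule borel_integrable_compact) (rule continuous_on_subset[OF cu C1c_test_support[OF t]])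
    show "continuous_on UNIV (\<lambda>x. Dphi x \<bullet> e)" by (intro continuous_intros C1c_test_continuous_grad[OF t])
    show "Dphi x \<bullet> e = 0" if "x \<notin> closure {x. phi x \<noteq> 0}" for x using C1c_test_grad_zero[OF t that] by simp
  qed
  have intM: "(\<integral>x. f x \<partial>M) = (LBINT x. indicator V x *\<^sub>R f x)" for f :: "'a \<Rightarrow> real"
    unfolding M_def by (rule integral_restrict_space[OF Vs])
  have ex: "\<exists>g. integrable lborel g \<and> (\<forall>phi Dphi. C1c_test V phi Dphi \<longrightarrow>
      (LBINT x. u x * (Dphi x \<bullet> e)) = - (LBINT x. g x * phi x))" for e
  proof -
    \<comment> \<open>The value \<open>t\<close> is computed from \<open>Dphi\<close>, whereas the
      representation speaks of \<open>phi\<close> alone; hence a relation.\<close>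
    define P where "P phi t \<longleftrightarrow> (\<exists>Dphi. C1c_test V phi Dphi \<and> t = - (LBINT x. u x * (Dphi x \<bullet> e)))" for phi t
    obtain g where g: "integrable M g" "\<And>phi t. P phi t \<Longrightarrow> t = (\<integral>x. g x * phi x \<partial>M)"
    proof (rule riesz_bounded_functional[OF fin, of P, where L = "L * norm e"])
      have "C1c_test V (\<lambda>_. 0) (\<lambda>_. 0)" by (rule C1c_testI[of _ _ "{}"]) auto
      then have "P (\<lambda>_. 0) (- (LBINT x. u x * ((\<lambda>_. 0) x \<bullet> e)))" unfolding P_def by blast
      then show "P (\<lambda>_. 0) 0" by simp
    next
      fix phi s psi t and a b :: real
      assume "P phi s" "P psi t"
      then obtain Dphi Dpsi where 1: "C1c_test V phi Dphi" "s = - (LBINT x. u x * (Dphi x \<bullet> e))"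
        and 2: "C1c_test V psi Dpsi" "t = - (LBINT x. u x * (Dpsi x \<bullet> e))" unfolding P_def by blast
      have "(LBINT x. u x * ((a *\<^sub>R Dphi x + b *\<^sub>R Dpsi x) \<bullet> e)) = (LBINT x. a * (u x * (Dphi x \<bullet> e)) + b * (u x * (Dpsi x \<bullet> e)))"
        by (intro Bochner_Integration.integral_cong) (auto simp: inner_add_left algebra_simps)
      also have "\<dots> = a * (LBINT x. u x * (Dphi x \<bullet> e)) + b * (LBINT x. u x * (Dpsi x \<bullet> e))"
        using iu[OF 1(1)] iu[OF 2(1)] by simp
      finally have "a * s + b * t = - (LBINT x. u x * ((a *\<^sub>R Dphi x + b *\<^sub>R Dpsi x) \<bullet> e))"
        using 1(2) 2(2) by simp
      then show "P (\<lambda>x. a * phi x + b * psi x) (a * s + b * t)"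
        unfolding P_def using C1c_test_lincomb[OF 1(1) 2(1), of a b] by blast
    next
      fix phi t assume "P phi t"
      then obtain Dphi where 1: "C1c_test V phi Dphi" "t = - (LBINT x. u x * (Dphi x \<bullet> e))" unfolding P_def by blast
      have mp: "phi \<in> borel_measurable borel" using borel_measurable_continuous_onI[OF C1c_test_continuous[OF 1(1)]] .
      then show "phi \<in> borel_measurable M" unfolding M_def by (intro measurable_restrict_space1) simp
      obtain C where "\<And>x. norm (phi x) \<le> C"
        using compact_support_bounded[OF C1c_test_continuous[OF 1(1)] C1c_test_compact[OF 1(1)] C1c_test_zero[OF 1(1)]] by metis
      then show "\<exists>C. \<forall>x. \<bar>phi x\<bar> \<le> C" by auto
      have "(\<integral>x. \<bar>phi x\<bar> \<partial>M) = (LBINT x. \<bar>phi x\<bar>)"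
        unfolding intM
      proof (intro Bochner_Integration.integral_cong refl)
        fix x show "indicator V x *\<^sub>R \<bar>phi x\<bar> = \<bar>phi x\<bar>"
          using C1c_test_zero[OF 1(1), of x] C1c_test_support[OF 1(1)] by (cases "x \<in> V") auto
      qed
      then show "\<bar>t\<bar> \<le> L * norm e * (\<integral>x. \<bar>phi x\<bar> \<partial>M)"
        using loc_lip_test_bound[OF V(1) u 1(1), of e] 1(2) by simp
    qed blast
    have ig: "integrable lborel (\<lambda>x. indicator V x *\<^sub>R g x)"
      using g(1) unfolding M_def by (simp add: integrable_restrict_space[OF Vs])
    moreover have "(LBINT x. u x * (Dphi x \<bullet> e)) = - (LBINT x. (indicator V x *\<^sub>R g x) * phi x)"
      if t: "C1c_test V phi Dphi" for phi Dphi
    proof -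
      have "P phi (- (LBINT x. u x * (Dphi x \<bullet> e)))" unfolding P_def using t by blast
      from g(2)[OF this] show ?thesis unfolding intM by (simp add: mult.assoc)
    qed
    ultimately show ?thesis by blast
  qed
  obtain g where gi: "\<And>e. integrable lborel (g e)"
    and gt: "\<And>e phi Dphi. C1c_test V phi Dphi \<Longrightarrow> (LBINT x. u x * (Dphi x \<bullet> e)) = - (LBINT x. g e x * phi x)"
    using ex by metis
  define G where "G x = (\<Sum>e\<in>Basis. g e x *\<^sub>R e)" for x
  have iG: "integrable lborel G" unfolding G_def using gi by (intro Bochner_Integration.integrable_sum integrable_scaleR_left) auto
  have "weak_grad V u G" unfolding weak_grad_def
  proof (intro conjI allI impI)
    show "set_borel_measurable lborel V u" unfolding set_borel_measurable_def
      using borel_measurable_continuous_on_indicator[OF _ cu] V by simp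
    show "set_borel_measurable lborel V G" unfolding set_borel_measurable_def
      using borel_measurable_integrable[OF iG] V by simp
    fix K assume K: "compact K \<and> K \<subseteq> V"
    show "set_integrable lborel K u" unfolding set_integrable_def
      using K continuous_on_subset[OF cu] by (intro borel_integrable_compact) auto
    show "set_integrable lborel K G" unfolding set_integrable_def
      using K by (intro integrable_mult_indicator[OF _ iG]) (auto intro: borel_compact)
  next
    fix phi Dphi v assume t: "C1c_test V phi Dphi"
    obtain C where C: "\<And>x. norm (phi x) \<le> C"
      using compact_support_bounded[OF C1c_test_continuous[OF t] C1c_test_compact[OF t] C1c_test_zero[OF t]] by metis
    have mp: "phi \<in> borel_measurable borel" using borel_measurable_continuous_onI[OF C1c_test_continuous[OF t]] .
    have igp: "integrable lborel (\<lambda>x. g e x * phi x)" for e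
      using C mp by (intro integrable_mult_bounded[OF gi, of _ C]) auto
    have "(LBINT x. u x * (Dphi x \<bullet> v)) = (LBINT x. (\<Sum>e\<in>Basis. (v \<bullet> e) * (u x * (Dphi x \<bullet> e))))"
      by (intro Bochner_Integration.integral_cong refl, subst euclidean_inner) (simp add: sum_distrib_left algebra_simps)
    also have "\<dots> = (\<Sum>e\<in>Basis. (v \<bullet> e) * (LBINT x. u x * (Dphi x \<bullet> e)))"
      using iu[OF t] by (subst Bochner_Integration.integral_sum) auto
    also have "\<dots> = - (\<Sum>e\<in>Basis. (v \<bullet> e) * (LBINT x. g e x * phi x))"
      by (simp add: gt[OF t] sum_negf)
    also have "(\<Sum>e\<in>Basis. (v \<bullet> e) * (LBINT x. g e x * phi x)) = (LBINT x. (\<Sum>e\<in>Basis. (v \<bullet> e) * (g e x * phi x)))"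
      using igp by (subst Bochner_Integration.integral_sum) auto
    also have "\<dots> = (LBINT x. (G x \<bullet> v) * phi x)"
      by (intro Bochner_Integration.integral_cong refl)
        (simp add: G_def inner_sum_left sum_distrib_left inner_commute[of v] mult_ac)
    finally show "(LINT x:V|lborel. u x * (Dphi x \<bullet> v)) = - (LINT x:V|lborel. (G x \<bullet> v) * phi x)"
      unfolding C1c_test_LINT[OF t] .
  qed
  then show ?thesis by blast
qed

subsection \<open>Continuous functions with bounded weak gradient\<close>

text \<open>Moving the centre by \<open>k\<close> amounts to moving the point by \<open>- k\<close>,
  whence the sign of the gradient term. The error is uniform in \<open>x\<close> within distance
  \<open>D\<close>, so it can be integrated.\<close>

lemma bump_translate_expansion:
  fixes x y k :: "'a::euclidean_space"
  assumes D: "norm (x - y) \<le> D" and k: "norm k \<le> 1"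
  shows "\<bar>bump (y + k) r x - bump y r x + Dbump y r x \<bullet> k\<bar> \<le> ((2 * D + 1)\<^sup>2 + 2 * r\<^sup>2) * (norm k)\<^sup>2"
proof -
  define z where "z = x - y"
  define t where "t = r\<^sup>2 - z \<bullet> z"
  define q where "q = 2 * (z \<bullet> k) - k \<bullet> k"
  have b1: "bump (y + k) r x = (max 0 (t + q))\<^sup>2"
  proof -
    have "(x - (y + k)) \<bullet> (x - (y + k)) = (z - k) \<bullet> (z - k)" by (simp add: z_def algebra_simps)
    also have "\<dots> = z \<bullet> z - q" by (simp add: q_def inner_diff_left inner_diff_right inner_commute algebra_simps)
    finally show ?thesis by (simp add: bump_def t_def)
  qed
  have b2: "bump y r x = (max 0 t)\<^sup>2" by (simp add: bump_def t_def z_def)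
  have b3: "Dbump y r x \<bullet> k = - (2 * max 0 t * q) - 2 * max 0 t * (k \<bullet> k)"
    unfolding q_def by (simp add: Dbump_def t_def z_def algebra_simps)
  have e: "bump (y + k) r x - bump y r x + Dbump y r x \<bullet> k = ((max 0 (t + q))\<^sup>2 - (max 0 t)\<^sup>2 - 2 * max 0 t * q) - 2 * max 0 t * (k \<bullet> k)"
    unfolding b1 b2 b3 by simp
  have t0: "0 \<le> max 0 t" "max 0 t \<le> r\<^sup>2" by (auto simp: t_def)
  have kk: "k \<bullet> k = (norm k)\<^sup>2" by (simp add: power2_norm_eq_inner)
  have 1: "\<bar>2 * max 0 t * (k \<bullet> k)\<bar> \<le> 2 * r\<^sup>2 * (norm k)\<^sup>2"
    unfolding kk using t0 by (simp add: abs_mult mult_right_mono)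
  have "\<bar>z \<bullet> k\<bar> \<le> D * norm k"
    using Cauchy_Schwarz_ineq2[of z k] mult_right_mono[OF D norm_ge_zero[of k]] by (simp add: z_def)
  moreover have "(norm k)\<^sup>2 \<le> norm k" unfolding power2_eq_square using k by (simp add: mult_left_le)
  moreover have "(2 * D + 1) * norm k = 2 * (D * norm k) + norm k" by (simp add: algebra_simps)
  ultimately have "\<bar>q\<bar> \<le> (2 * D + 1) * norm k"
    unfolding q_def kk using zero_le_power2[of "norm k"] by linarith
  then have "\<bar>q\<bar>\<^sup>2 \<le> ((2 * D + 1) * norm k)\<^sup>2" by (intro power_mono) auto
  then have 2: "q\<^sup>2 \<le> (2 * D + 1)\<^sup>2 * (norm k)\<^sup>2" by (simp add: power_mult_distrib)
  have 3: "\<bar>(max 0 (t + q))\<^sup>2 - (max 0 t)\<^sup>2 - 2 * max 0 t * q\<bar> \<le> q\<^sup>2" by (rule pospart_sq_expansion)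
  have "\<bar>bump (y + k) r x - bump y r x + Dbump y r x \<bullet> k\<bar> \<le> (2 * D + 1)\<^sup>2 * (norm k)\<^sup>2 + 2 * r\<^sup>2 * (norm k)\<^sup>2"
    unfolding e using 1 2 3 by linarith
  then show ?thesis by (simp add: algebra_simps)
qed

lemma open_AE_empty:
  fixes U :: "'a::euclidean_space set"
  assumes "open U" "AE x in lborel. x \<notin> U"
  shows "U = {}"
proof -
  have "U \<in> null_sets lborel" using assms by (subst AE_iff_null_sets) auto
  then have "negligible U" by (simp add: negligible_iff_null_sets null_sets_completionI)
  then show ?thesis using open_not_negligible[OF assms(1)] by blast
qed

text \<open>Averages of \<open>f\<close> against a bump of fixed radius change with the centre by
  the weak gradient tested with the bump, up to a quadratic error that disappears when local
  estimates are added along a segment. The radius is small enough that the averages approximate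
  \<open>f\<close> at the two points \<open>a\<close> and \<open>b\<close>.\<close>

lemma bounded_weak_grad_lipschitz:
  fixes f :: "'a::euclidean_space \<Rightarrow> real"
  assumes V: "open V" and f: "continuous_on V f" and G: "weak_grad V f G"
    and B: "cball c r \<subseteq> V" and L: "AE x in lborel. x \<in> cball c r \<longrightarrow> norm (G x) \<le> L" "L \<ge> 0"
    and a: "a \<in> ball c r" and b: "b \<in> ball c r"
  shows "\<bar>f a - f b\<bar> \<le> L * dist a b"
proof (rule field_le_epsilon)
  fix \<epsilon> :: real assume \<epsilon>: "\<epsilon> > 0"
  \<comment> \<open>Bumps of radius at most \<open>r - r'\<close> centred in
    \<open>ball c r'\<close> are supported in \<open>cball c r\<close>, where the gradient is
    bounded.\<close>
  define r' where "r' = (max (dist c a) (dist c b) + r) / 2"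
  have "r > 0" using a zero_le_dist[of c a] by (simp only: mem_ball)
  then have r': "dist c a < r'" "dist c b < r'" "r' < r" "r > 0"
    using a b by (auto simp: r'_def max_def)
  have isC: "isCont f x" if "x \<in> V" for x using f that V continuous_on_eq_continuous_at by blast
  have aV: "a \<in> V" "b \<in> V" using a b B by auto
  obtain d1 where d1: "d1 > 0" "\<And>x. dist x a < d1 \<Longrightarrow> \<bar>f x - f a\<bar> \<le> \<epsilon> / 2"
    using isC[OF aV(1)] \<epsilon> unfolding continuous_at_eps_delta dist_real_def by (metis half_gt_zero less_imp_le)
  obtain d2 where d2: "d2 > 0" "\<And>x. dist x b < d2 \<Longrightarrow> \<bar>f x - f b\<bar> \<le> \<epsilon> / 2"
    using isC[OF aV(2)] \<epsilon> unfolding continuous_at_eps_delta dist_real_def by (metis half_gt_zero less_imp_le)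
  define \<rho> where "\<rho> = min (r - r') (min d1 d2)"
  have \<rho>: "\<rho> > 0" "\<rho> \<le> r - r'" "\<rho> \<le> d1" "\<rho> \<le> d2" using r' d1 d2 by (auto simp: \<rho>_def)
  define K where "K = cball c r"
  have K: "compact K" "K \<subseteq> V" using B by (auto simp: K_def)
  have yK: "cball y \<rho> \<subseteq> K" if "y \<in> ball c r'" for y
  proof
    fix x assume "x \<in> cball y \<rho>"
    then show "x \<in> K" using that \<rho> dist_triangle[of c x y] by (simp add: K_def)
  qed
  have tst: "C1c_test V (bump y \<rho>) (Dbump y \<rho>)" if "y \<in> ball c r'" for y
    by (rule bump_test[OF \<rho>(1)]) (use yK[OF that] K in blast)
  have fK: "set_integrable lborel K f" unfolding set_integrable_def
    by (rule borel_integrable_compact[OF K(1) continuous_on_subset[OF f K(2)]])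
  have ifb: "integrable lborel (\<lambda>x. f x * bump y \<rho> x)" if "y \<in> ball c r'" for y
  proof (rule integrable_mult_compact_support[OF fK K(1) C1c_test_continuous[OF tst[OF that]]])
    fix x assume "x \<notin> K"
    then have "x \<notin> ball y \<rho>" using yK[OF that] ball_subset_cball by blast
    then show "bump y \<rho> x = 0" using bump_zero \<rho> by blast
  qed
  have Dz: "Dbump y \<rho> x = 0" if "y \<in> ball c r'" "x \<notin> K" for x y
  proof -
    have "x \<notin> cball y \<rho>" using yK[OF that(1)] that(2) by blast
    then have "\<rho> < norm (x - y)" by (simp add: dist_norm norm_minus_commute)
    then have "\<rho>\<^sup>2 < (norm (x - y))\<^sup>2" using \<rho> by (intro power_strict_mono) auto
    then show ?thesis by (simp add: Dbump_def power2_norm_eq_inner)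
  qed
  have ifD: "integrable lborel (\<lambda>x. f x * (Dbump y \<rho> x \<bullet> k))" if "y \<in> ball c r'" for y k
    by (rule integrable_mult_compact_support[OF fK K(1)])
      (use C1c_test_continuous_grad[OF tst[OF that]] Dz[OF that] in \<open>auto intro!: continuous_intros\<close>)
  define m where "m y = (LBINT x. f x * bump y \<rho> x)" for y
  define N where "N = (LBINT x. bump (0::'a) \<rho> x)"
  have mb[measurable]: "bump (0::'a) \<rho> \<in> borel_measurable borel"
    by (rule borel_measurable_continuous_onI) (auto simp: bump_def intro!: continuous_intros)
  have Ny: "(LBINT x. bump y \<rho> x) = N" for y :: 'a
  proof -
    have "bump y \<rho> x = bump 0 \<rho> (- y + x)" for x by (simp add: bump_def)
    then show ?thesis using lborel_integral_translate[OF mb, of "- y"] by (simp add: N_def)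
  qed
  have ib: "integrable lborel (bump y \<rho>)" for y :: 'a
    by (rule C1c_test_integrable[OF bump_test[OF \<rho>(1), of y UNIV]]) simp
  have N0: "N > 0"
  proof (rule ccontr)
    assume "\<not> N > 0"
    moreover have "N \<ge> 0" unfolding N_def by (intro integral_nonneg_AE) (auto simp: bump_nonneg)
    ultimately have "N = 0" by simp
    then have "AE x in lborel. bump (0::'a) \<rho> x = 0"
      unfolding N_def using ib[of 0] by (subst (asm) integral_nonneg_eq_0_iff_AE) (auto simp: bump_nonneg)
    then have "AE x in lborel. x \<notin> ball (0::'a) \<rho>"
      by eventually_elim (use bump_pos_iff[OF \<rho>(1), of "0::'a"] in force)
    then have "ball (0::'a) \<rho> = {}" by (rule open_AE_empty[OF open_ball])
    then show False using \<rho> by simp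
  qed
  define S where "S = (LBINT x. \<bar>indicator K x *\<^sub>R f x\<bar>)"
  define Q where "Q = (2 * (2 * r) + 1)\<^sup>2 + 2 * \<rho>\<^sup>2"
  have Q0: "Q \<ge> 0" by (simp add: Q_def)
  have S0: "S \<ge> 0" by (simp add: S_def)
  have step: "\<bar>m (y + k) - m y\<bar> \<le> L * N * norm k + Q * S * (norm k)\<^sup>2"
    if y: "y \<in> ball c r'" and yk: "y + k \<in> ball c r'" and k: "norm k \<le> 1" for y k
  proof -
    define R where "R x = bump (y + k) \<rho> x - bump y \<rho> x + Dbump y \<rho> x \<bullet> k" for x
    have "m (y + k) - m y + (LBINT x. f x * (Dbump y \<rho> x \<bullet> k)) = (LBINT x. f x * R x)"
      unfolding m_def R_def using ifb[OF y] ifb[OF yk] ifD[OF y, of k] by (simp add: distrib_left right_diff_distrib)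
    then have eq: "m (y + k) - m y = (LBINT x. (G x \<bullet> k) * bump y \<rho> x) + (LBINT x. f x * R x)"
      using weak_grad_test[OF G tst[OF y], of k] by simp
    have iG: "integrable lborel (\<lambda>x. (G x \<bullet> k) * bump y \<rho> x)" by (rule weak_grad_test_integrable[OF G tst[OF y]])
    have 1: "\<bar>LBINT x. (G x \<bullet> k) * bump y \<rho> x\<bar> \<le> L * N * norm k"
    proof -
      have "\<bar>LBINT x. (G x \<bullet> k) * bump y \<rho> x\<bar> \<le> (LBINT x. \<bar>(G x \<bullet> k) * bump y \<rho> x\<bar>)"
        by (rule integral_abs_bound)
      also have "\<dots> \<le> (LBINT x. L * norm k * bump y \<rho> x)"
      proof (rule integral_mono_AE)
        show "integrable lborel (\<lambda>x. \<bar>(G x \<bullet> k) * bump y \<rho> x\<bar>)" using iG by simp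
        show "integrable lborel (\<lambda>x. L * norm k * bump y \<rho> x)" using ib by simp
        show "AE x in lborel. \<bar>(G x \<bullet> k) * bump y \<rho> x\<bar> \<le> L * norm k * bump y \<rho> x"
          using L(1)
        proof eventually_elim
          case (elim x)
          show ?case
          proof (cases "x \<in> K")
            case True
            then have "norm (G x) \<le> L" using elim by (simp add: K_def)
            then have "\<bar>G x \<bullet> k\<bar> \<le> L * norm k"
              using Cauchy_Schwarz_ineq2[of "G x" k] mult_right_mono[of "norm (G x)" L "norm k"] by simp
            then show ?thesis by (simp add: abs_mult bump_nonneg mult_right_mono)
          next
            case False
            then have "x \<notin> ball y \<rho>" using yK[OF y] ball_subset_cball by blast
            then have "bump y \<rho> x = 0" by (rule bump_zero[OF \<rho>(1)])
            then show ?thesis by simp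
          qed
        qed
      qed
      also have "\<dots> = L * N * norm k" by (simp add: Ny)
      finally show ?thesis .
    qed
    have "\<bar>LBINT x. f x * R x\<bar> \<le> (LBINT x. \<bar>f x * R x\<bar>)" by (rule integral_abs_bound)
    also have "\<dots> \<le> (LBINT x. (Q * (norm k)\<^sup>2) * \<bar>indicator K x *\<^sub>R f x\<bar>)"
    proof (rule integral_mono)
      show "integrable lborel (\<lambda>x. \<bar>f x * R x\<bar>)"
        unfolding R_def using ifb[OF y] ifb[OF yk] ifD[OF y, of k] by (simp add: distrib_left right_diff_distrib)
      show "integrable lborel (\<lambda>x. (Q * (norm k)\<^sup>2) * \<bar>indicator K x *\<^sub>R f x\<bar>)"
        using fK unfolding set_integrable_def by (intro integrable_mult_right integrable_abs)
      fix x
      show "\<bar>f x * R x\<bar> \<le> (Q * (norm k)\<^sup>2) * \<bar>indicator K x *\<^sub>R f x\<bar>"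
      proof (cases "x \<in> K")
        case True
        have "norm (x - y) \<le> 2 * r"
          using True y r' dist_triangle[of x y c] by (simp add: K_def dist_norm norm_minus_commute)
        then have "\<bar>R x\<bar> \<le> Q * (norm k)\<^sup>2" unfolding R_def Q_def by (rule bump_translate_expansion[OF _ k])
        from mult_right_mono[OF this, of "\<bar>f x\<bar>"] show ?thesis using True by (simp add: abs_mult mult.commute)
      next
        case False
        then have "x \<notin> ball y \<rho>" "x \<notin> ball (y + k) \<rho>" using yK[OF y] yK[OF yk] ball_subset_cball by blast+
        then have "bump y \<rho> x = 0" "bump (y + k) \<rho> x = 0" by (auto intro!: bump_zero[OF \<rho>(1)])
        then have "R x = 0" unfolding R_def using Dz[OF y False] by simp
        then show ?thesis using False by simp
      qed
    qed
    also have "\<dots> = Q * (norm k)\<^sup>2 * S" by (simp add: S_def)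
    finally show ?thesis using 1 eq by (simp add: algebra_simps)
  qed
  have mlip: "\<bar>m a - m b\<bar> \<le> (L * N + \<eta>) * dist a b" if \<eta>: "\<eta> > 0" for \<eta>
  proof (rule lipschitz_on_segment_if_locally[where V = "ball c r'"])
    show "closed_segment a b \<subseteq> ball c r'" by (intro closed_segment_subset) (use r' in auto)
    fix x assume x: "x \<in> ball c r'"
    \<comment> \<open>At distances up to \<open>2 * d\<close> the quadratic error is at most
      \<open>\<eta>\<close> times the distance. The summand \<open>1\<close> covers
      \<open>Q * S = 0\<close>, and \<open>1 / 2\<close> ensures that shifts have norm at most
      one.\<close>
    define d where "d = min (1 / 2) (\<eta> / (2 * (Q * S + 1)))"
    have QS: "Q * S \<ge> 0" using Q0 S0 by simp
    have d: "d > 0" "d \<le> 1 / 2" "2 * d * (Q * S) \<le> \<eta>"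
    proof -
      show "d > 0" using \<eta> QS by (auto simp: d_def)
      show "d \<le> 1 / 2" unfolding d_def by (rule min.cobounded1)
      have "d * (2 * (Q * S + 1)) \<le> \<eta> / (2 * (Q * S + 1)) * (2 * (Q * S + 1))"
        unfolding d_def using QS by (intro mult_right_mono) auto
      also have "\<dots> = \<eta>" using QS by simp
      finally have "2 * d * (Q * S) + 2 * d \<le> \<eta>" by (simp add: algebra_simps)
      then show "2 * d * (Q * S) \<le> \<eta>" using \<open>d > 0\<close> by linarith
    qed
    obtain e where e: "e > 0" "ball x e \<subseteq> ball c r'" using openE[OF open_ball x] by blast
    show "\<exists>s>0. \<forall>p\<in>ball x s. \<forall>q\<in>ball x s. \<bar>m p - m q\<bar> \<le> (L * N + \<eta>) * dist p q"
    proof (intro exI[of _ "min d e"] conjI ballI)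
      show "min d e > 0" using d e by simp
      fix p q assume p: "p \<in> ball x (min d e)" and q: "q \<in> ball x (min d e)"
      have nk: "norm (p - q) \<le> 2 * d"
        using p q dist_triangle[of p q x] by (simp add: dist_norm norm_minus_commute)
      have "\<bar>m (q + (p - q)) - m q\<bar> \<le> L * N * norm (p - q) + Q * S * (norm (p - q))\<^sup>2"
        by (rule step) (use p q e nk d in \<open>auto simp: subset_iff\<close>)
      also have "Q * S * (norm (p - q))\<^sup>2 \<le> Q * S * (2 * d * norm (p - q))"
        unfolding power2_eq_square using nk QS by (intro mult_left_mono mult_right_mono) auto
      also have "Q * S * (2 * d * norm (p - q)) = (2 * d * (Q * S)) * norm (p - q)" by simp
      also have "\<dots> \<le> \<eta> * norm (p - q)" using d by (intro mult_right_mono) auto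
      finally show "\<bar>m p - m q\<bar> \<le> (L * N + \<eta>) * dist p q" by (simp add: dist_norm algebra_simps)
    qed
  qed
  have mL: "\<bar>m a - m b\<bar> \<le> L * N * dist a b"
  proof (rule field_le_epsilon)
    fix \<eta> :: real assume \<eta>: "\<eta> > 0"
    have "\<eta> / (dist a b + 1) * dist a b \<le> \<eta> / (dist a b + 1) * (dist a b + 1)"
      using \<eta> by (intro mult_left_mono) auto
    also have "\<dots> = \<eta>" using zero_le_dist[of a b] by (simp add: add_nonneg_eq_0_iff)
    finally have "\<eta> / (dist a b + 1) * dist a b \<le> \<eta>" .
    moreover have "\<bar>m a - m b\<bar> \<le> (L * N + \<eta> / (dist a b + 1)) * dist a b"
      by (rule mlip) (use \<eta> zero_le_dist[of a b] in \<open>auto intro!: divide_pos_pos add_nonneg_pos\<close>)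
    ultimately show "\<bar>m a - m b\<bar> \<le> L * N * dist a b + \<eta>" by (simp add: distrib_right)
  qed
  have app: "\<bar>m y - f y * N\<bar> \<le> \<epsilon> / 2 * N" if y: "y \<in> ball c r'" and cl: "\<And>x. dist x y < \<rho> \<Longrightarrow> \<bar>f x - f y\<bar> \<le> \<epsilon> / 2" for y
  proof -
    have "m y - f y * N = (LBINT x. (f x - f y) * bump y \<rho> x)"
      unfolding m_def using ifb[OF y] ib[of y] by (simp add: left_diff_distrib Ny)
    also have "\<bar>\<dots>\<bar> \<le> (LBINT x. \<bar>(f x - f y) * bump y \<rho> x\<bar>)" by (rule integral_abs_bound)
    also have "\<dots> \<le> (LBINT x. \<epsilon> / 2 * bump y \<rho> x)"
    proof (rule integral_mono)
      show "integrable lborel (\<lambda>x. \<bar>(f x - f y) * bump y \<rho> x\<bar>)" using ifb[OF y] ib[of y] by (simp add: left_diff_distrib)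
      show "integrable lborel (\<lambda>x. \<epsilon> / 2 * bump y \<rho> x)" using ib by simp
      fix x show "\<bar>(f x - f y) * bump y \<rho> x\<bar> \<le> \<epsilon> / 2 * bump y \<rho> x"
      proof (cases "x \<in> ball y \<rho>")
        case True
        then have "\<bar>f x - f y\<bar> * bump y \<rho> x \<le> \<epsilon> / 2 * bump y \<rho> x"
          by (intro mult_right_mono bump_nonneg cl) (simp add: dist_commute)
        then show ?thesis by (simp add: abs_mult bump_nonneg)
      qed (simp add: bump_zero[OF \<rho>(1)])
    qed
    finally show ?thesis by (simp add: Ny)
  qed
  have "\<bar>m a - f a * N\<bar> \<le> \<epsilon> / 2 * N" by (rule app) (use r' d1 \<rho> in auto)
  moreover have "\<bar>m b - f b * N\<bar> \<le> \<epsilon> / 2 * N" by (rule app) (use r' d2 \<rho> in auto)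
  ultimately have "\<bar>f a * N - f b * N\<bar> \<le> L * N * dist a b + \<epsilon> * N" using mL by linarith
  moreover have "\<bar>f a * N - f b * N\<bar> = \<bar>f a - f b\<bar> * N" using N0 by (simp add: left_diff_distrib[symmetric] abs_mult)
  ultimately have "\<bar>f a - f b\<bar> * N \<le> L * N * dist a b + \<epsilon> * N" by (simp only:)
  also have "\<dots> = (L * dist a b + \<epsilon>) * N" by (simp add: algebra_simps)
  finally have "\<bar>f a - f b\<bar> * N \<le> (L * dist a b + \<epsilon>) * N" .
  then show "\<bar>f a - f b\<bar> \<le> L * dist a b + \<epsilon>" using N0 by simp
qed

section \<open>Wells and absolute minimality\<close>

lemma AE_restrict_lborel_iff:
  "open V \<Longrightarrow> (AE x in restrict_space lborel V. P x) \<longleftrightarrow> (AE x in lborel. x \<in> V \<longrightarrow> P x)"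
  by (intro AE_restrict_space_iff) simp

text \<open>By convention \<open>esssup\<close> is the top element for functions that are not
  measurable, so upper bounds on energies rest on this.\<close>

lemma ess_H_measurable:
  fixes f :: "'a::euclidean_space \<Rightarrow> real"
  assumes V: "open V" and G: "weak_grad V f G"
  shows "(\<lambda>x. ereal ((1/2) * (norm (G x))\<^sup>2 - f x)) \<in> borel_measurable (restrict_space lborel V)"
proof -
  have "V \<inter> space lborel \<in> sets lborel" using V by simp
  then have "f \<in> borel_measurable (restrict_space lborel V)" "G \<in> borel_measurable (restrict_space lborel V)"
    using G unfolding weak_grad_def set_borel_measurable_def by (simp_all add: borel_measurable_restrict_space_iff)
  then show ?thesis by measurable
qed

lemma ess_H_le_iff:
  fixes f :: "'a::euclidean_space \<Rightarrow> real"
  assumes V: "open V" and G: "weak_grad V f G"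
  shows "ess_H V f G \<le> ereal k \<longleftrightarrow> (AE x in lborel. x \<in> V \<longrightarrow> (1/2) * (norm (G x))\<^sup>2 - f x \<le> k)"
proof
  assume le: "ess_H V f G \<le> ereal k"
  have "AE x in restrict_space lborel V. ereal ((1/2) * (norm (G x))\<^sup>2 - f x) \<le> ess_H V f G"
    unfolding ess_H_def by (rule esssup_AE)
  then have "AE x in restrict_space lborel V. (1/2) * (norm (G x))\<^sup>2 - f x \<le> k"
    by eventually_elim (metis ereal_less_eq(3) le order_trans)
  then show "AE x in lborel. x \<in> V \<longrightarrow> (1/2) * (norm (G x))\<^sup>2 - f x \<le> k"
    unfolding AE_restrict_lborel_iff[OF V] .
next
  assume "AE x in lborel. x \<in> V \<longrightarrow> (1/2) * (norm (G x))\<^sup>2 - f x \<le> k"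
  then have "AE x in restrict_space lborel V. ereal ((1/2) * (norm (G x))\<^sup>2 - f x) \<le> ereal k"
    unfolding AE_restrict_lborel_iff[OF V] by simp
  then show "ess_H V f G \<le> ereal k"
    unfolding ess_H_def by (intro esssup_I ess_H_measurable[OF V G])
qed

lemma weak_grad_const:
  fixes V :: "'a::euclidean_space set"
  assumes "open V"
  shows "weak_grad V (\<lambda>_. c) (\<lambda>_. 0)"
  unfolding weak_grad_def
proof (intro conjI allI impI)
  show "set_borel_measurable lborel V (\<lambda>_. c)" "set_borel_measurable lborel V (\<lambda>_. 0::'a)"
    unfolding set_borel_measurable_def using assms by auto
  show "set_integrable lborel K (\<lambda>_. c)" if "compact K \<and> K \<subseteq> V" for K
    using that set_integrable_const_compact by blast
  show "set_integrable lborel K (\<lambda>_. 0::'a)" for K by (simp add: set_integrable_def)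
  fix phi Dphi v assume t: "C1c_test V phi Dphi"
  have "loc_lip V 0 (\<lambda>_. c)" unfolding loc_lip_def by (auto intro: exI[of _ 1])
  from loc_lip_test_bound[OF assms this t, of v]
  show "(LINT x:V|lborel. c * (Dphi x \<bullet> v)) = - (LINT x:V|lborel. (0 \<bullet> v) * phi x)"
    unfolding C1c_test_LINT[OF t] by simp
qed

lemma W1inf_const:
  fixes V :: "'a::euclidean_space set"
  assumes "open V"
  shows "W1inf V (\<lambda>_. c)"
proof -
  have "set_borel_measurable lborel V (\<lambda>_. c)" unfolding set_borel_measurable_def using assms by auto
  moreover have "\<exists>G. weak_grad V (\<lambda>_. c) G \<and> (\<exists>M. AE x in lborel. x \<in> V \<longrightarrow> norm (G x) \<le> M)"
    using weak_grad_const[OF assms, of c] by (intro exI[of _ "\<lambda>_. 0"] conjI exI[of _ 0]) auto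
  moreover have "\<exists>M. AE x in lborel. x \<in> V \<longrightarrow> \<bar>c\<bar> \<le> M" by (intro exI[of _ "\<bar>c\<bar>"]) auto
  ultimately show ?thesis unfolding W1inf_def by blast
qed

lemma continuous_bounded_range:
  fixes u :: "'a::euclidean_space \<Rightarrow> real"
  assumes "bounded \<Omega>" "continuous_on (closure \<Omega>) u"
  obtains M where "\<And>x. x \<in> closure \<Omega> \<Longrightarrow> \<bar>u x\<bar> \<le> M"
proof -
  have "compact (closure \<Omega>)" using assms(1) by simp
  then have "bounded (u ` closure \<Omega>)" using compact_continuous_image[OF assms(2)] compact_imp_bounded by blast
  then show ?thesis using that unfolding bounded_iff by auto
qed

lemma well_imp_not_abs_minimizer:
  fixes u :: "'a::euclidean_space \<Rightarrow> real"
  assumes b: "bounded \<Omega>" and c: "continuous_on (closure \<Omega>) u" and w: "has_well \<Omega> u"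
  shows "\<not> abs_minimizer \<Omega> u"
proof
  assume am: "abs_minimizer \<Omega> u"
  obtain V where V: "open V" "V \<noteq> {}" "V \<subseteq> \<Omega>" "(INF x\<in>closure V. u x) < (INF x\<in>frontier V. u x)"
    using w unfolding has_well_def by blast
  \<comment> \<open>A level strictly between the two infima keeps the closure of the sublevel set
    \<open>W\<close> inside \<open>V\<close>. On \<open>W\<close> the constant has energy
    \<open>- c0\<close>, while the density of \<open>u\<close> is at least \<open>- u\<close>, hence
    above \<open>- c0\<close>.\<close>
  obtain c0 where c0: "(INF x\<in>closure V. u x) < c0" "c0 < (INF x\<in>frontier V. u x)" using dense[OF V(4)] by blast
  obtain M where M: "\<And>x. x \<in> closure \<Omega> \<Longrightarrow> \<bar>u x\<bar> \<le> M" using continuous_bounded_range[OF b c] by blast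
  have clV: "closure V \<subseteq> closure \<Omega>" using V(3) by (rule closure_mono)
  have lo: "- M \<le> u x" if "x \<in> closure \<Omega>" for x using M[OF that] by linarith
  have frV: "frontier V \<subseteq> closure V" by (simp add: frontier_def)
  have bb: "bdd_below (u ` closure V)" "bdd_below (u ` frontier V)"
    unfolding bdd_below_def using lo clV frV by (auto intro!: exI[of _ "- M"])
  have fr: "c0 < u x" if "x \<in> frontier V" for x
    using cINF_lower[OF bb(2) that] c0(2) by linarith
  have cV: "continuous_on (closure V) u" using c clV continuous_on_subset by blast
  have "\<exists>x\<in>closure V. u x < c0" using c0(1) V(2) bb(1) by (subst (asm) cINF_less_iff) auto
  then obtain x0 where x0: "x0 \<in> closure V" "u x0 < c0" by blast
  have x0V: "x0 \<in> V"
  proof (rule ccontr)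
    assume "x0 \<notin> V"
    then have "x0 \<in> frontier V" using x0 V(1) by (simp add: frontier_def interior_open)
    then show False using fr x0 by fastforce
  qed
  define W where "W = V \<inter> u -` {..<c0}"
  have W: "open W" unfolding W_def
    by (rule continuous_open_preimage[OF continuous_on_subset[OF cV closure_subset] V(1)]) simp
  have x0W: "x0 \<in> W" using x0 x0V by (simp add: W_def)
  have "closed (closure V \<inter> u -` {..c0})"
    by (rule continuous_closed_preimage[OF cV]) auto
  then have clW: "closure W \<subseteq> closure V \<inter> u -` {..c0}"
    by (rule closure_minimal[rotated]) (use closure_subset[of V] in \<open>auto simp: W_def\<close>)
  have clWV: "closure W \<subseteq> V"
  proof
    fix x assume x: "x \<in> closure W"
    show "x \<in> V"
    proof (rule ccontr)
      assume "x \<notin> V"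
      then have "x \<in> frontier V" using x clW V(1) by (auto simp: frontier_def interior_open)
      then show False using fr x clW by fastforce
    qed
  qed
  have frW: "u x = c0" if "x \<in> frontier W" for x
  proof -
    have x: "x \<in> closure W" "x \<notin> W" using that W by (auto simp: frontier_def interior_open)
    then have "u x \<le> c0" "x \<in> V" using clW clWV by auto
    then show ?thesis using x(2) by (auto simp: W_def)
  qed
  have "bounded W" using b V(3) bounded_subset by (auto simp: W_def)
  then have cW: "compact (closure W)" by simp
  have sub: "closure W \<subseteq> \<Omega>" using clWV V(3) by blast
  have "W1inf W u" using am W cW sub unfolding abs_minimizer_def W1inf_loc_def by blast
  then obtain G where G: "weak_grad W u G" unfolding W1inf_def by blast
  have "ess_H W u G \<le> ess_H W (\<lambda>_. c0) (\<lambda>_. 0)"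
    using am[unfolded abs_minimizer_def, THEN conjunct2, rule_format, of W "\<lambda>_. c0" G "\<lambda>_. 0"]
      W cW sub W1inf_const[OF W] frW G weak_grad_const[OF W] by simp
  also have "ess_H W (\<lambda>_. c0) (\<lambda>_. 0) \<le> ereal (- c0)"
    unfolding ess_H_le_iff[OF W weak_grad_const[OF W]] by simp
  finally have "AE x in lborel. x \<in> W \<longrightarrow> (1/2) * (norm (G x))\<^sup>2 - u x \<le> - c0"
    unfolding ess_H_le_iff[OF W G] .
  then have "AE x in lborel. x \<notin> W"
  proof eventually_elim
    case (elim x)
    show ?case
    proof
      assume x: "x \<in> W"
      then have "u x < c0" by (simp add: W_def)
      moreover have "(1/2) * (norm (G x))\<^sup>2 \<ge> 0" by simp
      ultimately show False using elim x by linarith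
    qed
  qed
  then have "W = {}" by (rule open_AE_empty[OF W])
  then show False using x0W by blast
qed

section \<open>Competitors with bounded energy\<close>

text \<open>The energy density is at least \<open>- f\<close>, and continuity extends the almost
  everywhere bound to all of \<open>closure V\<close>.\<close>

lemma competitor_lower_bound:
  fixes f :: "'a::euclidean_space \<Rightarrow> real"
  assumes V: "open V" and f: "continuous_on (closure V) f"
    and k: "AE x in lborel. x \<in> V \<longrightarrow> (1/2) * (norm (G x))\<^sup>2 - f x \<le> k"
    and x: "x \<in> closure V"
  shows "- k \<le> f x"
proof -
  have "open (V \<inter> f -` {..<- k})"
    by (rule continuous_open_preimage[OF continuous_on_subset[OF f closure_subset] V]) simp
  moreover have "AE x in lborel. x \<notin> V \<inter> f -` {..<- k}"
    using k
  proof eventually_elim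
    case (elim x)
    have "(1/2) * (norm (G x))\<^sup>2 \<ge> 0" by simp
    moreover have "(1/2) * (norm (G x))\<^sup>2 - f x \<le> k" if "x \<in> V" using elim that by blast
    ultimately have "- k \<le> f x" if "x \<in> V" using that by linarith
    then show ?case by auto
  qed
  ultimately have e: "V \<inter> f -` {..<- k} = {}" by (rule open_AE_empty)
  have "closed (closure V \<inter> f -` {- k..})" by (rule continuous_closed_preimage[OF f]) auto
  moreover have "V \<subseteq> closure V \<inter> f -` {- k..}" using e closure_subset[of V] by force
  ultimately have "closure V \<subseteq> closure V \<inter> f -` {- k..}" by (rule closure_minimal[rotated])
  then show ?thesis using x by auto
qed

lemma continuous_ratio_ball:
  fixes w :: "'a::euclidean_space \<Rightarrow> real"
  assumes "isCont w x" "w x > 0" "\<eta> > 0" "open V" "x \<in> V"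
  obtains \<rho> a b where "\<rho> > 0" "cball x \<rho> \<subseteq> V" "0 < a" "b = (1 + \<eta>) * a" "\<And>y. y \<in> cball x \<rho> \<Longrightarrow> a \<le> w y \<and> w y \<le> b"
proof -
  \<comment> \<open>The solution of
    \<open>(1 + \<theta>) / (1 - \<theta>) = 1 + \<eta>\<close>.\<close>
  define \<theta> where "\<theta> = \<eta> / (2 + \<eta>)"
  have \<theta>: "\<theta> > 0" "\<theta> < 1" using assms(3) by (auto simp: \<theta>_def)
  have eq: "1 + \<theta> = (1 + \<eta>) * (1 - \<theta>)" using assms(3) by (simp add: \<theta>_def field_simps)
  obtain d where d: "d > 0" "\<And>y. dist y x < d \<Longrightarrow> \<bar>w y - w x\<bar> < \<theta> * w x"
    using assms(1)[unfolded continuous_at_eps_delta dist_real_def] mult_pos_pos[OF \<theta>(1) assms(2)] by blast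
  obtain e where e: "e > 0" "cball x e \<subseteq> V" using assms(4,5) open_contains_cball by blast
  define \<rho> where "\<rho> = min (d / 2) e"
  have \<rho>: "\<rho> > 0" "\<rho> < d" "\<rho> \<le> e" using d e by (auto simp: \<rho>_def)
  have "(1 - \<theta>) * w x \<le> w y \<and> w y \<le> (1 + \<theta>) * w x" if "y \<in> cball x \<rho>" for y
    using d(2)[of y] that \<rho> by (simp add: dist_commute abs_less_iff algebra_simps)
  moreover have "cball x \<rho> \<subseteq> V" using e \<rho> by force
  moreover have "(1 + \<theta>) * w x = (1 + \<eta>) * ((1 - \<theta>) * w x)" unfolding eq by simp
  moreover have "(1 - \<theta>) * w x > 0" using \<theta> assms(2) by simp
  ultimately show ?thesis using that[of \<rho> "(1 - \<theta>) * w x" "(1 + \<theta>) * w x"] \<rho> by blast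
qed

text \<open>Formally the gradient of the root has norm at most one. On a ball where the root lies
  between \<open>a\<close> and \<open>b = (1 + \<eta>) * a\<close>, \<open>f\<close> has Lipschitz
  constant \<open>b\<close>, and dividing by the sum of two roots, at least \<open>2 * a\<close>,
  leaves the factor \<open>1 + \<eta>\<close>. The summand \<open>e\<close> keeps the root positive
  where \<open>f = - k\<close>.\<close>

lemma competitor_transformed_lipschitz:
  fixes f :: "'a::euclidean_space \<Rightarrow> real"
  assumes V: "open V" and f: "continuous_on (closure V) f" and G: "weak_grad V f G"
    and k: "AE x in lborel. x \<in> V \<longrightarrow> (1/2) * (norm (G x))\<^sup>2 - f x \<le> k"
    and seg: "closed_segment p q \<subseteq> V"
  shows "\<bar>sqrt (2 * (f p + k)) - sqrt (2 * (f q + k))\<bar> \<le> dist p q"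
proof -
  have cV: "continuous_on V f" using f closure_subset continuous_on_subset by blast
  have lb: "f x + k \<ge> 0" if "x \<in> V" for x
    using competitor_lower_bound[OF V f k, of x] that closure_subset[of V] by auto
  have reg: "\<bar>sqrt (2 * (f p + k) + e) - sqrt (2 * (f q + k) + e)\<bar> \<le> dist p q" if e: "e > 0" for e
  proof -
    define w where "w x = sqrt (2 * (f x + k) + e)" for x
    have w2: "(w x)\<^sup>2 = 2 * (f x + k) + e" if "x \<in> V" for x using lb[OF that] e by (simp add: w_def)
    have wp: "w x > 0" if "x \<in> V" for x using lb[OF that] e by (simp add: w_def)
    have wc: "isCont w x" if "x \<in> V" for x
    proof -
      have "isCont f x" using cV V that continuous_on_eq_continuous_at by blast
      then show ?thesis unfolding w_def by (intro continuous_intros)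
    qed
    have "\<bar>w p - w q\<bar> \<le> (1 + \<eta>) * dist p q" if \<eta>: "\<eta> > 0" for \<eta>
    proof (rule lipschitz_on_segment_if_locally[OF _ seg])
      fix x assume x: "x \<in> V"
      obtain \<rho> a b where \<rho>: "\<rho> > 0" "cball x \<rho> \<subseteq> V" and ab: "0 < a" "b = (1 + \<eta>) * a"
        and w: "\<And>y. y \<in> cball x \<rho> \<Longrightarrow> a \<le> w y \<and> w y \<le> b"
        using continuous_ratio_ball[OF wc[OF x] wp[OF x] \<eta> V x] by blast
      have b0: "b \<ge> 0" using ab \<eta> by simp
      have Gb: "AE y in lborel. y \<in> cball x \<rho> \<longrightarrow> norm (G y) \<le> b"
        using k
      proof eventually_elim
        case (elim y)
        show ?case
        proof
          assume y: "y \<in> cball x \<rho>"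
          then have yV: "y \<in> V" using \<rho> by blast
          have "(norm (G y))\<^sup>2 \<le> (w y)\<^sup>2" using elim yV w2[OF yV] e by simp
          then have "norm (G y) \<le> w y" using wp[OF yV] by (rule power2_le_imp_le[OF _ less_imp_le])
          then show "norm (G y) \<le> b" using w[OF y] by linarith
        qed
      qed
      show "\<exists>r>0. \<forall>s\<in>ball x r. \<forall>t\<in>ball x r. \<bar>w s - w t\<bar> \<le> (1 + \<eta>) * dist s t"
      proof (intro exI[of _ \<rho>] conjI ballI)
        fix s t assume s: "s \<in> ball x \<rho>" and t: "t \<in> ball x \<rho>"
        then have sV: "s \<in> V" and tV: "t \<in> V" and sc: "s \<in> cball x \<rho>" and tc: "t \<in> cball x \<rho>"
          using \<rho>(2) ball_subset_cball[of x \<rho>] by blast+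
        have "\<bar>f s - f t\<bar> \<le> b * dist s t"
          by (rule bounded_weak_grad_lipschitz[OF V cV G \<rho>(2) Gb b0 s t])
        moreover have "(w s - w t) * (w s + w t) = 2 * (f s - f t)"
        proof -
          have "(w s - w t) * (w s + w t) = (w s)\<^sup>2 - (w t)\<^sup>2" by (simp add: power2_eq_square algebra_simps)
          then show ?thesis using w2[OF sV] w2[OF tV] by simp
        qed
        then have "\<bar>w s - w t\<bar> * \<bar>w s + w t\<bar> = 2 * \<bar>f s - f t\<bar>" by (metis abs_mult abs_numeral)
        moreover have "\<bar>w s - w t\<bar> * (2 * a) \<le> \<bar>w s - w t\<bar> * \<bar>w s + w t\<bar>"
          using w[OF sc] w[OF tc] by (intro mult_left_mono) auto
        ultimately have "\<bar>w s - w t\<bar> * (2 * a) \<le> 2 * (b * dist s t)" by simp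
        then have "\<bar>w s - w t\<bar> * a \<le> b * dist s t" by simp
        then have "\<bar>w s - w t\<bar> * a \<le> (1 + \<eta>) * dist s t * a" unfolding ab by (simp add: mult_ac)
        then show "\<bar>w s - w t\<bar> \<le> (1 + \<eta>) * dist s t" using ab by simp
      qed fact
    qed
    then have *: "\<bar>w p - w q\<bar> \<le> dist p q + \<eta> * dist p q" if "\<eta> > 0" for \<eta> using that by (simp add: distrib_right)
    show ?thesis
    proof (cases "p = q")
      case False
      have "\<bar>w p - w q\<bar> \<le> dist p q"
      proof (rule field_le_epsilon)
        fix \<epsilon> :: real assume "\<epsilon> > 0"
        then show "\<bar>w p - w q\<bar> \<le> dist p q + \<epsilon>" using *[of "\<epsilon> / dist p q"] False by simp
      qed
      then show ?thesis by (simp add: w_def)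
    qed simp
  qed
  have l: "(\<lambda>n. \<bar>sqrt (2 * (f p + k) + inverse (real (Suc n))) - sqrt (2 * (f q + k) + inverse (real (Suc n)))\<bar>)
      \<longlonglongrightarrow> \<bar>sqrt (2 * (f p + k) + 0) - sqrt (2 * (f q + k) + 0)\<bar>"
    by (intro tendsto_intros LIMSEQ_inverse_real_of_nat)
  have "\<bar>sqrt (2 * (f p + k) + 0) - sqrt (2 * (f q + k) + 0)\<bar> \<le> dist p q"
    by (rule LIMSEQ_le_const2[OF l]) (use reg in auto)
  then show ?thesis by simp
qed

section \<open>Absolute minimality in the absence of wells\<close>

lemma gsub_W1inf_loc:
  fixes u :: "'a::euclidean_space \<Rightarrow> real"
  assumes op: "open \<Omega>" and b: "bounded \<Omega>" and c: "continuous_on (closure \<Omega>) u" and u: "gsub 1 \<Omega> u"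
  shows "W1inf_loc \<Omega> u"
  unfolding W1inf_loc_def
proof (intro allI impI)
  fix V assume V: "open V \<and> compact (closure V) \<and> closure V \<subseteq> \<Omega>"
  obtain e where e: "e > 0" "(\<Union>y\<in>closure V. ball y e) \<subseteq> \<Omega>"
    using compact_subset_open_imp_ball_epsilon_subset[of "closure V" \<Omega>] V op by metis
  define R where "R = e / 2"
  have R: "R > 0" using e by (simp add: R_def)
  have cb: "cball p R \<subseteq> \<Omega>" if "p \<in> V" for p
  proof -
    have "cball p R \<subseteq> ball p e" using e by (auto simp: R_def)
    then show ?thesis using e(2) that closure_subset[of V] by blast
  qed
  obtain M where M: "\<And>x. x \<in> closure \<Omega> \<Longrightarrow> \<bar>u x\<bar> \<le> M" using continuous_bounded_range[OF b c] by blast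
  then have M': "\<And>x. x \<in> \<Omega> \<Longrightarrow> \<bar>u x\<bar> \<le> M" using closure_subset[of \<Omega>] by blast
  define L where "L = 2 * M / R + R"
  have ll: "loc_lip V L u"
    unfolding loc_lip_def
  proof
    fix x assume x: "x \<in> V"
    obtain r where r: "r > 0" "ball x r \<subseteq> V" using V x openE by blast
    show "\<exists>r>0. \<forall>p\<in>ball x r. \<forall>q\<in>ball x r. \<bar>u p - u q\<bar> \<le> L * dist p q"
    proof (intro exI[of _ "min r (R / 2)"] conjI ballI)
      show "min r (R / 2) > 0" using r R by simp
      fix p q assume p: "p \<in> ball x (min r (R / 2))" and q: "q \<in> ball x (min r (R / 2))"
      have "dist p q \<le> R" using p q dist_triangle2[of p q x] by (simp add: dist_commute)
      moreover have "p \<in> V" "q \<in> V" using p q r by auto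
      ultimately show "\<bar>u p - u q\<bar> \<le> L * dist p q"
        unfolding L_def by (intro gsub_locally_lipschitz[OF u R M'] cb)
    qed
  qed
  have bV: "bounded V" using V bounded_subset[of "closure V" V] closure_subset[of V] compact_imp_bounded by blast
  obtain G where G: "weak_grad V u G" using loc_lip_weak_grad_exists[OF _ bV ll] V by blast
  have Gb: "AE x in lborel. x \<in> V \<longrightarrow> norm (G x) \<le> L"
    by (rule weak_grad_bound[OF _ order_refl G ll]) (use V in blast)
  have "AE x in lborel. x \<in> V \<longrightarrow> \<bar>u x\<bar> \<le> M"
    by (rule AE_I2) (use M' V closure_subset[of V] in blast)
  moreover have "set_borel_measurable lborel V u" using G by (simp add: weak_grad_def)
  ultimately show "W1inf V u" unfolding W1inf_def using G Gb by blast
qed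

lemma no_well_imp_abs_minimizer:
  fixes u :: "'a::euclidean_space \<Rightarrow> real"
  assumes op: "open \<Omega>" and b: "bounded \<Omega>" and c: "continuous_on (closure \<Omega>) u"
    and u: "gsub 1 \<Omega> u" "gsub (-1) \<Omega> (\<lambda>x. - u x)" and nw: "\<not> has_well \<Omega> u"
  shows "abs_minimizer \<Omega> u"
  unfolding abs_minimizer_def
proof (intro conjI allI impI)
  show "W1inf_loc \<Omega> u" by (rule gsub_W1inf_loc[OF op b c u(1)])
  fix V f Gu Gf
  assume H: "open V \<and> compact (closure V) \<and> closure V \<subseteq> \<Omega> \<and> W1inf V f \<and> continuous_on (closure V) f \<and>
      (\<forall>x\<in>frontier V. u x = f x)"
    and W: "weak_grad V u Gu \<and> weak_grad V f Gf"
  have V: "open V" "closure V \<subseteq> \<Omega>" and fc: "continuous_on (closure V) f" and uf: "\<And>x. x \<in> frontier V \<Longrightarrow> u x = f x"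
    and Gu: "weak_grad V u Gu" and Gf: "weak_grad V f Gf"
    using H W by auto
  have VO: "V \<subseteq> \<Omega>" using V(2) closure_subset[of V] by blast
  have bV: "bounded V" using VO b bounded_subset by blast
  have uc: "continuous_on (closure V) u" using c V(2) closure_subset[of \<Omega>] by (meson continuous_on_subset)
  show "ess_H V u Gu \<le> ess_H V f Gf"
  \<comment> \<open>Levels \<open>z\<close> strictly above the energy of \<open>f\<close> leave room
    for the gap \<open>k < A\<close>; an infinite \<open>z\<close> is trivial or impossible.\<close>
  proof (rule dense_ge)
    fix z assume z: "ess_H V f Gf < z"
    show "ess_H V u Gu \<le> z"
    proof (cases z)
      case (real A)
      obtain k where k: "ess_H V f Gf < ereal k" "ereal k < z" using ereal_dense2[OF z] by blast
      have kA: "k < A" using k real by simp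
      have fk: "AE x in lborel. x \<in> V \<longrightarrow> (1/2) * (norm (Gf x))\<^sup>2 - f x \<le> k"
        using k(1) unfolding ess_H_le_iff[OF V(1) Gf, symmetric] by simp
      have flow: "- k \<le> f x" if "x \<in> closure V" for x by (rule competitor_lower_bound[OF V(1) fc fk that])
      have ulow: "- k \<le> u x" if x: "x \<in> V" for x
      proof -
        have Vne: "V \<noteq> {}" using x by blast
        \<comment> \<open>A nonempty bounded set has a frontier, so the infimum over
          \<open>frontier V\<close> is not the unspecified one of an empty set.\<close>
        have "V \<noteq> UNIV" using bV not_bounded_UNIV by auto
        then have fne: "frontier V \<noteq> {}" using Vne by (simp add: frontier_eq_empty)
        obtain M where M: "\<And>x. x \<in> closure V \<Longrightarrow> \<bar>u x\<bar> \<le> M" using continuous_bounded_range[OF bV uc] by blast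
        have bb: "bdd_below (u ` closure V)" unfolding bdd_below_def
          using M by (intro exI[of _ "- M"]) (force simp: abs_le_iff)
        have "- k \<le> u y" if "y \<in> frontier V" for y
          using uf[OF that] flow[of y] that by (simp add: frontier_def)
        then have "- k \<le> (INF x\<in>frontier V. u x)" by (rule cINF_greatest[OF fne])
        also have "\<dots> \<le> (INF x\<in>closure V. u x)" using nw V(1) Vne VO unfolding has_well_def by (meson not_le)
        also have "\<dots> \<le> u x" using x closure_subset[of V] by (intro cINF_lower[OF bb]) auto
        finally show ?thesis .
      qed
      \<comment> \<open>\<open>sqrt\<close> takes negative values at negative arguments, and
        \<open>F\<close> must be nonnegative also outside \<open>closure V\<close>, where nothing is
        known about \<open>f\<close>.\<close>
      define F where "F x = sqrt (max 0 (2 * (f x + k)))" for x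
      have F1: "\<bar>F p - F q\<bar> \<le> dist p q" if seg: "closed_segment p q \<subseteq> V" for p q
      proof -
        have "p \<in> closure V" "q \<in> closure V" using seg ends_in_segment[of p q] closure_subset[of V] by auto
        then have "F p = sqrt (2 * (f p + k))" "F q = sqrt (2 * (f q + k))"
          using flow[of p] flow[of q] by (auto simp: F_def max_def)
        then show ?thesis using competitor_transformed_lipschitz[OF V(1) fc Gf fk seg] by simp
      qed
      have Fbd: "u x = (F x)\<^sup>2 / 2 - k" if "x \<in> frontier V" for x
        using uf[OF that] flow[of x] that by (simp add: F_def frontier_def add_divide_distrib)
      have Fc: "continuous_on (closure V) F" unfolding F_def by (intro continuous_intros fc)
      define w where "w x = sqrt (2 * (u x + A))" for x
      have F0: "0 \<le> F x" for x by (simp add: F_def)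
      have wl1: "w t - w s \<le> dist s t" if "closed_segment s t \<subseteq> V" for s t
        unfolding w_def by (rule transformed_lipschitz[OF u op V(1) bV V(2) kA ulow Fc F0 F1 Fbd that])
      have wl: "\<bar>w s - w t\<bar> \<le> dist s t" if "closed_segment s t \<subseteq> V" for s t
        using wl1[OF that] wl1[of t s] that by (simp add: closed_segment_commute[of t s] dist_commute[of t s] abs_le_iff)
      have w2: "(w x)\<^sup>2 = 2 * (u x + A)" and wp: "w x > 0" if "x \<in> V" for x
        using ulow[OF that] kA by (simp_all add: w_def)
      have wc: "isCont w x" if "x \<in> V" for x
      proof -
        have "isCont u x" using u(1) op VO that unfolding gsub_def by (metis continuous_on_eq_continuous_at subsetD)
        then show ?thesis unfolding w_def by (intro continuous_intros)
      qed
      \<comment> \<open>Formally \<open>Du = w * Dw\<close> with \<open>Dw\<close> of norm at most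
        one. Where \<open>w\<close> varies by less than \<open>\<epsilon> / 2\<close>, factoring
        \<open>(w s)\<^sup>2 - (w t)\<^sup>2\<close> gives a Lipschitz constant of \<open>u\<close>
        that is at most \<open>w y + \<epsilon>\<close> at every point \<open>y\<close> of the
        ball.\<close>
      have Gw: "AE x in lborel. x \<in> V \<longrightarrow> norm (Gu x) \<le> w x + \<epsilon>" if \<epsilon>: "\<epsilon> > 0" for \<epsilon>
      proof -
        define \<B> where "\<B> = {B. open B \<and> B \<subseteq> V \<and> (\<exists>b. loc_lip B b u \<and> (\<forall>y\<in>B. b \<le> w y + \<epsilon>))}"
        have cov: "\<exists>B\<in>\<B>. x \<in> B" if x: "x \<in> V" for x
        proof -
          obtain d where d: "d > 0" "\<And>y. dist y x < d \<Longrightarrow> \<bar>w y - w x\<bar> < \<epsilon> / 2"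
            using wc[OF x, unfolded continuous_at_eps_delta dist_real_def] \<epsilon> by (metis half_gt_zero)
          obtain e where e: "e > 0" "ball x e \<subseteq> V" using V(1) x openE by blast
          define \<rho> where "\<rho> = min d e"
          have \<rho>: "\<rho> > 0" "ball x \<rho> \<subseteq> V" using d e by (auto simp: \<rho>_def)
          have near: "\<bar>w y - w x\<bar> < \<epsilon> / 2" if "y \<in> ball x \<rho>" for y
            using that by (intro d(2)) (simp add: \<rho>_def dist_commute)
          have lip: "\<bar>u s - u t\<bar> \<le> (w x + \<epsilon> / 2) * dist s t" if s: "s \<in> ball x \<rho>" and t: "t \<in> ball x \<rho>" for s t
          proof -
            have sV: "s \<in> V" and tV: "t \<in> V" using s t \<rho> by auto
            have "closed_segment s t \<subseteq> V"
              using closed_segment_subset[OF s t convex_ball] \<rho> by blast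
            then have 1: "\<bar>w s - w t\<bar> \<le> dist s t" by (rule wl)
            have "w s \<le> w x + \<epsilon> / 2" "w t \<le> w x + \<epsilon> / 2"
              using less_imp_le[OF near[OF s], THEN abs_le_D1] less_imp_le[OF near[OF t], THEN abs_le_D1] by simp_all
            then have 2: "\<bar>w s + w t\<bar> \<le> 2 * (w x + \<epsilon> / 2)" using wp[OF sV] wp[OF tV] by simp
            have "(w s - w t) * (w s + w t) = (w s)\<^sup>2 - (w t)\<^sup>2" by (simp add: power2_eq_square algebra_simps)
            then have "(w s - w t) * (w s + w t) = 2 * (u s - u t)" using w2[OF sV] w2[OF tV] by simp
            then have "2 * \<bar>u s - u t\<bar> = \<bar>w s - w t\<bar> * \<bar>w s + w t\<bar>" by (metis abs_mult abs_numeral)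
            also have "\<dots> \<le> dist s t * (2 * (w x + \<epsilon> / 2))" using 1 2 by (intro mult_mono) auto
            also have "\<dots> = 2 * ((w x + \<epsilon> / 2) * dist s t)" by simp
            finally show ?thesis by (rule mult_left_le_imp_le) simp
          qed
          have "loc_lip (ball x \<rho>) (w x + \<epsilon> / 2) u"
            unfolding loc_lip_def
          proof
            fix y assume "y \<in> ball x \<rho>"
            then obtain r where "r > 0" "ball y r \<subseteq> ball x \<rho>" using openE[OF open_ball] by blast
            then show "\<exists>r>0. \<forall>p\<in>ball y r. \<forall>q\<in>ball y r. \<bar>u p - u q\<bar> \<le> (w x + \<epsilon> / 2) * dist p q"
              using lip by blast
          qed
          moreover have "w x + \<epsilon> / 2 \<le> w y + \<epsilon>" if "y \<in> ball x \<rho>" for y using near[OF that] by linarith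
          ultimately have "ball x \<rho> \<in> \<B>" unfolding \<B>_def using \<rho> open_ball by blast
          then show ?thesis using \<rho> by (intro bexI[of _ "ball x \<rho>"]) auto
        qed
        \<comment> \<open>A countable subcover, since each member contributes its own exceptional
          null set.\<close>
        obtain \<C> where \<C>: "\<C> \<subseteq> \<B>" "countable \<C>" "\<Union>\<C> = \<Union>\<B>"
          by (rule Lindelof[of \<B>]) (auto simp: \<B>_def)
        have "AE x in lborel. \<forall>B\<in>\<C>. x \<in> B \<longrightarrow> norm (Gu x) \<le> w x + \<epsilon>"
        proof (rule AE_ball_countable'[OF _ \<C>(2)])
          fix B assume "B \<in> \<C>"
          then obtain b' where B: "open B" "B \<subseteq> V" "loc_lip B b' u" "\<And>y. y \<in> B \<Longrightarrow> b' \<le> w y + \<epsilon>"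
            using \<C>(1) unfolding \<B>_def by blast
          have "AE x in lborel. x \<in> B \<longrightarrow> norm (Gu x) \<le> b'" by (rule weak_grad_bound[OF B(1,2) Gu B(3)])
          then show "AE x in lborel. x \<in> B \<longrightarrow> norm (Gu x) \<le> w x + \<epsilon>"
            by eventually_elim (use B(4) order_trans in blast)
        qed
        then show ?thesis
        proof eventually_elim
          case (elim x)
          show ?case
          proof
            assume "x \<in> V"
            then have "x \<in> \<Union>\<C>" using cov \<C>(3) by blast
            then show "norm (Gu x) \<le> w x + \<epsilon>" using elim by blast
          qed
        qed
      qed
      have "AE x in lborel. \<forall>n. x \<in> V \<longrightarrow> norm (Gu x) \<le> w x + inverse (real (Suc n))"
        unfolding AE_all_countable by (intro allI Gw) simp
      then have "AE x in lborel. x \<in> V \<longrightarrow> (1/2) * (norm (Gu x))\<^sup>2 - u x \<le> A"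
      proof eventually_elim
        case (elim x)
        show ?case
        proof
          assume x: "x \<in> V"
          have l: "(\<lambda>n. w x + inverse (real (Suc n))) \<longlonglongrightarrow> w x + 0" by (intro tendsto_intros LIMSEQ_inverse_real_of_nat)
          have "norm (Gu x) \<le> w x + 0" by (rule LIMSEQ_le_const[OF l]) (use elim x in auto)
          then have "(norm (Gu x))\<^sup>2 \<le> (w x)\<^sup>2" by (intro power_mono) auto
          then show "(1/2) * (norm (Gu x))\<^sup>2 - u x \<le> A" using w2[OF x] by simp
        qed
      qed
      then show ?thesis unfolding real ess_H_le_iff[OF V(1) Gu, symmetric] .
    qed (use z in auto)
  qed
qed

theorem theorem3p1:
  fixes \<Omega> :: "'a::euclidean_space set" and g u :: "'a \<Rightarrow> real"
  assumes "open \<Omega>" and "bounded \<Omega>"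
    and "W1inf \<Omega> g" and "continuous_on (closure \<Omega>) g"
    and "continuous_on (closure \<Omega>) u"
    and "visc_sol_inflap_grad \<Omega> u"
    and "\<forall>x\<in>frontier \<Omega>. u x = g x"
  shows "(\<not> is_the_abs_minimizer \<Omega> g u \<longleftrightarrow> has_well \<Omega> u)
       \<and> (\<not> is_the_cont_value_fn \<Omega> g u \<longleftrightarrow> has_flat_piece \<Omega> u)
       \<and> ((\<not> is_the_abs_minimizer \<Omega> g u \<and> \<not> is_the_cont_value_fn \<Omega> g u)
            \<longleftrightarrow> (has_well \<Omega> u \<and> has_flat_piece \<Omega> u))"
proof -
  have "\<not> is_the_abs_minimizer \<Omega> g u \<longleftrightarrow> has_well \<Omega> u"
    using well_imp_not_abs_minimizer[OF assms(2,5)] assms(5,7)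
      no_well_imp_abs_minimizer[OF assms(1,2,5) gsub_if_visc_sol[OF assms(6)] gsub_uminus_if_visc_sol[OF assms(6)]]
    unfolding is_the_abs_minimizer_def by blast
  moreover have "\<not> is_the_cont_value_fn \<Omega> g u \<longleftrightarrow> has_flat_piece \<Omega> u"
    using flat_piece_imp_not_normalized[of \<Omega> u] no_flat_piece_imp_normalized[OF assms(1,6)] assms(5,7)
    unfolding is_the_cont_value_fn_def by blast
  ultimately show ?thesis by blast
qed

end
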